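(* Let $c,h,\alpha,\beta,c_1,h_1,\alpha_1,\beta_1\in\mathbb{C}$ with $0\le\mathfrak{Re}\,\alpha<1$, $0\le\mathfrak{Re}\,\alpha_1<1$, $\beta\ne1$ and $\beta_1\ne1$. Then $V(c,h)\otimes V'_{\alpha,\beta}\cong V(c_1,h_1)\otimes V'_{\alpha_1,\beta_1}$ as modules over the Virasoro algebra if and only if $c_1=c$, $h_1=h$, $\alpha_1=\alpha$ and $\beta_1=\beta$.
   Context: The Virasoro algebra $\mathrm{Vir}$ is the complex Lie algebra with basis $\{d_n, C : n\in\mathbb{Z}\}$ and brackets $[d_m,d_n]=(n-m)d_{m+n}+\delta_{n,-m}\frac{m^3-m}{12}C$, $[C,d_m]=0$. Put $\mathrm{Vir}_{+}=\sum_{i\ge1}\mathbb{C}d_{i}$. For $c,h\in\mathbb{C}$ let $\mathbb{C}u$ be the one-dimensional module over $\mathrm{Vir}_+\oplus\mathbb{C}d_0\oplus\mathbb{C}C$ with $\mathrm{Vir}_+u=0$, $d_0u=hu$, $Cu=cu$; the Verma module is $M(c,h)=U(\mathrm{Vir})\otimes_{U(\mathrm{Vir}_+\oplus\mathbb{C}d_0\oplus\mathbb{C}C)}\mathbb{C}u$, and $V(c,h)$ denotes its unique simple quotient $M(c,h)/J(c,h)$, where $J(c,h)$ is the unique maximal submodule. Intermediate series modules: $V_{\alpha,\beta}=\bigoplus_{n\in\mathbb{Z}}\mathbb{C}v_n$ with $d_m v_n=(\alpha+n+m\beta)v_{m+n}$ and $Cv_n=0$. When $0\le\mathfrak{Re}\,\alpha<1$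 and $\beta\ne1$, $V_{\alpha,\beta}$ is simple unless $(\alpha,\beta)=(0,0)$, in which case $\mathbb{C}v_0$ is its unique nonzero proper submodule. Set $V'_{0,0}=V_{0,0}/\mathbb{C}v_0$ and $V'_{\alpha,\beta}=V_{\alpha,\beta}$ otherwise. *)

theory Defs
  imports
    "HOL-Library.Poly_Mapping"
    "HOL-Algebra.Module"
    "HOL-Algebra.QuotRing"
    "HOL-Algebra.Algebraic_Closure_Type"
begin

section \<open>Complex vector spaces and free spaces\<close>

text \<open>
  Vector spaces are modules over the ring below, with an explicit carrier. The record
  of \<^locale>\<open>module\<close> also has the ring fields \<open>mult\<close> and \<open>one\<close>; they play no role
  for a mere vector space and are then left undefined.
\<close>

abbreviation complex_field :: "complex ring" where
  "complex_field \<equiv> ring_of_type_algebra"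

definition lin_span :: "(complex, 'v, 'm) module_scheme \<Rightarrow> 'v set \<Rightarrow> 'v set" where
  "lin_span M S = \<Inter>{H. submodule H complex_field M \<and> S \<subseteq> H}"

definition scale :: "complex \<Rightarrow> ('k \<Rightarrow>\<^sub>0 complex) \<Rightarrow> ('k \<Rightarrow>\<^sub>0 complex)" where
  "scale a = Poly_Mapping.map ((*) a)"

definition lin_ext :: "('k \<Rightarrow> ('n \<Rightarrow>\<^sub>0 complex)) \<Rightarrow> ('k \<Rightarrow>\<^sub>0 complex) \<Rightarrow> ('n \<Rightarrow>\<^sub>0 complex)" where
  "lin_ext f p = (\<Sum>k\<in>Poly_Mapping.keys p. scale (Poly_Mapping.lookup p k) (f k))"

abbreviation basis_vec :: "'k \<Rightarrow> ('k \<Rightarrow>\<^sub>0 complex)" where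
  "basis_vec k \<equiv> Poly_Mapping.single k 1"

lemma lookup_scale [simp]: "Poly_Mapping.lookup (scale a p) k = a * Poly_Mapping.lookup p k"
  by (simp add: scale_def Poly_Mapping.map.rep_eq when_def)

lemma scale_add_right: "scale a (p + q) = scale a p + scale a q"
  by (rule poly_mapping_eqI) (simp add: lookup_add distrib_left)

lemma scale_add_left: "scale (a + b) p = scale a p + scale b p"
  by (rule poly_mapping_eqI) (simp add: lookup_add distrib_right)

lemma scale_scale [simp]: "scale a (scale b p) = scale (a * b) p"
  by (rule poly_mapping_eqI) (simp add: mult.assoc)

lemma scale_one [simp]: "scale 1 p = p"
  by (rule poly_mapping_eqI) simp

lemma scale_zero_left [simp]: "scale 0 p = 0"
  by (rule poly_mapping_eqI) simp

lemma scale_zero_right [simp]: "scale a 0 = 0"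
  by (rule poly_mapping_eqI) simp

lemma scale_single [simp]: "scale a (Poly_Mapping.single k b) = Poly_Mapping.single k (a * b)"
  by (rule poly_mapping_eqI) (simp add: lookup_single when_def)

lemma scale_minus_right: "scale a (- p) = - scale a p"
  by (rule poly_mapping_eqI) simp

lemma scale_diff_right: "scale a (p - q) = scale a p - scale a q"
  by (rule poly_mapping_eqI) (simp add: lookup_minus right_diff_distrib)

lemma scale_sum_right: "scale a (\<Sum>i\<in>I. f i) = (\<Sum>i\<in>I. scale a (f i))"
  by (induction I rule: infinite_finite_induct) (simp_all add: scale_add_right)

lemma keys_scale: "Poly_Mapping.keys (scale a p) \<subseteq> Poly_Mapping.keys p"
  by (auto simp: in_keys_iff)

lemma lin_ext_superset:
  assumes "finite S" "Poly_Mapping.keys p \<subseteq> S"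
  shows "lin_ext f p = (\<Sum>k\<in>S. scale (Poly_Mapping.lookup p k) (f k))"
  unfolding lin_ext_def
  by (rule sum.mono_neutral_left) (use assms in \<open>auto simp: in_keys_iff\<close>)

lemma lin_ext_zero [simp]: "lin_ext f 0 = 0"
  by (simp add: lin_ext_def)

lemma lin_ext_add: "lin_ext f (p + q) = lin_ext f p + lin_ext f q"
proof -
  let ?S = "Poly_Mapping.keys p \<union> Poly_Mapping.keys q"
  have "lin_ext f (p + q) = (\<Sum>k\<in>?S. scale (Poly_Mapping.lookup (p + q) k) (f k))"
    by (rule lin_ext_superset) (simp_all add: Poly_Mapping.keys_add)
  moreover have "lin_ext f p = (\<Sum>k\<in>?S. scale (Poly_Mapping.lookup p k) (f k))"
    and "lin_ext f q = (\<Sum>k\<in>?S. scale (Poly_Mapping.lookup q k) (f k))"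
    by (rule lin_ext_superset; simp)+
  ultimately show ?thesis
    by (simp add: lookup_add scale_add_left sum.distrib)
qed

lemma lin_ext_scale: "lin_ext f (scale a p) = scale a (lin_ext f p)"
  by (simp add: lin_ext_superset[OF finite_keys keys_scale] scale_sum_right) (simp add: lin_ext_def scale_sum_right)

lemma lin_ext_single [simp]: "lin_ext f (Poly_Mapping.single k a) = scale a (f k)"
  by (simp add: lin_ext_superset[of "{k}"])

lemma lin_ext_minus: "lin_ext f (- p) = - lin_ext f p"
  by (metis add_eq_0_iff lin_ext_add lin_ext_zero)

lemma lin_ext_diff: "lin_ext f (p - q) = lin_ext f p - lin_ext f q"
  using lin_ext_add[of f p "- q"] by (simp add: lin_ext_minus)

lemma lin_ext_add_fun: "lin_ext (\<lambda>k. f k + g k) p = lin_ext f p + lin_ext g p"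
  by (simp add: lin_ext_def scale_add_right sum.distrib)

lemma lin_ext_scale_fun: "lin_ext (\<lambda>k. scale a (f k)) p = scale a (lin_ext f p)"
  by (simp add: lin_ext_def scale_sum_right mult.commute)

lemma free_space_induct [case_names zero basis add scale]:
  assumes "P 0" "\<And>k. P (basis_vec k)" "\<And>p q. P p \<Longrightarrow> P q \<Longrightarrow> P (p + q)"
    "\<And>a p. P p \<Longrightarrow> P (scale a p)"
  shows "P p"
proof -
  have "P (\<Sum>k\<in>S. scale (Poly_Mapping.lookup p k) (basis_vec k))" if "finite S" for S
    using that by induction (auto simp del: scale_single intro!: assms)
  moreover have "p = (\<Sum>k\<in>Poly_Mapping.keys p. scale (Poly_Mapping.lookup p k) (basis_vec k))"
    by (rule poly_mapping_eqI) (simp add: lookup_sum lookup_single when_def in_keys_iff)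
  ultimately show ?thesis by (metis finite_keys)
qed

lemma lookup_lin_ext:
  "Poly_Mapping.lookup (lin_ext f p) k =
    (\<Sum>i\<in>Poly_Mapping.keys p. Poly_Mapping.lookup p i * Poly_Mapping.lookup (f i) k)"
  by (simp add: lin_ext_def lookup_sum)

lemma module_free:
  assumes "carrier M = {p. Poly_Mapping.keys p \<subseteq> K}" "zero M = 0" "add M = (+)" "module.smult M = scale"
  shows "module complex_field M"
proof (rule moduleI)
  show "cring complex_field" by (rule cring_from_type_algebra)
  show "abelian_group M"
  proof (rule abelian_groupI)
    fix x assume "x \<in> carrier M"
    then show "\<exists>y\<in>carrier M. y \<oplus>\<^bsub>M\<^esub> x = \<zero>\<^bsub>M\<^esub>"
      by (intro bexI[of _ "- x"]) (auto simp: assms)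
  qed (use Poly_Mapping.keys_add in \<open>fastforce simp: assms ac_simps\<close>)+
qed (auto dest: subsetD[OF keys_scale] simp: assms ring_of_type_algebra_def scale_add_left scale_add_right)

lemma a_minus_free:
  assumes "Module.module complex_field M" "carrier M = UNIV" "zero M = 0" "add M = (+)"
  shows "v \<ominus>\<^bsub>M\<^esub> w = v - (w :: 'k \<Rightarrow>\<^sub>0 complex)"
proof -
  interpret Module.module complex_field M by fact
  have "\<ominus>\<^bsub>M\<^esub> w = - w"
    by (rule M.minus_equality) (simp_all add: assms)
  then show ?thesis by (simp add: a_minus_def assms)
qed


section \<open>Lie algebras and their modules\<close>

record 'l lie_alg = "(complex, 'l) module" +
  bracket :: "'l \<Rightarrow> 'l \<Rightarrow> 'l"

locale lie_algebra = module complex_field L for L :: "('l, 'm) lie_alg_scheme" (structure) +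
  assumes bracket_closed:
      "\<lbrakk>x \<in> carrier L; y \<in> carrier L\<rbrakk> \<Longrightarrow> bracket L x y \<in> carrier L"
    and bracket_add_left:
      "\<lbrakk>x \<in> carrier L; y \<in> carrier L; z \<in> carrier L\<rbrakk> \<Longrightarrow>
        bracket L (x \<oplus> y) z = bracket L x z \<oplus> bracket L y z"
    and bracket_add_right:
      "\<lbrakk>x \<in> carrier L; y \<in> carrier L; z \<in> carrier L\<rbrakk> \<Longrightarrow>
        bracket L x (y \<oplus> z) = bracket L x y \<oplus> bracket L x z"
    and bracket_smult_left:
      "\<lbrakk>x \<in> carrier L; y \<in> carrier L\<rbrakk> \<Longrightarrow> bracket L (a \<odot> x) y = a \<odot> bracket L x y"
    and bracket_smult_right:
      "\<lbrakk>x \<in> carrier L; y \<in> carrier L\<rbrakk> \<Longrightarrow> bracket L x (a \<odot> y) = a \<odot> bracket L x y"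
    and bracket_self: "x \<in> carrier L \<Longrightarrow> bracket L x x = \<zero>"
    and jacobi:
      "\<lbrakk>x \<in> carrier L; y \<in> carrier L; z \<in> carrier L\<rbrakk> \<Longrightarrow>
        bracket L x (bracket L y z) \<oplus> bracket L y (bracket L z x) \<oplus> bracket L z (bracket L x y) = \<zero>"

record ('l, 'v) lie_rep = "(complex, 'v) module" +
  act :: "'l \<Rightarrow> 'v \<Rightarrow> 'v"

locale lie_module = L?: lie_algebra L + M?: module complex_field M
  for L :: "('l, 'm) lie_alg_scheme" and M :: "('l, 'v, 'n) lie_rep_scheme" +
  assumes act_closed:
      "\<lbrakk>x \<in> carrier L; v \<in> carrier M\<rbrakk> \<Longrightarrow> act M x v \<in> carrier M"
    and act_add_left:
      "\<lbrakk>x \<in> carrier L; y \<in> carrier L; v \<in> carrier M\<rbrakk> \<Longrightarrow>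
        act M (x \<oplus>\<^bsub>L\<^esub> y) v = act M x v \<oplus>\<^bsub>M\<^esub> act M y v"
    and act_smult_left:
      "\<lbrakk>x \<in> carrier L; v \<in> carrier M\<rbrakk> \<Longrightarrow> act M (a \<odot>\<^bsub>L\<^esub> x) v = a \<odot>\<^bsub>M\<^esub> act M x v"
    and act_add_right:
      "\<lbrakk>x \<in> carrier L; v \<in> carrier M; w \<in> carrier M\<rbrakk> \<Longrightarrow>
        act M x (v \<oplus>\<^bsub>M\<^esub> w) = act M x v \<oplus>\<^bsub>M\<^esub> act M x w"
    and act_smult_right:
      "\<lbrakk>x \<in> carrier L; v \<in> carrier M\<rbrakk> \<Longrightarrow> act M x (a \<odot>\<^bsub>M\<^esub> v) = a \<odot>\<^bsub>M\<^esub> act M x v"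
    and act_bracket:
      "\<lbrakk>x \<in> carrier L; y \<in> carrier L; v \<in> carrier M\<rbrakk> \<Longrightarrow>
        act M (bracket L x y) v = act M x (act M y v) \<ominus>\<^bsub>M\<^esub> act M y (act M x v)"

definition lie_submodule ::
  "('l, 'm) lie_alg_scheme \<Rightarrow> ('l, 'v, 'n) lie_rep_scheme \<Rightarrow> 'v set \<Rightarrow> bool" where
  "lie_submodule L M N \<longleftrightarrow>
    submodule N complex_field M \<and> (\<forall>x\<in>carrier L. \<forall>v\<in>N. act M x v \<in> N)"

definition maximal_lie_submodule ::
  "('l, 'm) lie_alg_scheme \<Rightarrow> ('l, 'v, 'n) lie_rep_scheme \<Rightarrow> 'v set \<Rightarrow> bool" where
  "maximal_lie_submodule L M N \<longleftrightarrow>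
    lie_submodule L M N \<and> N \<noteq> carrier M \<and>
    (\<forall>K. lie_submodule L M K \<and> N \<subseteq> K \<longrightarrow> K = N \<or> K = carrier M)"

definition lie_quotient :: "('l, 'v, 'n) lie_rep_scheme \<Rightarrow> 'v set \<Rightarrow> ('l, 'v set) lie_rep" where
  "lie_quotient M N =
    \<lparr>carrier = a_rcosets\<^bsub>M\<^esub> N, monoid.mult = undefined, one = undefined, zero = N, add = set_add M,
      module.smult = (\<lambda>a A. \<Union>v\<in>A. N +>\<^bsub>M\<^esub> (a \<odot>\<^bsub>M\<^esub> v)),
      act = (\<lambda>x A. \<Union>v\<in>A. N +>\<^bsub>M\<^esub> act M x v)\<rparr>"

definition lie_module_isomorphic ::
  "('l, 'm) lie_alg_scheme \<Rightarrow> ('l, 'v, 'n) lie_rep_scheme \<Rightarrow> ('l, 'w, 'p) lie_rep_scheme \<Rightarrow> bool" where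
  "lie_module_isomorphic L M N \<longleftrightarrow>
    (\<exists>f \<in> iso (add_monoid M) (add_monoid N).
      (\<forall>a. \<forall>v\<in>carrier M. f (a \<odot>\<^bsub>M\<^esub> v) = a \<odot>\<^bsub>N\<^esub> f v) \<and>
      (\<forall>x\<in>carrier L. \<forall>v\<in>carrier M. f (act M x v) = act N x (f v)))"

text \<open>
  The complex space with basis \<open>K\<close> on which \<open>x\<close> acts by the linear operator sending the
  basis vector \<open>k\<close> to \<open>\<phi> x k\<close>. Depending on \<open>\<phi>\<close>, this is a Lie module only
  after passing to a quotient.
\<close>

definition free_rep :: "'k set \<Rightarrow> ('l \<Rightarrow> 'k \<Rightarrow> ('k \<Rightarrow>\<^sub>0 complex)) \<Rightarrow> ('l, 'k \<Rightarrow>\<^sub>0 complex) lie_rep" where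
  "free_rep K \<phi> =
    \<lparr>carrier = {p. Poly_Mapping.keys p \<subseteq> K}, monoid.mult = undefined, one = undefined,
      zero = 0, add = (+), module.smult = scale, act = (\<lambda>x. lin_ext (\<phi> x))\<rparr>"


section \<open>Tensor products of modules over a Lie algebra\<close>

definition bilinear_relations ::
  "(complex, 'v, 'm) module_scheme \<Rightarrow> (complex, 'w, 'n) module_scheme \<Rightarrow> ('v \<times> 'w \<Rightarrow>\<^sub>0 complex) set" where
  "bilinear_relations V W =
    {basis_vec (v \<oplus>\<^bsub>V\<^esub> v', w) - basis_vec (v, w) - basis_vec (v', w) |v v' w.
      v \<in> carrier V \<and> v' \<in> carrier V \<and> w \<in> carrier W} \<union>
    {basis_vec (v, w \<oplus>\<^bsub>W\<^esub> w') - basis_vec (v, w) - basis_vec (v, w') |v w w'.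
      v \<in> carrier V \<and> w \<in> carrier W \<and> w' \<in> carrier W} \<union>
    {basis_vec (a \<odot>\<^bsub>V\<^esub> v, w) - scale a (basis_vec (v, w)) |a v w.
      v \<in> carrier V \<and> w \<in> carrier W} \<union>
    {basis_vec (v, a \<odot>\<^bsub>W\<^esub> w) - scale a (basis_vec (v, w)) |a v w.
      v \<in> carrier V \<and> w \<in> carrier W}"

definition lie_tensor ::
  "('l, 'v, 'm) lie_rep_scheme \<Rightarrow> ('l, 'w, 'n) lie_rep_scheme \<Rightarrow> ('l, ('v \<times> 'w \<Rightarrow>\<^sub>0 complex) set) lie_rep" where
  "lie_tensor V W =
    (let F = free_rep (carrier V \<times> carrier W)
           (\<lambda>x (v, w). basis_vec (act V x v, w) + basis_vec (v, act W x w))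
     in lie_quotient F (lin_span F (bilinear_relations V W)))"


section \<open>The universal enveloping algebra\<close>

datatype 'a fword = FWord (letters: "'a list")

instantiation fword :: (type) monoid_add
begin

definition zero_fword :: "'a fword" where "zero_fword = FWord []"

definition plus_fword :: "'a fword \<Rightarrow> 'a fword \<Rightarrow> 'a fword" where
  "plus_fword u v = FWord (letters u @ letters v)"

instance by standard (simp_all add: zero_fword_def plus_fword_def)

end

text \<open>
  Words under concatenation form an additive monoid, so the convolution product on
  finitely supported functions on words is that of the free associative algebra.
\<close>

definition free_algebra :: "'a set \<Rightarrow> ('a fword \<Rightarrow>\<^sub>0 complex) ring" where
  "free_algebra A =
    \<lparr>carrier = {p. \<forall>w\<in>Poly_Mapping.keys p. set (letters w) \<subseteq> A},
      monoid.mult = (*), one = 1, zero = 0, add = (+)\<rparr>"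

abbreviation gen :: "'a \<Rightarrow> ('a fword \<Rightarrow>\<^sub>0 complex)" where
  "gen x \<equiv> basis_vec (FWord [x])"

text \<open>
  The free algebra on the set \<open>carrier L\<close> modulo the first two families of relations
  is the tensor algebra of \<open>L\<close>.
\<close>

definition uea_relations :: "('l, 'm) lie_alg_scheme \<Rightarrow> ('l fword \<Rightarrow>\<^sub>0 complex) set" where
  "uea_relations L =
    {gen (x \<oplus>\<^bsub>L\<^esub> y) - gen x - gen y |x y. x \<in> carrier L \<and> y \<in> carrier L} \<union>
    {gen (a \<odot>\<^bsub>L\<^esub> x) - scale a (gen x) |a x. x \<in> carrier L} \<union>
    {gen x * gen y - gen y * gen x - gen (bracket L x y) |x y. x \<in> carrier L \<and> y \<in> carrier L}"

definition uea_ideal :: "('l, 'm) lie_alg_scheme \<Rightarrow> ('l fword \<Rightarrow>\<^sub>0 complex) set" where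
  "uea_ideal L = Idl\<^bsub>free_algebra (carrier L)\<^esub> (uea_relations L)"

definition uea_class :: "('l, 'm) lie_alg_scheme \<Rightarrow> ('l fword \<Rightarrow>\<^sub>0 complex) \<Rightarrow> ('l fword \<Rightarrow>\<^sub>0 complex) set" where
  "uea_class L p = uea_ideal L +>\<^bsub>free_algebra (carrier L)\<^esub> p"

definition uea :: "('l, 'm) lie_alg_scheme \<Rightarrow> (complex, ('l fword \<Rightarrow>\<^sub>0 complex) set) module" where
  "uea L = ring.extend (free_algebra (carrier L) Quot uea_ideal L)
    (module.fields (\<lambda>a A. \<Union>p\<in>A. uea_class L (scale a p)))"

lemma uea_simps:
  "carrier (uea L) = a_rcosets\<^bsub>free_algebra (carrier L)\<^esub> uea_ideal L"
  "monoid.mult (uea L) = rcoset_mult (free_algebra (carrier L)) (uea_ideal L)"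
  "one (uea L) = uea_class L 1"
  "zero (uea L) = uea_ideal L"
  "add (uea L) = set_add (free_algebra (carrier L))"
  "module.smult (uea L) = (\<lambda>a A. \<Union>p\<in>A. uea_class L (scale a p))"
  by (simp_all add: uea_def FactRing_def ring.defs module.defs uea_class_def free_algebra_def)

definition free_algebra_act :: "('l, 'v, 'n) lie_rep_scheme \<Rightarrow> ('l fword \<Rightarrow>\<^sub>0 complex) \<Rightarrow> 'v \<Rightarrow> 'v" where
  "free_algebra_act M p v =
    (\<Oplus>\<^bsub>M\<^esub> w\<in>Poly_Mapping.keys p. Poly_Mapping.lookup p w \<odot>\<^bsub>M\<^esub> foldr (act M) (letters w) v)"

text \<open>
  On a Lie module all representatives of a class in the enveloping algebra act alike.
\<close>

definition uea_act :: "('l, 'v, 'n) lie_rep_scheme \<Rightarrow> ('l fword \<Rightarrow>\<^sub>0 complex) set \<Rightarrow> 'v \<Rightarrow> 'v" where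
  "uea_act M A v = the_elem ((\<lambda>p. free_algebra_act M p v) ` A)"

text \<open>
  The induced module \<open>U(L) \<otimes> N\<close>, with the tensor product taken over \<open>U(B)\<close>, for a subalgebra
  \<open>B\<close> of \<open>L\<close> and a \<open>B\<close>-module \<open>N\<close>. The algebra \<open>U(B)\<close> acts on \<open>U(L)\<close> from the right
  through the canonical homomorphism \<open>U(B) \<rightarrow> U(L)\<close>.
\<close>

definition uea_incl ::
  "('l, 'm) lie_alg_scheme \<Rightarrow> ('l fword \<Rightarrow>\<^sub>0 complex) set \<Rightarrow> ('l fword \<Rightarrow>\<^sub>0 complex) set" where
  "uea_incl L A = (\<Union>p\<in>A. uea_class L p)"

definition balanced_relations ::
  "('l, 'm) lie_alg_scheme \<Rightarrow> ('l, 'm) lie_alg_scheme \<Rightarrow> ('l, 'v, 'n) lie_rep_scheme \<Rightarrow>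
    (('l fword \<Rightarrow>\<^sub>0 complex) set \<times> 'v \<Rightarrow>\<^sub>0 complex) set" where
  "balanced_relations L B N =
    {basis_vec (u \<otimes>\<^bsub>uea L\<^esub> uea_incl L r, n) - basis_vec (u, uea_act N r n) |u r n.
      u \<in> carrier (uea L) \<and> r \<in> carrier (uea B) \<and> n \<in> carrier N}"

definition induced_module ::
  "('l, 'm) lie_alg_scheme \<Rightarrow> ('l, 'm) lie_alg_scheme \<Rightarrow> ('l, 'v, 'n) lie_rep_scheme \<Rightarrow>
    ('l, (('l fword \<Rightarrow>\<^sub>0 complex) set \<times> 'v \<Rightarrow>\<^sub>0 complex) set) lie_rep" where
  "induced_module L B N =
    (let F = free_rep (carrier (uea L) \<times> carrier N)
           (\<lambda>x (u, n). basis_vec (uea_class L (gen x) \<otimes>\<^bsub>uea L\<^esub> u, n))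
     in lie_quotient F (lin_span F (bilinear_relations (uea L) N \<union> balanced_relations L B N)))"


section \<open>The Virasoro algebra\<close>

datatype vir_basis = Vd int | VC

type_synonym vir = "vir_basis \<Rightarrow>\<^sub>0 complex"

fun vir_basis_bracket :: "vir_basis \<Rightarrow> vir_basis \<Rightarrow> vir" where
  "vir_basis_bracket (Vd m) (Vd n) =
    scale (of_int (n - m)) (basis_vec (Vd (m + n))) +
    (if n = - m then scale (of_int (m ^ 3 - m) / 12) (basis_vec VC) else 0)"
| "vir_basis_bracket _ _ = 0"

definition Vir :: "vir lie_alg" where
  "Vir =
    \<lparr>carrier = UNIV, monoid.mult = undefined, one = undefined, zero = 0, add = (+), module.smult = scale,
      bracket = (\<lambda>x y. lin_ext (\<lambda>i. lin_ext (vir_basis_bracket i) y) x)\<rparr>"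

lemma Vir_bracket_simps:
  "bracket Vir (x + y) z = bracket Vir x z + bracket Vir y z"
  "bracket Vir x (y + z) = bracket Vir x y + bracket Vir x z"
  "bracket Vir (scale a x) y = scale a (bracket Vir x y)"
  "bracket Vir x (scale a y) = scale a (bracket Vir x y)"
  "bracket Vir 0 y = 0" "bracket Vir x 0 = 0"
  by (simp_all add: Vir_def lin_ext_add lin_ext_scale lin_ext_add_fun lin_ext_scale_fun)
     (simp add: lin_ext_def)

lemma Vir_bracket_basis: "bracket Vir (basis_vec i) (basis_vec j) = vir_basis_bracket i j"
  by (simp add: Vir_def)

lemma Vir_bracket_skew: "bracket Vir x y = - bracket Vir y x"
proof -
  have on_basis: "vir_basis_bracket i j + vir_basis_bracket j i = 0" for i j
  proof (cases "\<exists>m n. i = Vd m \<and> j = Vd n")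
    case True
    then obtain m n where ij: "i = Vd m" "j = Vd n" by blast
    show ?thesis
    proof (rule poly_mapping_eqI)
      fix k
      show "Poly_Mapping.lookup (vir_basis_bracket i j + vir_basis_bracket j i) k = Poly_Mapping.lookup 0 k"
        by (cases k) (auto simp: ij lookup_add lookup_single when_def power3_eq_cube add_divide_distrib[symmetric])
    qed
  next
    case False
    then show ?thesis by (cases i; cases j) auto
  qed
  let ?S = "\<lambda>x y. bracket Vir x y + bracket Vir y x"
  have add: "?S (u + x) y = ?S u y + ?S x y" "?S x (u + y) = ?S x u + ?S x y" for u x y
    by (simp_all add: Vir_bracket_simps)
  have scale: "?S (scale a x) y = scale a (?S x y)" "?S x (scale a y) = scale a (?S x y)" for a x y
    by (simp_all add: Vir_bracket_simps scale_add_right)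
  have zero: "?S 0 y = 0" "?S x 0 = 0" for x y by (simp_all add: Vir_bracket_simps)
  have "?S x y = 0"
  proof (induction x rule: free_space_induct)
    case (basis i)
    show ?case
    proof (induction y rule: free_space_induct)
      case (basis j)
      show ?case by (simp only: Vir_bracket_basis on_basis)
    qed (simp_all only: add scale zero scale_zero_right add_0)
  qed (simp_all only: add scale zero scale_zero_right add_0)
  then show ?thesis by (simp only: add_eq_0_iff2)
qed

lemma Vir_bracket_Vd_single:
  "bracket Vir (basis_vec (Vd l)) (Poly_Mapping.single (Vd p) a) =
    Poly_Mapping.single (Vd (l + p)) (a * of_int (p - l)) +
    Poly_Mapping.single VC (if p = - l then a * (of_int (l ^ 3 - l) / 12) else 0)"
  "bracket Vir (basis_vec (Vd l)) (Poly_Mapping.single VC a) = 0"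
  by (simp_all add: Vir_def scale_add_right)

lemma vir_basis_jacobi:
  "bracket Vir (basis_vec (Vd l)) (bracket Vir (basis_vec (Vd m)) (basis_vec (Vd n))) +
   bracket Vir (basis_vec (Vd m)) (bracket Vir (basis_vec (Vd n)) (basis_vec (Vd l))) +
   bracket Vir (basis_vec (Vd n)) (bracket Vir (basis_vec (Vd l)) (basis_vec (Vd m))) = 0"
proof -
  define e :: complex where "e = (if l + m + n = 0 then 1 / 12 else 0)"
  define \<omega> :: "int \<Rightarrow> int \<Rightarrow> int \<Rightarrow> complex" where
    "\<omega> x y z = e * of_int ((z - y) * (x ^ 3 - x))" for x y z
  have t: "bracket Vir (basis_vec (Vd x)) (bracket Vir (basis_vec (Vd y)) (basis_vec (Vd z))) =
      Poly_Mapping.single (Vd (l + m + n)) (of_int ((z - y) * (y + z - x))) +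
      Poly_Mapping.single VC (\<omega> x y z)" if "x + y + z = l + m + n" for x y z
  proof -
    have "y + z = - x \<longleftrightarrow> l + m + n = 0" "x + (y + z) = l + m + n" using that by auto
    then show ?thesis
      by (simp add: Vir_bracket_Vd_single Vir_bracket_simps \<omega>_def e_def)
  qed
  have "(n - m) * (m + n - l) + (l - n) * (n + l - m) + (m - l) * (l + m - n) = 0"
    by (simp add: algebra_simps)
  then have 1: "of_int ((n - m) * (m + n - l)) + of_int ((l - n) * (n + l - m))
      + of_int ((m - l) * (l + m - n)) = (0 :: complex)"
    by (metis of_int_0 of_int_add)
  have 2: "\<omega> l m n + \<omega> m n l + \<omega> n l m = 0"
  proof (cases "l + m + n = 0")
    case True
    then have n: "n = - l - m" by simp
    have "(n - m) * (l ^ 3 - l) + (l - n) * (m ^ 3 - m) + (m - l) * (n ^ 3 - n) = 0"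
      unfolding n by (simp add: algebra_simps power3_eq_cube)
    then show ?thesis
      unfolding \<omega>_def by (metis distrib_left mult_zero_right of_int_0 of_int_add)
  qed (simp add: \<omega>_def e_def)
  have "Poly_Mapping.single (Vd (l + m + n)) (of_int ((n - m) * (m + n - l)) + of_int ((l - n) * (n + l - m))
      + of_int ((m - l) * (l + m - n))) +
     Poly_Mapping.single VC (\<omega> l m n + \<omega> m n l + \<omega> n l m) = (0 :: vir)"
    unfolding 1 2 by simp
  then show ?thesis
    by (subst (1 2 3) t) (simp_all add: single_add ac_simps del: of_int_mult of_int_add of_int_diff)
qed

lemma Vir_jacobi:
  "bracket Vir x (bracket Vir y z) + bracket Vir y (bracket Vir z x) + bracket Vir z (bracket Vir x y) = 0"
  (is "?J x y z = 0")
proof -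
  have on_basis: "?J (basis_vec i) (basis_vec j) (basis_vec k) = 0" for i j k
  proof (cases "i = VC \<or> j = VC \<or> k = VC")
    case True
    have "bracket Vir (basis_vec VC) u = 0" for u
      by (simp add: Vir_def) (simp add: lin_ext_def)
    moreover from this have "bracket Vir u (basis_vec VC) = 0" for u
      using Vir_bracket_skew[of u] by simp
    ultimately show ?thesis using True by (auto simp: Vir_bracket_simps)
  next
    case False
    then obtain l m n where "i = Vd l" "j = Vd m" "k = Vd n"
      by (metis vir_basis.exhaust)
    then show ?thesis
      by (simp add: vir_basis_jacobi)
  qed
  have add: "?J (u + x) y z = ?J u y z + ?J x y z" "?J x (u + y) z = ?J x u z + ?J x y z" "?J x y (u + z) = ?J x y u + ?J x y z" for u x y z
    by (simp_all add: Vir_bracket_simps)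
  have scale: "?J (scale a x) y z = scale a (?J x y z)" "?J x (scale a y) z = scale a (?J x y z)" "?J x y (scale a z) = scale a (?J x y z)" for a x y z
    by (simp_all add: Vir_bracket_simps scale_add_right)
  have zero: "?J 0 y z = 0" "?J x 0 z = 0" "?J x y 0 = 0" for x y z by (simp_all add: Vir_bracket_simps)
  show ?thesis
  proof (induction x rule: free_space_induct)
    case (basis i)
    show ?case
    proof (induction y rule: free_space_induct)
      case (basis j)
      show ?case
        by (induction z rule: free_space_induct) (simp_all only: on_basis add scale zero scale_zero_right add_0)
    qed (simp_all only: add scale zero scale_zero_right add_0)
  qed (simp_all only: add scale zero scale_zero_right add_0)
qed

lemma lie_algebra_Vir: "lie_algebra Vir"
proof (intro lie_algebra.intro lie_algebra_axioms.intro)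
  show "Module.module complex_field Vir"
    by (rule module_free[of _ UNIV]) (simp_all add: Vir_def)
  fix x show "bracket Vir x x = \<zero>\<^bsub>Vir\<^esub>"
  proof (rule poly_mapping_eqI)
    fix k
    have "Poly_Mapping.lookup (bracket Vir x x) k = - Poly_Mapping.lookup (bracket Vir x x) k"
      by (subst Vir_bracket_skew) simp
    then show "Poly_Mapping.lookup (bracket Vir x x) k = Poly_Mapping.lookup \<zero>\<^bsub>Vir\<^esub> k"
      by (simp add: Vir_def)
  qed
next
  fix x y z
  show "bracket Vir x (bracket Vir y z) \<oplus>\<^bsub>Vir\<^esub> bracket Vir y (bracket Vir z x) \<oplus>\<^bsub>Vir\<^esub>
    bracket Vir z (bracket Vir x y) = \<zero>\<^bsub>Vir\<^esub>"
    using Vir_jacobi[of x y z] by (simp add: Vir_def)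
qed (use Vir_bracket_simps in \<open>simp_all add: Vir_def\<close>)

text \<open>The subalgebra spanned by \<open>C\<close> and the \<open>d\<^sub>i\<close> with \<open>i \<ge> 0\<close>.\<close>

definition Vir_nonneg :: "vir lie_alg" where
  "Vir_nonneg = Vir\<lparr>carrier := {x. \<forall>i < 0. Poly_Mapping.lookup x (Vd i) = 0}\<rparr>"

lemma Vir_nonneg_bracket:
  assumes "x \<in> carrier Vir_nonneg" "y \<in> carrier Vir_nonneg" "k \<le> 0"
  shows "Poly_Mapping.lookup (bracket Vir x y) (Vd k) = 0"
    and "Poly_Mapping.lookup (bracket Vir x y) VC = 0"
proof -
  have "Poly_Mapping.lookup (vir_basis_bracket i j) (Vd k) = 0 \<and>
      Poly_Mapping.lookup (vir_basis_bracket i j) VC = 0"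
    if "i \<in> Poly_Mapping.keys x" "j \<in> Poly_Mapping.keys y" for i j
  proof (cases "\<exists>m n. i = Vd m \<and> j = Vd n")
    case True
    then obtain m n where ij: "i = Vd m" "j = Vd n" by blast
    then have "0 \<le> m" "0 \<le> n"
      using that assms by (auto simp: Vir_nonneg_def in_keys_iff not_less[symmetric])
    then show ?thesis
      using assms(3) by (auto simp: ij lookup_add lookup_single when_def)
  next
    case False
    then show ?thesis by (cases i; cases j) auto
  qed
  then show "Poly_Mapping.lookup (bracket Vir x y) (Vd k) = 0"
    "Poly_Mapping.lookup (bracket Vir x y) VC = 0"
    by (simp_all add: Vir_def lookup_lin_ext)
qed

lemma lie_algebra_Vir_nonneg: "lie_algebra Vir_nonneg"
proof -
  interpret V: lie_algebra Vir by (rule lie_algebra_Vir)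
  have uminus: "\<ominus>\<^bsub>Vir\<^esub> x = - x" for x
    by (rule V.M.minus_equality) (simp_all add: Vir_def)
  have "submodule (carrier Vir_nonneg) complex_field Vir"
    by (rule V.submoduleI) (auto simp: uminus, auto simp: Vir_nonneg_def Vir_def lookup_add)
  then have "Module.module complex_field (Vir\<lparr>carrier := carrier Vir_nonneg\<rparr>)"
    by (rule submodule.submodule_is_module) (rule V.module_axioms)
  then have *: "Module.module complex_field Vir_nonneg"
    by (simp add: Vir_nonneg_def)
  show ?thesis
  proof (intro lie_algebra.intro lie_algebra_axioms.intro *)
    fix x y assume "x \<in> carrier Vir_nonneg" "y \<in> carrier Vir_nonneg"
    then show "bracket Vir_nonneg x y \<in> carrier Vir_nonneg"
      using Vir_nonneg_bracket(1) by (simp add: Vir_nonneg_def)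
  next
    have eqs: "add Vir_nonneg = add Vir" "module.smult Vir_nonneg = module.smult Vir"
      "zero Vir_nonneg = zero Vir" "bracket Vir_nonneg = bracket Vir"
      by (simp_all add: Vir_nonneg_def)
    have V: "v \<in> carrier Vir" for v by (simp add: Vir_def)
    fix x y z a
    show "bracket Vir_nonneg (x \<oplus>\<^bsub>Vir_nonneg\<^esub> y) z = bracket Vir_nonneg x z \<oplus>\<^bsub>Vir_nonneg\<^esub> bracket Vir_nonneg y z"
      unfolding eqs by (rule V.bracket_add_left[OF V V V])
    show "bracket Vir_nonneg x (y \<oplus>\<^bsub>Vir_nonneg\<^esub> z) = bracket Vir_nonneg x y \<oplus>\<^bsub>Vir_nonneg\<^esub> bracket Vir_nonneg x z"
      unfolding eqs by (rule V.bracket_add_right[OF V V V])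
    show "bracket Vir_nonneg (a \<odot>\<^bsub>Vir_nonneg\<^esub> x) y = a \<odot>\<^bsub>Vir_nonneg\<^esub> bracket Vir_nonneg x y"
      unfolding eqs by (rule V.bracket_smult_left[OF V V])
    show "bracket Vir_nonneg x (a \<odot>\<^bsub>Vir_nonneg\<^esub> y) = a \<odot>\<^bsub>Vir_nonneg\<^esub> bracket Vir_nonneg x y"
      unfolding eqs by (rule V.bracket_smult_right[OF V V])
    show "bracket Vir_nonneg x x = \<zero>\<^bsub>Vir_nonneg\<^esub>"
      unfolding eqs by (rule V.bracket_self[OF V])
    show "bracket Vir_nonneg x (bracket Vir_nonneg y z) \<oplus>\<^bsub>Vir_nonneg\<^esub> bracket Vir_nonneg y (bracket Vir_nonneg z x)
        \<oplus>\<^bsub>Vir_nonneg\<^esub> bracket Vir_nonneg z (bracket Vir_nonneg x y) = \<zero>\<^bsub>Vir_nonneg\<^esub>"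
      unfolding eqs by (rule V.jacobi[OF V V V])
  qed
qed

text \<open>
  The one-dimensional module \<open>\<complex>u\<close> over \<open>Vir_nonneg\<close>, with \<open>u = 1\<close>.
\<close>

definition highest_weight_line :: "complex \<Rightarrow> complex \<Rightarrow> (vir, complex) lie_rep" where
  "highest_weight_line c h =
    \<lparr>carrier = UNIV, monoid.mult = undefined, one = undefined, zero = 0, add = (+), module.smult = (*),
      act = (\<lambda>x z. (Poly_Mapping.lookup x (Vd 0) * h + Poly_Mapping.lookup x VC * c) * z)\<rparr>"

lemma lie_module_highest_weight_line: "lie_module Vir_nonneg (highest_weight_line c h)"
proof (intro lie_module.intro lie_module_axioms.intro lie_algebra_Vir_nonneg)
  have "\<exists>y. y + x = 0" for x :: complex by (rule exI[of _ "- x"]) simp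
  then show *: "Module.module complex_field (highest_weight_line c h)"
    by (intro moduleI cring_from_type_algebra abelian_groupI)
       (auto simp: highest_weight_line_def ring_of_type_algebra_def algebra_simps)
  then interpret Module.module complex_field "highest_weight_line c h" .
  fix x y v
  assume x: "x \<in> carrier Vir_nonneg" and y: "y \<in> carrier Vir_nonneg"
  have "act (highest_weight_line c h) (bracket Vir_nonneg x y) v = 0"
    using Vir_nonneg_bracket[OF x y, of 0] by (simp add: highest_weight_line_def Vir_nonneg_def)
  moreover have "act (highest_weight_line c h) x (act (highest_weight_line c h) y v) =
      act (highest_weight_line c h) y (act (highest_weight_line c h) x v)"
    by (simp add: highest_weight_line_def)
  moreover have "w \<ominus>\<^bsub>highest_weight_line c h\<^esub> w = 0" for w
    using M.r_neg[of w] by (simp add: a_minus_def highest_weight_line_def)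
  ultimately show "act (highest_weight_line c h) (bracket Vir_nonneg x y) v =
      act (highest_weight_line c h) x (act (highest_weight_line c h) y v) \<ominus>\<^bsub>highest_weight_line c h\<^esub>
      act (highest_weight_line c h) y (act (highest_weight_line c h) x v)"
    by simp
qed (simp_all add: highest_weight_line_def Vir_nonneg_def Vir_def lookup_add algebra_simps)

type_synonym verma = "((vir fword \<Rightarrow>\<^sub>0 complex) set \<times> complex \<Rightarrow>\<^sub>0 complex) set"

definition Verma :: "complex \<Rightarrow> complex \<Rightarrow> (vir, verma) lie_rep" where
  "Verma c h = induced_module Vir Vir_nonneg (highest_weight_line c h)"

definition Verma_max_submodule :: "complex \<Rightarrow> complex \<Rightarrow> verma set" where
  "Verma_max_submodule c h = (THE J. maximal_lie_submodule Vir (Verma c h) J)"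

definition simple_highest_weight :: "complex \<Rightarrow> complex \<Rightarrow> (vir, verma set) lie_rep" where
  "simple_highest_weight c h = lie_quotient (Verma c h) (Verma_max_submodule c h)"


section \<open>Intermediate series modules\<close>

fun intermediate_basis_act :: "complex \<Rightarrow> complex \<Rightarrow> vir_basis \<Rightarrow> int \<Rightarrow> (int \<Rightarrow>\<^sub>0 complex)" where
  "intermediate_basis_act \<alpha> \<beta> (Vd m) n =
    scale (\<alpha> + of_int n + of_int m * \<beta>) (basis_vec (m + n))"
| "intermediate_basis_act \<alpha> \<beta> VC n = 0"

definition intermediate_series :: "complex \<Rightarrow> complex \<Rightarrow> (vir, int \<Rightarrow>\<^sub>0 complex) lie_rep" where
  "intermediate_series \<alpha> \<beta> =
    free_rep UNIV (\<lambda>x n. lin_ext (\<lambda>b. intermediate_basis_act \<alpha> \<beta> b n) x)"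

lemma act_intermediate_simps:
  "act (intermediate_series \<alpha> \<beta>) (x + y) v =
    act (intermediate_series \<alpha> \<beta>) x v + act (intermediate_series \<alpha> \<beta>) y v"
  "act (intermediate_series \<alpha> \<beta>) x (v + w) =
    act (intermediate_series \<alpha> \<beta>) x v + act (intermediate_series \<alpha> \<beta>) x w"
  "act (intermediate_series \<alpha> \<beta>) (scale a x) v = scale a (act (intermediate_series \<alpha> \<beta>) x v)"
  "act (intermediate_series \<alpha> \<beta>) x (scale a v) = scale a (act (intermediate_series \<alpha> \<beta>) x v)"
  "act (intermediate_series \<alpha> \<beta>) 0 v = 0" "act (intermediate_series \<alpha> \<beta>) x 0 = 0"
  by (simp_all add: intermediate_series_def free_rep_def lin_ext_add lin_ext_scale lin_ext_add_fun
      lin_ext_scale_fun)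
     (simp add: lin_ext_def)

lemma act_intermediate_basis:
  "act (intermediate_series \<alpha> \<beta>) (Poly_Mapping.single (Vd m) a) (Poly_Mapping.single n b) =
    Poly_Mapping.single (m + n) (a * b * (\<alpha> + of_int n + of_int m * \<beta>))"
  "act (intermediate_series \<alpha> \<beta>) (Poly_Mapping.single VC a) v = 0"
  by (simp_all add: intermediate_series_def free_rep_def mult.left_commute mult.assoc) (simp add: lin_ext_def)

lemma act_intermediate_bracket:
  "act (intermediate_series \<alpha> \<beta>) (bracket Vir x y) v =
    act (intermediate_series \<alpha> \<beta>) x (act (intermediate_series \<alpha> \<beta>) y v) -
    act (intermediate_series \<alpha> \<beta>) y (act (intermediate_series \<alpha> \<beta>) x v)"
proof (induction x rule: free_space_induct)
  case (basis i)
  show ?case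
  proof (induction y rule: free_space_induct)
    case (basis j)
    show ?case
    proof (induction v rule: free_space_induct)
      case (basis k)
      show ?case
      proof (cases "\<exists>m n. i = Vd m \<and> j = Vd n")
        case True
        then obtain m n where ij: "i = Vd m" "j = Vd n" by blast
        have "of_int (n - m) * (\<alpha> + of_int k + of_int (m + n) * \<beta>) =
            (\<alpha> + of_int k + of_int n * \<beta>) * (\<alpha> + of_int (n + k) + of_int m * \<beta>) -
            (\<alpha> + of_int k + of_int m * \<beta>) * (\<alpha> + of_int (m + k) + of_int n * \<beta>)"
          by (simp add: algebra_simps)
        moreover have "m + (n + k) = m + n + k" and "n + (m + k) = m + n + k" by simp_all
        note 1 = this
        ultimately show ?thesis
          by (simp add: 1 ij Vir_bracket_basis act_intermediate_simps act_intermediate_basis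
              flip: single_diff del: of_int_add of_int_diff)
      next
        case False
        then show ?thesis
          by (cases i; cases j) (auto simp: Vir_bracket_basis act_intermediate_simps act_intermediate_basis)
      qed
    qed (simp_all add: act_intermediate_simps scale_diff_right)
  qed (simp_all add: act_intermediate_simps Vir_bracket_simps scale_diff_right)
qed (simp_all add: act_intermediate_simps Vir_bracket_simps scale_diff_right)

lemma lie_module_intermediate_series: "lie_module Vir (intermediate_series \<alpha> \<beta>)"
proof (intro lie_module.intro lie_module_axioms.intro lie_algebra_Vir)
  show *: "Module.module complex_field (intermediate_series \<alpha> \<beta>)"
    by (rule module_free[of _ UNIV]) (simp_all add: intermediate_series_def free_rep_def)
  fix x y v
  have c: "carrier (intermediate_series \<alpha> \<beta>) = UNIV" "zero (intermediate_series \<alpha> \<beta>) = 0"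
    "add (intermediate_series \<alpha> \<beta>) = (+)"
    by (simp_all add: intermediate_series_def free_rep_def)
  show "act (intermediate_series \<alpha> \<beta>) (bracket Vir x y) v =
    act (intermediate_series \<alpha> \<beta>) x (act (intermediate_series \<alpha> \<beta>) y v) \<ominus>\<^bsub>intermediate_series \<alpha> \<beta>\<^esub>
    act (intermediate_series \<alpha> \<beta>) y (act (intermediate_series \<alpha> \<beta>) x v)"
    by (simp only: a_minus_free[OF * c] act_intermediate_bracket)
next
  have c: "carrier (intermediate_series \<alpha> \<beta>) = UNIV" "add (intermediate_series \<alpha> \<beta>) = (+)"
    "module.smult (intermediate_series \<alpha> \<beta>) = scale" "add Vir = (+)" "module.smult Vir = scale"
    by (simp_all add: intermediate_series_def free_rep_def Vir_def)
  fix x y :: vir and v w a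
  show "act (intermediate_series \<alpha> \<beta>) x v \<in> carrier (intermediate_series \<alpha> \<beta>)"
    and "act (intermediate_series \<alpha> \<beta>) (x \<oplus>\<^bsub>Vir\<^esub> y) v =
      act (intermediate_series \<alpha> \<beta>) x v \<oplus>\<^bsub>intermediate_series \<alpha> \<beta>\<^esub> act (intermediate_series \<alpha> \<beta>) y v"
    and "act (intermediate_series \<alpha> \<beta>) (a \<odot>\<^bsub>Vir\<^esub> x) v =
      a \<odot>\<^bsub>intermediate_series \<alpha> \<beta>\<^esub> act (intermediate_series \<alpha> \<beta>) x v"
    and "act (intermediate_series \<alpha> \<beta>) x (v \<oplus>\<^bsub>intermediate_series \<alpha> \<beta>\<^esub> w) =
      act (intermediate_series \<alpha> \<beta>) x v \<oplus>\<^bsub>intermediate_series \<alpha> \<beta>\<^esub> act (intermediate_series \<alpha> \<beta>) x w"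
    and "act (intermediate_series \<alpha> \<beta>) x (a \<odot>\<^bsub>intermediate_series \<alpha> \<beta>\<^esub> v) =
      a \<odot>\<^bsub>intermediate_series \<alpha> \<beta>\<^esub> act (intermediate_series \<alpha> \<beta>) x v"
    by (simp_all only: c act_intermediate_simps UNIV_I)
qed

text \<open>
  To give both cases the same type, the module is replaced by its (canonically isomorphic)
  quotient by the zero submodule when \<open>(\<alpha>, \<beta>) \<noteq> (0, 0)\<close>.
\<close>

definition intermediate_series' :: "complex \<Rightarrow> complex \<Rightarrow> (vir, (int \<Rightarrow>\<^sub>0 complex) set) lie_rep" where
  "intermediate_series' \<alpha> \<beta> =
    lie_quotient (intermediate_series \<alpha> \<beta>)
      (if \<alpha> = 0 \<and> \<beta> = 0 then lin_span (intermediate_series \<alpha> \<beta>) {basis_vec 0} else {0})"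

end

theory Submission
  imports Defs "HOL-Library.Multiset"
begin

text \<open>
  For all \<open>c\<close>, \<open>h\<close> a beta-gamma system gives a Virasoro representation on polynomials in infinitely many
  variables whose vacuum is a highest weight vector of weight \<open>h\<close> and central charge \<open>c\<close>. Its vacuum
  functional \<open>\<epsilon>\<close> shows that the Verma module is nonzero, and \<open>V(c,h)\<close> is the free algebra modulo the left
  ideal of all \<open>p\<close> with \<open>\<epsilon> (s p) = 0\<close> for every \<open>s\<close>.

  In \<open>V(c,h) \<otimes> V'\<close>, where \<open>u\<close> is the highest weight vector, \<open>(\<alpha> + k + (m + n) \<beta>) d\<^sub>m d\<^sub>n\<close> and
  \<open>(\<alpha> + k + n \<beta>) (\<alpha> + k + n + m \<beta>) d\<^bsub>m+n\<^esub>\<close> agree on \<open>u \<otimes> v\<^sub>k\<close> for \<open>m, n > 0\<close>. Apply an isomorphism and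
  compare coordinates: for large indices the operators act on the second factor only, so every index
  \<open>j\<close> in the support of the image of \<open>u \<otimes> v\<^sub>k\<close> satisfies a polynomial identity in \<open>m\<close> and \<open>n\<close>, which forces
  \<open>\<beta>\<^sub>1 = \<beta>\<close> and \<open>\<alpha>\<^sub>1 + j = \<alpha> + k\<close>. Hence \<open>\<alpha>\<^sub>1 = \<alpha>\<close> and \<open>j = k\<close>, and the image is \<open>x \<otimes> v\<^sub>k\<close> with \<open>x\<close> annihilated by
  all \<open>d\<^sub>n\<close>, \<open>n > 0\<close>, of weight \<open>h\<close> and central charge \<open>c\<close>; the only such weight in \<open>V(c\<^sub>1,h\<^sub>1)\<close> is \<open>h\<^sub>1\<close>.
\<close>

section \<open>Quotients and free representations\<close>

text \<open>The danger in modules given by generators and relations is that the relations might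
  collapse them. A concrete model rules this out, and the model need not resemble the Verma module:
  all that is extracted from it is a functional that sees a highest weight vector on its right and a
  lowest weight covector on its left. The model has two parameters because central charge and weight
  are prescribed independently: one quadratic equation fixes the central charge, a second one the
  weight.

  No basis of V(c,h) is at hand. A vector represented by p is therefore described by the numbers
  \<open>\<epsilon> (s * p)\<close> for all s, and a tensor by these numbers at each index j of the
  series. The action then becomes a substitution on the labels s and j.

  The image of u \<otimes> v_k may involve several indices j, with components killed by d_n only for
  n beyond a bound that depends on k. The comparison is arranged so that the bound for a single k is
  used. Taking k positive avoids the index 0 that V'_{0,0} lacks and makes \<alpha> + k
  nonzero.\<close>

lemma carrier_complex_field: "carrier complex_field = UNIV"
  and complex_field_simps: "one complex_field = 1" "add complex_field = (+)" "monoid.mult complex_field = (*)"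
    "zero complex_field = 0"
  by (simp_all add: ring_of_type_algebra_def)

text \<open>Asks only for additive operators that preserve \<open>N\<close>, because the free spaces
  behind \<open>Verma\<close> and \<open>lie_tensor\<close> are not Lie modules before the quotient
  is taken.\<close>

locale rep_quotient = module complex_field M for M :: "('l, 'v, 'n) lie_rep_scheme" (structure) +
  fixes N :: "'v set"
  assumes N_submodule: "submodule N complex_field M"
    and act_carrier: "\<And>x v. v \<in> carrier M \<Longrightarrow> act M x v \<in> carrier M"
    and act_add: "\<And>x v w. v \<in> carrier M \<Longrightarrow> w \<in> carrier M \<Longrightarrow> act M x (v \<oplus> w) = act M x v \<oplus> act M x w"
    and act_N: "\<And>x v. v \<in> N \<Longrightarrow> act M x v \<in> N"
begin

lemma smult_carrier: "v \<in> carrier M \<Longrightarrow> a \<odot> v \<in> carrier M"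
  by (rule smult_closed) (simp_all add: carrier_complex_field)

lemma smult_add: "v \<in> carrier M \<Longrightarrow> w \<in> carrier M \<Longrightarrow> a \<odot> (v \<oplus> w) = a \<odot> v \<oplus> a \<odot> w"
  by (rule smult_r_distr) (simp_all add: carrier_complex_field)

lemma smult_N: "v \<in> N \<Longrightarrow> a \<odot> v \<in> N"
  using submoduleE(4)[OF N_submodule] by (simp add: carrier_complex_field)

sublocale N: abelian_subgroup N M
  by (intro abelian_subgroupI3 additive_subgroup.intro abelian_group_axioms submodule.axioms(1)[OF N_submodule])

lemma coset_eq_iff:
  assumes "v \<in> carrier M" "w \<in> carrier M"
  shows "N +> v = N +> w \<longleftrightarrow> v \<ominus> w \<in> N"
proof
  assume "N +> v = N +> w"
  then have "v \<in> N +> w" using N.a_rcos_self[OF assms(1)] by simp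
  then show "v \<ominus> w \<in> N" using N.a_rcos_module assms by (simp add: a_minus_def)
next
  assume "v \<ominus> w \<in> N"
  then have "v \<in> N +> w" using N.a_rcos_module assms by (simp add: a_minus_def)
  then show "N +> v = N +> w" using N.a_repr_independence' assms(2) by auto
qed

lemma coset_mem: "v \<in> carrier M \<Longrightarrow> w \<in> N +> v \<Longrightarrow> w \<in> carrier M \<and> w \<ominus> v \<in> N"
  using N.a_elemrcos_carrier[of v w] N.a_rcos_module[of v w] by (simp add: a_minus_def)

lemma quotient_carrier: "carrier (lie_quotient M N) = (\<lambda>v. N +> v) ` carrier M"
  by (auto simp: lie_quotient_def A_RCOSETS_def')

lemma quotient_add:
  "v \<in> carrier M \<Longrightarrow> w \<in> carrier M \<Longrightarrow> (N +> v) \<oplus>\<^bsub>lie_quotient M N\<^esub> (N +> w) = N +> (v \<oplus> w)"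
  by (simp add: lie_quotient_def N.a_rcos_sum)

lemma quotient_zero: "\<zero>\<^bsub>lie_quotient M N\<^esub> = N +> \<zero>"
  by (simp add: lie_quotient_def a_coset_add_zero N.a_subset)

text \<open>Two representatives differ by an element of \<open>N\<close>, and \<open>f\<close> keeps
  that difference in \<open>N\<close>; hence the unions in \<open>lie_quotient\<close> collapse to a
  single coset.\<close>

lemma additive_on_coset:
  assumes v: "v \<in> carrier M"
    and f: "\<And>v. v \<in> carrier M \<Longrightarrow> f v \<in> carrier M"
      "\<And>v w. v \<in> carrier M \<Longrightarrow> w \<in> carrier M \<Longrightarrow> f (v \<oplus> w) = f v \<oplus> f w"
      "\<And>v. v \<in> N \<Longrightarrow> f v \<in> N"
  shows "(\<Union>w\<in>N +> v. N +> f w) = N +> f v"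
proof -
  have "N +> f w = N +> f v" if "w \<in> N +> v" for w
  proof -
    from coset_mem[OF v that] have w: "w \<in> carrier M" "w \<ominus> v \<in> N" by auto
    have "f w = f (w \<ominus> v) \<oplus> f v"
      using f(2)[of "w \<ominus> v" v] w v by (simp add: a_minus_def a_assoc l_neg)
    moreover have "f (w \<ominus> v) \<in> carrier M" using f(1) w v by simp
    ultimately have "f w \<ominus> f v = f (w \<ominus> v)"
      using f(1)[OF v] by (simp add: a_minus_def a_assoc r_neg)
    then show ?thesis using coset_eq_iff[of "f w" "f v"] f(1,3) w v by simp
  qed
  moreover have "v \<in> N +> v" using N.a_rcos_self v by simp
  ultimately show ?thesis by blast
qed

lemma quotient_smult: "v \<in> carrier M \<Longrightarrow> a \<odot>\<^bsub>lie_quotient M N\<^esub> (N +> v) = N +> (a \<odot> v)"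
  by (simp add: lie_quotient_def additive_on_coset smult_carrier smult_add smult_N)

lemma quotient_act: "v \<in> carrier M \<Longrightarrow> act (lie_quotient M N) x (N +> v) = N +> act M x v"
  by (simp add: lie_quotient_def additive_on_coset act_carrier act_add act_N)

lemma quotient_module: "Module.module complex_field (lie_quotient M N)"
proof (intro moduleI cring_from_type_algebra)
  show "abelian_group (lie_quotient M N)"
  proof (rule abelian_groupI)
    fix Z assume "Z \<in> carrier (lie_quotient M N)"
    then obtain v where v: "v \<in> carrier M" "Z = N +> v" by (auto simp: quotient_carrier)
    then show "\<exists>Y\<in>carrier (lie_quotient M N). Y \<oplus>\<^bsub>lie_quotient M N\<^esub> Z = \<zero>\<^bsub>lie_quotient M N\<^esub>"
      by (intro bexI[of _ "N +> (\<ominus> v)"]) (auto simp: quotient_carrier quotient_add quotient_zero l_neg)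
  qed (auto simp: quotient_carrier quotient_add quotient_zero a_ac)
qed (auto simp: quotient_carrier quotient_add quotient_smult carrier_complex_field complex_field_simps
    smult_carrier smult_add cring_from_type_algebra smult_l_distr smult_assoc1
    simp flip: complex_field_simps)

end

lemma module_free_rep: "Module.module complex_field (free_rep K \<phi>)"
  by (rule module_free[of _ K]) (simp_all add: free_rep_def)

lemma free_rep_simps:
  "carrier (free_rep K \<phi>) = {p. Poly_Mapping.keys p \<subseteq> K}" "add (free_rep K \<phi>) = (+)"
  "zero (free_rep K \<phi>) = 0" "module.smult (free_rep K \<phi>) = scale" "act (free_rep K \<phi>) x = lin_ext (\<phi> x)"
  by (simp_all add: free_rep_def)

lemma free_rep_uminus: "Poly_Mapping.keys p \<subseteq> K \<Longrightarrow> \<ominus>\<^bsub>free_rep K \<phi>\<^esub> p = - p"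
proof -
  interpret Module.module complex_field "free_rep K \<phi>" by (rule module_free_rep)
  assume "Poly_Mapping.keys p \<subseteq> K"
  then show ?thesis by (intro M.minus_equality) (simp_all add: free_rep_simps)
qed

lemma free_rep_minus:
  "Poly_Mapping.keys q \<subseteq> K \<Longrightarrow> p \<ominus>\<^bsub>free_rep K \<phi>\<^esub> q = p - q"
  by (simp add: a_minus_def free_rep_uminus) (simp add: free_rep_simps)

lemma submodule_free_repI:
  assumes "H \<subseteq> {p. Poly_Mapping.keys p \<subseteq> K}" "0 \<in> H" "\<And>p q. p \<in> H \<Longrightarrow> q \<in> H \<Longrightarrow> p + q \<in> H"
    "\<And>a p. p \<in> H \<Longrightarrow> scale a p \<in> H"
  shows "submodule H complex_field (free_rep K \<phi>)"
proof -
  interpret Module.module complex_field "free_rep K \<phi>" by (rule module_free_rep)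
  have "- p \<in> H" if "p \<in> H" for p
  proof -
    have "- p = scale (- 1) p" by (rule poly_mapping_eqI) simp
    then show ?thesis using assms(4)[OF that] by simp
  qed
  moreover have "\<ominus>\<^bsub>free_rep K \<phi>\<^esub> p = - p" if "p \<in> H" for p
    using assms(1) that by (intro free_rep_uminus) blast
  ultimately show ?thesis
    by (intro submoduleI) (use assms in \<open>auto simp: free_rep_simps\<close>)
qed

lemma submodule_free_repD:
  assumes "submodule H complex_field (free_rep K \<phi>)"
  shows "H \<subseteq> {p. Poly_Mapping.keys p \<subseteq> K}" "0 \<in> H" "\<And>p q. p \<in> H \<Longrightarrow> q \<in> H \<Longrightarrow> p + q \<in> H"
    "\<And>a p. p \<in> H \<Longrightarrow> scale a p \<in> H" "\<And>p q. p \<in> H \<Longrightarrow> q \<in> H \<Longrightarrow> p - q \<in> H"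
    "\<And>I f. (\<And>i. i \<in> I \<Longrightarrow> f i \<in> H) \<Longrightarrow> (\<Sum>i\<in>I. f i) \<in> H"
proof -
  interpret Module.module complex_field "free_rep K \<phi>" by (rule module_free_rep)
  note E = submoduleE[OF assms, unfolded free_rep_simps carrier_complex_field]
  show "H \<subseteq> {p. Poly_Mapping.keys p \<subseteq> K}" by (rule E(1))
  show add: "p + q \<in> H" if "p \<in> H" "q \<in> H" for p q using E(5) that by blast
  show s: "scale a p \<in> H" if "p \<in> H" for a p using E(4) that by blast
  show z: "0 \<in> H" using E(2) s[of _ 0] by auto
  show "p - q \<in> H" if "p \<in> H" "q \<in> H" for p q
  proof -
    have "p - q = p + scale (- 1) q" by (rule poly_mapping_eqI) (simp add: lookup_add lookup_minus)
    then show ?thesis using add s that by (simp only:)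
  qed
  show "(\<And>i. i \<in> I \<Longrightarrow> f i \<in> H) \<Longrightarrow> (\<Sum>i\<in>I. f i) \<in> H" for I f
    by (induction I rule: infinite_finite_induct) (auto intro: z add)
qed

lemma lin_span_superset: "S \<subseteq> lin_span M S"
  by (auto simp: lin_span_def)

lemma lin_span_least: "submodule H complex_field M \<Longrightarrow> S \<subseteq> H \<Longrightarrow> lin_span M S \<subseteq> H"
  by (auto simp: lin_span_def)

lemma submodule_lin_span_free_rep:
  assumes "S \<subseteq> carrier (free_rep K \<phi>)"
  shows "submodule (lin_span (free_rep K \<phi>) S) complex_field (free_rep K \<phi>)"
proof (rule submodule_free_repI)
  interpret Module.module complex_field "free_rep K \<phi>" by (rule module_free_rep)
  show "lin_span (free_rep K \<phi>) S \<subseteq> {p. Poly_Mapping.keys p \<subseteq> K}"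
    using lin_span_least[OF carrier_is_submodule assms] by (simp add: free_rep_simps)
qed (auto simp: lin_span_def dest: submodule_free_repD)

lemma rep_quotient_free_rep:
  assumes "submodule N complex_field (free_rep K \<phi>)"
    and "\<And>x k. k \<in> K \<Longrightarrow> Poly_Mapping.keys (\<phi> x k) \<subseteq> K"
    and "\<And>x p. p \<in> N \<Longrightarrow> lin_ext (\<phi> x) p \<in> N"
  shows "rep_quotient (free_rep K \<phi>) N"
proof (intro rep_quotient.intro rep_quotient_axioms.intro module_free_rep assms(1))
  show "act (free_rep K \<phi>) x v \<in> carrier (free_rep K \<phi>)" if "v \<in> carrier (free_rep K \<phi>)" for x v
  proof -
    have "submodule {p. Poly_Mapping.keys p \<subseteq> K} complex_field (free_rep K \<phi>)"
      using Module.module.carrier_is_submodule[OF module_free_rep] by (simp add: free_rep_simps)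
    note D = submodule_free_repD[OF this]
    have "lin_ext (\<phi> x) v \<in> {p. Poly_Mapping.keys p \<subseteq> K}"
      unfolding lin_ext_def by (intro D(6) D(4)) (use assms(2) that in \<open>auto simp: free_rep_simps\<close>)
    then show ?thesis by (simp add: free_rep_simps)
  qed
qed (simp_all add: free_rep_simps lin_ext_add assms(3))

text \<open>The elements of the span whose image stays in the span form a submodule, so the
  generators in \<open>S\<close> decide.\<close>

lemma lin_span_closed_lin_ext:
  assumes "S \<subseteq> carrier (free_rep K \<phi>)" "\<And>r. r \<in> S \<Longrightarrow> lin_ext f r \<in> lin_span (free_rep K \<phi>) S"
    "p \<in> lin_span (free_rep K \<phi>) S"
  shows "lin_ext f p \<in> lin_span (free_rep K \<phi>) S"
proof -
  note D = submodule_free_repD[OF submodule_lin_span_free_rep[OF assms(1)]]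
  let ?H = "{p \<in> lin_span (free_rep K \<phi>) S. lin_ext f p \<in> lin_span (free_rep K \<phi>) S}"
  have "submodule ?H complex_field (free_rep K \<phi>)"
  proof (rule submodule_free_repI)
    show "?H \<subseteq> {p. Poly_Mapping.keys p \<subseteq> K}" using D(1) by blast
    show "0 \<in> ?H" by (simp add: D(2))
    show "p + q \<in> ?H" if "p \<in> ?H" "q \<in> ?H" for p q
      using that by (simp add: lin_ext_add D(3))
    show "scale a p \<in> ?H" if "p \<in> ?H" for a p
      using that by (simp add: lin_ext_scale D(4))
  qed
  moreover have "S \<subseteq> ?H" using subsetD[OF lin_span_superset, of _ S] assms(2) by blast
  ultimately have "lin_span (free_rep K \<phi>) S \<subseteq> ?H" by (rule lin_span_least)
  then show ?thesis using assms(3) by blast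
qed

section \<open>Free algebras and enveloping algebras\<close>

type_synonym 'l falg = "'l fword \<Rightarrow>\<^sub>0 complex"

lemma scale_conv_mult: "scale a p = Poly_Mapping.single 0 a * (p :: 'l falg)"
  unfolding scale_def by (rule mult_map_scale_conv_mult)

lemma scale_mult_left: "scale a p * q = scale a (p * q :: 'l falg)"
  by (simp only: scale_conv_mult mult.assoc)

text \<open>A scalar is a multiple of the empty word, which commutes with every word.\<close>

lemma scale_mult_right: "p * scale a q = scale a (p * q :: 'l falg)"
proof -
  have "p * Poly_Mapping.single 0 a = Poly_Mapping.single 0 a * p" for p :: "'l falg"
  proof (induction p rule: free_space_induct)
    case (scale b p)
    then show ?case
      by (simp add: scale_mult_left flip: scale_conv_mult) (simp add: mult.commute)
  qed (simp_all only: distrib_left distrib_right mult_single add_0_left add_0_right mult_zero_left mult_zero_right mult_1_left mult_1_right)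
  then show ?thesis by (simp only: scale_conv_mult flip: mult.assoc)
qed

lemma basis_fword_Cons: "basis_vec (FWord (x # w)) = gen x * basis_vec (FWord w)"
  by (simp add: mult_single plus_fword_def)

lemma one_falg: "(1 :: 'l falg) = basis_vec (FWord [])"
  by (metis single_one zero_fword_def)

lemma free_algebra_simps:
  "carrier (free_algebra S) = {p. \<forall>w\<in>Poly_Mapping.keys p. set (letters w) \<subseteq> S}"
  "monoid.mult (free_algebra S) = (*)" "one (free_algebra S) = 1" "zero (free_algebra S) = 0"
  "add (free_algebra S) = (+)"
  by (simp_all add: free_algebra_def)

lemma free_algebra_carrier_intros:
  "0 \<in> carrier (free_algebra S)" "1 \<in> carrier (free_algebra S)"
  "p \<in> carrier (free_algebra S) \<Longrightarrow> q \<in> carrier (free_algebra S) \<Longrightarrow> p + q \<in> carrier (free_algebra S)"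
  "p \<in> carrier (free_algebra S) \<Longrightarrow> - p \<in> carrier (free_algebra S)"
  "p \<in> carrier (free_algebra S) \<Longrightarrow> q \<in> carrier (free_algebra S) \<Longrightarrow> p - q \<in> carrier (free_algebra S)"
  "p \<in> carrier (free_algebra S) \<Longrightarrow> scale a p \<in> carrier (free_algebra S)"
  "p \<in> carrier (free_algebra S) \<Longrightarrow> q \<in> carrier (free_algebra S) \<Longrightarrow> p * q \<in> carrier (free_algebra S)"
  "x \<in> S \<Longrightarrow> gen x \<in> carrier (free_algebra S)"
proof -
  show a: "p \<in> carrier (free_algebra S) \<Longrightarrow> q \<in> carrier (free_algebra S) \<Longrightarrow> p + q \<in> carrier (free_algebra S)" for p q
    using Poly_Mapping.keys_add[of p q] by (auto simp: free_algebra_simps)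
  show m: "p \<in> carrier (free_algebra S) \<Longrightarrow> - p \<in> carrier (free_algebra S)" for p
    by (auto simp: free_algebra_simps in_keys_iff)
  show "p \<in> carrier (free_algebra S) \<Longrightarrow> q \<in> carrier (free_algebra S) \<Longrightarrow> p - q \<in> carrier (free_algebra S)"
    using a[of p "- q"] m by simp
  show "p \<in> carrier (free_algebra S) \<Longrightarrow> scale a p \<in> carrier (free_algebra S)"
    by (auto simp: free_algebra_simps in_keys_iff)
  show "p \<in> carrier (free_algebra S) \<Longrightarrow> q \<in> carrier (free_algebra S) \<Longrightarrow> p * q \<in> carrier (free_algebra S)"
    using Poly_Mapping.keys_mult[of p q] by (fastforce simp: free_algebra_simps plus_fword_def)
qed (auto simp: free_algebra_simps one_falg)

lemma ring_free_algebra: "ring (free_algebra S)"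
proof (rule ringI)
  show "abelian_group (free_algebra S)"
  proof (rule abelian_groupI)
    fix x assume "x \<in> carrier (free_algebra S)"
    then show "\<exists>y\<in>carrier (free_algebra S). y \<oplus>\<^bsub>free_algebra S\<^esub> x = \<zero>\<^bsub>free_algebra S\<^esub>"
      by (intro bexI[of _ "- x"]) (simp_all add: free_algebra_carrier_intros free_algebra_simps(2-))
  qed (simp_all add: free_algebra_carrier_intros free_algebra_simps(2-) ac_simps)
  show "monoid (free_algebra S)"
    by (rule monoidI) (simp_all add: free_algebra_carrier_intros free_algebra_simps(2-) mult.assoc)
qed (simp_all add: free_algebra_simps(2-) algebra_simps)

lemma free_algebra_minus:
  assumes "q \<in> carrier (free_algebra S)"
  shows "p \<ominus>\<^bsub>free_algebra S\<^esub> q = p - q"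
proof -
  interpret ring "free_algebra S" by (rule ring_free_algebra)
  have "\<ominus>\<^bsub>free_algebra S\<^esub> q = - q"
    by (rule minus_equality) (simp_all add: assms free_algebra_carrier_intros free_algebra_simps(2-))
  then show ?thesis by (simp add: a_minus_def free_algebra_simps(2-))
qed

lemma idealI_free_algebra:
  assumes "I \<subseteq> carrier (free_algebra S)" "0 \<in> I" "\<And>p q. p \<in> I \<Longrightarrow> q \<in> I \<Longrightarrow> p + q \<in> I"
    "\<And>p q. p \<in> I \<Longrightarrow> q \<in> carrier (free_algebra S) \<Longrightarrow> p * q \<in> I"
    "\<And>p q. p \<in> I \<Longrightarrow> q \<in> carrier (free_algebra S) \<Longrightarrow> q * p \<in> I"
  shows "ideal I (free_algebra S)"
proof -
  interpret ring "free_algebra S" by (rule ring_free_algebra)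
  have neg: "- p \<in> I" if "p \<in> I" for p
    using assms(5)[OF that, of "- 1"] by (simp add: free_algebra_carrier_intros)
  have "\<ominus>\<^bsub>free_algebra S\<^esub> p = - p" if "p \<in> I" for p
    by (rule minus_equality) (use assms(1) neg that in \<open>auto simp: free_algebra_simps(2-)\<close>)
  then have "inv\<^bsub>add_monoid (free_algebra S)\<^esub> p \<in> I" if "p \<in> I" for p
    using neg[OF that] that by (simp only: a_inv_def)
  then have "subgroup I (add_monoid (free_algebra S))"
    by (rule subgroup.intro[rotated 3]) (use assms(1-3) in \<open>auto simp: free_algebra_simps(2-)\<close>)
  then show ?thesis
    by (rule idealI[OF ring_free_algebra]) (use assms(4,5) in \<open>simp_all add: free_algebra_simps(2)\<close>)
qed

lemma uea_relations_carrier: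
  assumes "lie_algebra L"
  shows "uea_relations L \<subseteq> carrier (free_algebra (carrier L))"
proof -
  interpret lie_algebra L by fact
  show ?thesis
    unfolding uea_relations_def
    by (auto intro!: free_algebra_carrier_intros bracket_closed smult_closed simp: ring_of_type_algebra_def
        simp del: scale_single)
qed

lemma ideal_uea_ideal: "lie_algebra L \<Longrightarrow> ideal (uea_ideal L) (free_algebra (carrier L))"
  unfolding uea_ideal_def by (rule ring.genideal_ideal[OF ring_free_algebra uea_relations_carrier])

lemma uea_ideal_least:
  assumes "ideal I (free_algebra (carrier L))" "uea_relations L \<subseteq> I"
  shows "uea_ideal L \<subseteq> I"
  unfolding uea_ideal_def by (rule ring.genideal_minimal[OF ring_free_algebra assms])

lemma uea_relations_subset_ideal: "lie_algebra L \<Longrightarrow> uea_relations L \<subseteq> uea_ideal L"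
  unfolding uea_ideal_def by (rule ring.genideal_self[OF ring_free_algebra uea_relations_carrier])

lemma carrier_Vir: "carrier Vir = UNIV" and Vir_ops: "add Vir = (+)" "module.smult Vir = scale" "zero Vir = 0"
  by (simp_all add: Vir_def)

lemma carrier_free_algebra_Vir: "carrier (free_algebra (carrier Vir)) = UNIV"
  by (simp add: free_algebra_simps carrier_Vir)

lemma uea_ideal_Vir_closed:
  "p \<in> uea_ideal Vir \<Longrightarrow> q \<in> uea_ideal Vir \<Longrightarrow> p + q \<in> uea_ideal Vir"
  "p \<in> uea_ideal Vir \<Longrightarrow> q * p \<in> uea_ideal Vir"
  "p \<in> uea_ideal Vir \<Longrightarrow> p * q \<in> uea_ideal Vir"
  "0 \<in> uea_ideal Vir"
  "p \<in> uea_ideal Vir \<Longrightarrow> scale a p \<in> uea_ideal Vir"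
proof -
  interpret ideal "uea_ideal Vir" "free_algebra (carrier Vir)" by (rule ideal_uea_ideal[OF lie_algebra_Vir])
  note carr = carrier_free_algebra_Vir
  show "p \<in> uea_ideal Vir \<Longrightarrow> q \<in> uea_ideal Vir \<Longrightarrow> p + q \<in> uea_ideal Vir"
    using additive_subgroup.a_closed[OF is_additive_subgroup, of p q] by (simp add: free_algebra_simps(2-))
  show l: "p \<in> uea_ideal Vir \<Longrightarrow> q * p \<in> uea_ideal Vir" for p q
    using I_l_closed[of p q] by (simp only: carr free_algebra_simps(2-) UNIV_I)
  show "p \<in> uea_ideal Vir \<Longrightarrow> p * q \<in> uea_ideal Vir"
    using I_r_closed[of p q] by (simp only: carr free_algebra_simps(2-) UNIV_I)
  show "0 \<in> uea_ideal Vir"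
    using additive_subgroup.zero_closed[OF is_additive_subgroup] by (simp add: free_algebra_simps(2-))
  show "p \<in> uea_ideal Vir \<Longrightarrow> scale a p \<in> uea_ideal Vir"
    using l[of p "scale a 1"] by (simp add: scale_mult_left)
qed

lemma uea_ideal_Vir_relations:
  "gen (x + y) - gen x - gen y \<in> uea_ideal Vir"
  "gen (scale a x) - scale a (gen x) \<in> uea_ideal Vir"
  "gen x * gen y - gen y * gen x - gen (bracket Vir x y) \<in> uea_ideal Vir"
  by (rule subsetD[OF uea_relations_subset_ideal[OF lie_algebra_Vir]],
      unfold uea_relations_def Vir_ops carrier_Vir, blast)+

section \<open>A Fock representation of every central charge and weight\<close>

definition linear_op :: "(('a \<Rightarrow>\<^sub>0 complex) \<Rightarrow> ('b \<Rightarrow>\<^sub>0 complex)) \<Rightarrow> bool" where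
  "linear_op f \<longleftrightarrow> (\<forall>p q. f (p + q) = f p + f q) \<and> (\<forall>a p. f (scale a p) = scale a (f p))"

lemma linear_op_lin_ext: "linear_op (lin_ext f)"
  by (simp add: linear_op_def lin_ext_add lin_ext_scale)

lemma linear_opD:
  assumes "linear_op f"
  shows "f (p + q) = f p + f q" "f (scale a p) = scale a (f p)" "f 0 = 0" "f (- p) = - f p"
    "f (p - q) = f p - f q" "f (\<Sum>i\<in>I. g i) = (\<Sum>i\<in>I. f (g i))"
proof -
  show add: "f (p + q) = f p + f q" and s: "f (scale a p) = scale a (f p)" for a p q
    using assms by (auto simp: linear_op_def)
  show 0: "f 0 = 0" using s[of 0 0] by simp
  show m: "f (- p) = - f p" for p using add[of p "- p"] 0 by (simp add: eq_neg_iff_add_eq_0 add.commute)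
  show "f (p - q) = f p - f q" using add[of p "- q"] m by simp
  show "f (\<Sum>i\<in>I. g i) = (\<Sum>i\<in>I. f (g i))"
    by (induction I rule: infinite_finite_induct) (simp_all add: 0 add)
qed

lemma linear_op_eqI:
  assumes "linear_op f" "linear_op g" "\<And>k. f (basis_vec k) = g (basis_vec k)"
  shows "f p = g p"
  by (induction p rule: free_space_induct) (simp_all add: linear_opD[OF assms(1)] linear_opD[OF assms(2)] assms(3))

lemma linear_op_intros:
  "linear_op f \<Longrightarrow> linear_op g \<Longrightarrow> linear_op (\<lambda>v. f v + g v)"
  "linear_op f \<Longrightarrow> linear_op g \<Longrightarrow> linear_op (\<lambda>v. f v - g v)"
  "linear_op f \<Longrightarrow> linear_op (\<lambda>v. - f v)"
  "linear_op f \<Longrightarrow> linear_op (\<lambda>v. scale a (f v))"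
  "linear_op f \<Longrightarrow> linear_op f' \<Longrightarrow> linear_op (\<lambda>v. f (f' v))"
  "linear_op (\<lambda>v. v)" "linear_op (\<lambda>v. 0)"
  by (simp_all add: linear_op_def scale_add_right scale_diff_right scale_minus_right algebra_simps)

lemma lin_ext_one: "lin_ext f 1 = f 0"
  using lin_ext_single[of f 0 1] by simp

section \<open>Polynomials in variables indexed by the integers, with their multiplications and
  derivations\<close>

type_synonym fock = "int multiset \<Rightarrow>\<^sub>0 complex"

definition mul_var :: "int \<Rightarrow> fock \<Rightarrow> fock" where
  "mul_var k = lin_ext (\<lambda>M. basis_vec (add_mset k M))"

definition pderiv_var :: "int \<Rightarrow> fock \<Rightarrow> fock" where
  "pderiv_var k = lin_ext (\<lambda>M. scale (of_nat (count M k)) (basis_vec (M - {#k#})))"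

lemma linear_mul_var: "linear_op (mul_var k)" and linear_pderiv_var: "linear_op (pderiv_var k)"
  by (simp_all add: mul_var_def pderiv_var_def linear_op_lin_ext)

lemma mul_var_basis: "mul_var k (Poly_Mapping.single M a) = Poly_Mapping.single (add_mset k M) a"
  by (simp add: mul_var_def)

lemma pderiv_var_basis:
  "pderiv_var k (Poly_Mapping.single M a) = Poly_Mapping.single (M - {#k#}) (a * of_nat (count M k))"
  by (simp add: pderiv_var_def)

lemma mul_var_commute: "mul_var k (mul_var l v) = mul_var l (mul_var k v)"
  by (rule linear_op_eqI[of "\<lambda>v. mul_var k (mul_var l v)" "\<lambda>v. mul_var l (mul_var k v)"])
     (simp_all add: linear_op_intros linear_mul_var mul_var_basis add_mset_commute)

lemma pderiv_var_commute: "pderiv_var k (pderiv_var l v) = pderiv_var l (pderiv_var k v)"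
  by (rule linear_op_eqI[of "\<lambda>v. pderiv_var k (pderiv_var l v)" "\<lambda>v. pderiv_var l (pderiv_var k v)"])
     (auto simp: linear_op_intros linear_pderiv_var pderiv_var_basis add_mset_commute mult.commute)

lemma pderiv_mul_var:
  "pderiv_var k (mul_var l v) = mul_var l (pderiv_var k v) + (if k = l then v else 0)"
proof (rule linear_op_eqI[of "\<lambda>v. pderiv_var k (mul_var l v)" "\<lambda>v. mul_var l (pderiv_var k v) + (if k = l then v else 0)"])
  show "linear_op (\<lambda>v. mul_var l (pderiv_var k v) + (if k = l then v else 0))"
    by (cases "k = l") (simp_all add: linear_op_intros linear_mul_var linear_pderiv_var)
  fix M
  show "pderiv_var k (mul_var l (basis_vec M)) = mul_var l (pderiv_var k (basis_vec M)) + (if k = l then basis_vec M else 0)"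
  proof (cases "k \<in># M")
    case True
    then obtain M' where "M = add_mset k M'" by (metis mset_add)
    then show ?thesis
      by (auto simp: mul_var_basis pderiv_var_basis single_add[symmetric] add_ac)
  next
    case False
    then have "count M k = 0" by (simp add: not_in_iff)
    then show ?thesis by (auto simp: mul_var_basis pderiv_var_basis linear_opD[OF linear_mul_var])
  qed
qed (simp add: linear_op_intros linear_mul_var linear_pderiv_var)

text \<open>
  A beta-gamma system, with the vacuum chosen by the sign of the index: \<open>d\<^sub>m\<close> will act as the sum of
  all \<open>(\<alpha> + k + m \<beta>) bop (m + k) (cop k v)\<close>, so that its commutators with the operators \<open>bop l\<close>
  reproduce the intermediate series. For \<open>m = 0\<close> that sum has to be normally ordered; this is the
  correction in \<open>vir_term\<close> below.
\<close>

definition bop :: "int \<Rightarrow> fock \<Rightarrow> fock" where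
  "bop k v = (if k < 0 then mul_var k v else - pderiv_var k v)"

definition cop :: "int \<Rightarrow> fock \<Rightarrow> fock" where
  "cop k v = (if k < 0 then pderiv_var k v else mul_var k v)"

lemma linear_bop: "linear_op (bop k)" and linear_cop: "linear_op (cop k)"
proof -
  have "bop k = (if k < 0 then mul_var k else (\<lambda>v. - pderiv_var k v))"
    "cop k = (if k < 0 then pderiv_var k else mul_var k)"
    by (auto simp: bop_def cop_def)
  then show "linear_op (bop k)" "linear_op (cop k)"
    by (simp_all add: linear_op_intros linear_mul_var linear_pderiv_var)
qed

lemmas bop_simps = linear_opD[OF linear_bop] and cop_simps = linear_opD[OF linear_cop]

lemma bop_commute: "bop k (bop l v) = bop l (bop k v)"
  and cop_commute: "cop k (cop l v) = cop l (cop k v)"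
  and cop_bop: "cop k (bop l v) = bop l (cop k v) + (if k = l then v else 0)"
  by (auto simp: bop_def cop_def linear_opD[OF linear_mul_var] linear_opD[OF linear_pderiv_var]
      mul_var_commute pderiv_var_commute pderiv_mul_var)

text \<open>In characteristic zero a polynomial with vanishing partial derivatives is constant: the
  coefficient of the derivative at \<open>M\<close> is a positive integer times that of
  \<open>g\<close> at \<open>add_mset k M\<close>.\<close>

lemma fock_scalar:
  assumes "\<And>k. pderiv_var k g = 0"
  shows "g = scale (Poly_Mapping.lookup g {#}) (basis_vec {#})"
proof (rule poly_mapping_eqI)
  fix M
  have "Poly_Mapping.lookup g (add_mset k M) = 0" for k M
  proof -
    have "Poly_Mapping.lookup (pderiv_var k g) M = of_nat (Suc (count M k)) * Poly_Mapping.lookup g (add_mset k M)" for g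
    proof (induction g rule: free_space_induct)
      case (basis N)
      then show ?case
        by (cases "k \<in># N") (auto simp: pderiv_var_basis lookup_single when_def not_in_iff)
    qed (simp_all add: linear_opD[OF linear_pderiv_var] lookup_add algebra_simps del: of_nat_Suc)
    from this[of g] show ?thesis using assms by (simp del: of_nat_Suc)
  qed
  then show "Poly_Mapping.lookup g M = Poly_Mapping.lookup (scale (Poly_Mapping.lookup g {#}) (basis_vec {#})) M"
    by (cases M) (auto simp: lookup_single lookup_one)
qed

context fixes \<alpha> \<beta> :: complex
begin

text \<open>The coefficients of \<open>intermediate_basis_act\<close>. In this context \<alpha> and
  \<beta> are parameters of the model, to be adjusted to a given weight and charge; they are
  unrelated to the series in the theorem.\<close>

definition coef :: "int \<Rightarrow> int \<Rightarrow> complex" where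
  "coef m k = \<alpha> + of_int k + of_int m * \<beta>"

definition vir_term :: "int \<Rightarrow> int \<Rightarrow> fock \<Rightarrow> fock" where
  "vir_term m k v = scale (coef m k) (bop (m + k) (cop k v))
    + scale (if m = 0 \<and> 0 \<le> k then coef m k else 0) v"

text \<open>On the monomial \<open>M\<close> a summand survives only if \<open>cop k\<close>
  differentiates by a variable of \<open>M\<close>, if \<open>bop (m + k)\<close> does, or if both
  operators multiply, that is \<open>0 \<le> k < - m\<close>.\<close>

definition vir_support :: "int \<Rightarrow> int multiset \<Rightarrow> int set" where
  "vir_support m M = set_mset M \<union> (\<lambda>k. k - m) ` set_mset M \<union> {0..<-m}"

text \<open>The constant that normal ordering leaves free at m = 0. With this value the vacuum part
  of the commutator of d_m and d_{-m} becomes a multiple of m^3 - m; any other value would leave an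
  extra term linear in m.\<close>

definition fock_weight :: complex where
  "fock_weight = (\<alpha>\<^sup>2 - \<alpha> + \<beta> * (1 - \<beta>)) / 2"

definition fock_op :: "int \<Rightarrow> fock \<Rightarrow> fock" where
  "fock_op m v = lin_ext (\<lambda>M. \<Sum>k\<in>vir_support m M. vir_term m k (basis_vec M)) v
    + scale (if m = 0 then fock_weight else 0) v"

lemma linear_vir_term: "linear_op (vir_term m k)"
  by (simp add: linear_op_def vir_term_def bop_simps(1,2) cop_simps(1,2) scale_add_right mult.commute)

lemma linear_fock_op: "linear_op (fock_op m)"
  by (simp add: linear_op_def fock_op_def lin_ext_add lin_ext_scale scale_add_right mult.commute)

lemma vir_term_eq_0:
  assumes "k \<notin> vir_support m M"
  shows "vir_term m k (basis_vec M) = 0"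
proof -
  have k: "k \<notin># M" "m + k \<notin># M" "\<not> (0 \<le> k \<and> m + k < 0)"
    using assms by (auto simp: vir_support_def image_iff)
  then show ?thesis
    by (auto simp: vir_term_def bop_def cop_def mul_var_basis pderiv_var_basis not_in_iff
        linear_opD[OF linear_pderiv_var] linear_opD[OF linear_mul_var] scale_minus_right)
qed

text \<open>A vector involves finitely many monomials, so every sufficiently large finite index set
  computes the operator on it. This removes the dependence of the summation range on the
  monomial.\<close>

lemma fock_op_eventually:
  "\<forall>\<^sub>F S in finite_subsets_at_top UNIV.
    fock_op m v = (\<Sum>k\<in>S. vir_term m k v) + scale (if m = 0 then fock_weight else 0) v"
proof (induction v rule: free_space_induct)
  case zero
  show ?case by (simp add: linear_opD(3)[OF linear_fock_op] linear_opD(3)[OF linear_vir_term])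
next
  case (basis M)
  have fin: "finite (vir_support m M)" by (simp add: vir_support_def)
  have "fock_op m (basis_vec M) = (\<Sum>k\<in>S. vir_term m k (basis_vec M))
      + scale (if m = 0 then fock_weight else 0) (basis_vec M)"
    if "finite S" "vir_support m M \<subseteq> S" for S
  proof -
    have "(\<Sum>k\<in>S. vir_term m k (basis_vec M)) = (\<Sum>k\<in>vir_support m M. vir_term m k (basis_vec M))"
      using that by (intro sum.mono_neutral_right) (auto simp: vir_term_eq_0)
    then show ?thesis by (simp only: fock_op_def lin_ext_single scale_one)
  qed
  then show ?case
    unfolding eventually_finite_subsets_at_top
    by (intro exI[of _ "vir_support m M"]) (use fin in blast)
next
  case (add p q)
  then show ?case
    by eventually_elim
      (simp add: linear_opD(1)[OF linear_fock_op] linear_opD(1)[OF linear_vir_term] sum.distrib scale_add_right)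
next
  case (scale a p)
  then show ?case
    by eventually_elim
      (simp add: linear_opD(2)[OF linear_fock_op] linear_opD(2)[OF linear_vir_term] scale_add_right
        scale_sum_right[symmetric] mult.commute[of a])
qed

text \<open>Puts both sides of a commutator over the same index set, which also contains the one
  index \<open>l\<close> whose term fails to commute.\<close>

lemma fock_op_common:
  obtains S where "finite S" "l \<in> S"
    "fock_op m v = (\<Sum>k\<in>S. vir_term m k v) + scale (if m = 0 then fock_weight else 0) v"
    "fock_op m w = (\<Sum>k\<in>S. vir_term m k w) + scale (if m = 0 then fock_weight else 0) w"
proof -
  have "\<forall>\<^sub>F S in finite_subsets_at_top UNIV. finite S \<and> l \<in> S"
    unfolding eventually_finite_subsets_at_top by (intro exI[of _ "{l}"]) auto
  with fock_op_eventually[of m v] fock_op_eventually[of m w]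
  have "\<forall>\<^sub>F S in finite_subsets_at_top UNIV. (finite S \<and> l \<in> S) \<and>
    fock_op m v = (\<Sum>k\<in>S. vir_term m k v) + scale (if m = 0 then fock_weight else 0) v \<and>
    fock_op m w = (\<Sum>k\<in>S. vir_term m k w) + scale (if m = 0 then fock_weight else 0) w"
    by eventually_elim blast
  from eventually_happens'[OF _ this] show ?thesis using that by auto
qed

text \<open>By \<open>cop_bop\<close> only the summand k = l fails to commute with
  \<open>bop l\<close>; the scalar corrections commute with everything. The operators
  \<open>bop l\<close> thus transform like the vectors v_l of the series.\<close>

lemma fock_op_bop: "fock_op m (bop l v) = bop l (fock_op m v) + scale (coef m l) (bop (m + l) v)"
proof -
  obtain S where S: "finite S" "l \<in> S"
    "fock_op m v = (\<Sum>k\<in>S. vir_term m k v) + scale (if m = 0 then fock_weight else 0) v"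
    "fock_op m (bop l v) = (\<Sum>k\<in>S. vir_term m k (bop l v)) + scale (if m = 0 then fock_weight else 0) (bop l v)"
    by (rule fock_op_common[of l m v "bop l v"])
  have "vir_term m k (bop l v) = bop l (vir_term m k v) + (if k = l then scale (coef m l) (bop (m + l) v) else 0)" for k
  proof -
    have "bop (m + k) (cop k (bop l v)) = bop l (bop (m + k) (cop k v)) + (if k = l then bop (m + l) v else 0)"
      by (simp only: cop_bop bop_simps(1) bop_commute[of "m + k" l]) (simp add: bop_simps(3))
    then show ?thesis
      by (cases "k = l") (simp_all add: vir_term_def bop_simps(1,2) scale_add_right)
  qed
  then have "(\<Sum>k\<in>S. vir_term m k (bop l v)) = bop l (\<Sum>k\<in>S. vir_term m k v) + scale (coef m l) (bop (m + l) v)"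
    using S(1,2) by (simp add: bop_simps(6) sum.distrib)
  then show ?thesis
    by (simp only: S(3,4) bop_simps(1,2) ac_simps)
qed

text \<open>Dual to the previous commutator: the exceptional summand is the one with m + k = l, and
  the sign changes.\<close>

lemma fock_op_cop: "fock_op m (cop l v) = cop l (fock_op m v) - scale (coef m (l - m)) (cop (l - m) v)"
proof -
  obtain S where S: "finite S" "l - m \<in> S"
    "fock_op m v = (\<Sum>k\<in>S. vir_term m k v) + scale (if m = 0 then fock_weight else 0) v"
    "fock_op m (cop l v) = (\<Sum>k\<in>S. vir_term m k (cop l v)) + scale (if m = 0 then fock_weight else 0) (cop l v)"
    by (rule fock_op_common[of "l - m" m v "cop l v"])
  have "vir_term m k (cop l v) = cop l (vir_term m k v) - (if k = l - m then scale (coef m (l - m)) (cop (l - m) v) else 0)" for k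
  proof -
    have "cop l (bop (m + k) (cop k v)) = bop (m + k) (cop k (cop l v)) + (if k = l - m then cop k v else 0)"
      by (simp only: cop_bop cop_commute[of l k]) auto
    then show ?thesis
      by (cases "k = l - m") (simp_all add: vir_term_def cop_simps(1,2) scale_add_right)
  qed
  then have "(\<Sum>k\<in>S. vir_term m k (cop l v)) = cop l (\<Sum>k\<in>S. vir_term m k v) - scale (coef m (l - m)) (cop (l - m) v)"
    using S(1,2) by (simp add: cop_simps(6) sum_subtractf)
  then show ?thesis
    by (simp only: S(3,4) cop_simps(1,2)) (simp only: algebra_simps)
qed

abbreviation const_coeff :: "fock \<Rightarrow> complex" where "const_coeff v \<equiv> Poly_Mapping.lookup v {#}"

lemma const_coeff_mul_var: "const_coeff (mul_var k v) = 0"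
  by (induction v rule: free_space_induct)
     (simp_all add: linear_opD[OF linear_mul_var] mul_var_basis lookup_add lookup_single)

lemma fock_op_vac: "m > 0 \<Longrightarrow> fock_op m 1 = 0" "fock_op 0 1 = scale fock_weight 1"
  by (simp_all add: fock_op_def vir_support_def lin_ext_one)

text \<open>For m \<le> 0 each summand ends in a multiplication or, after a derivation has been
  moved past \<open>mul_var k\<close>, can be rewritten as one. The exception m = 0 leaves a scalar
  that the correction in \<open>vir_term\<close> cancels. Hence the constant coefficient is a lowest
  weight covector.\<close>

lemma const_coeff_fock_op_nonpos:
  assumes "m \<le> 0"
  shows "const_coeff (fock_op m v) = (if m = 0 then fock_weight * const_coeff v else 0)"
proof -
  have 0: "const_coeff (vir_term m k v) = 0" for k
    using assms by (auto simp: vir_term_def bop_def cop_def const_coeff_mul_var pderiv_mul_var lookup_add lookup_minus lookup_uminus)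
  from eventually_happens'[OF _ fock_op_eventually[of m v]] obtain S
    where "fock_op m v = (\<Sum>k\<in>S. vir_term m k v) + scale (if m = 0 then fock_weight else 0) v"
    by auto
  then show ?thesis by (simp add: lookup_add lookup_sum 0)
qed

text \<open>A form of Schur's lemma: \<open>K 1\<close> is killed by all derivations and so is
  constant, and multiplications generate every monomial from \<open>1\<close>.\<close>

lemma fock_commutant_scalar:
  assumes "linear_op K" "\<And>l v. K (bop l v) = bop l (K v)" "\<And>l v. K (cop l v) = cop l (K v)"
  shows "K v = scale (const_coeff (K 1)) v"
proof -
  have mul: "K (mul_var l v) = mul_var l (K v)" for l v
    using assms(2)[of l v] assms(3)[of l v] by (cases "l < 0") (simp_all add: bop_def cop_def)
  have "K (pderiv_var l v) = pderiv_var l (K v)" for l v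
    using assms(2)[of l v] assms(3)[of l v]
    by (cases "l < 0") (simp_all add: bop_def cop_def linear_opD(4)[OF assms(1)])
  moreover have "pderiv_var l 1 = 0" for l
    using pderiv_var_basis[of l "{#}" 1] by simp
  ultimately have "pderiv_var l (K 1) = 0" for l
    by (metis linear_opD(3)[OF assms(1)])
  then have one: "K 1 = scale (const_coeff (K 1)) 1"
    using fock_scalar[of "K 1"] by simp
  show ?thesis
  proof (rule linear_op_eqI[of K "scale (const_coeff (K 1))"])
    show "linear_op (scale (const_coeff (K 1)))"
      by (simp add: linear_op_def scale_add_right mult.commute)
    show "K (basis_vec M) = scale (const_coeff (K 1)) (basis_vec M)" for M
    proof (induction M)
      case empty
      then show ?case using one by simp
    next
      case (add x M)
      then show ?case
        using mul[of x "basis_vec M"] by (simp add: mul_var_basis)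
    qed
  qed fact
qed

text \<open>
  The defect of the bracket relation commutes with all multiplications and derivations, hence is the
  scalar by which it acts on the vacuum \<open>1\<close>.
\<close>

definition fock_defect :: "int \<Rightarrow> int \<Rightarrow> fock \<Rightarrow> fock" where
  "fock_defect m n v = fock_op m (fock_op n v) - fock_op n (fock_op m v)
    - scale (of_int (n - m)) (fock_op (m + n) v)"

lemmas fock_op_simps = linear_opD[OF linear_fock_op]

lemma linear_fock_defect: "linear_op (fock_defect m n)"
  by (simp add: linear_op_def fock_defect_def fock_op_simps(1,2) scale_add_right scale_diff_right mult.commute)

lemma fock_defect_bop: "fock_defect m n (bop l v) = bop l (fock_defect m n v)"
proof -
  \<comment> \<open>This is the bracket relation of the intermediate series, read off on the basis
    vector v_l.\<close>
  have eq: "coef n l * coef m (n + l) = coef m l * coef n (m + l) + of_int (n - m) * coef (m + n) l"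
    by (simp add: coef_def algebra_simps)
  have idx: "m + (n + l) = m + n + l" "n + (m + l) = m + n + l" by simp_all
  show ?thesis
    by (simp add: fock_defect_def fock_op_bop fock_op_simps(1,2) bop_simps(1,2,5) scale_add_right idx eq scale_add_left
        del: of_int_diff)
qed

lemma fock_defect_cop: "fock_defect m n (cop l v) = cop l (fock_defect m n v)"
proof -
  have eq: "coef m (l - m) * coef n (l - (m + n)) =
      coef n (l - n) * coef m (l - (m + n)) + of_int (n - m) * coef (m + n) (l - (m + n))"
    by (simp add: coef_def algebra_simps)
  have idx: "l - n - m = l - (m + n)" "l - m - n = l - (m + n)" by simp_all
  show ?thesis
    by (simp add: fock_defect_def fock_op_cop fock_op_simps(1,2,5) cop_simps(1,2,5) scale_diff_right idx eq scale_add_left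
        del: of_int_diff)
qed

text \<open>Equal to 2 (6 \<beta>^2 - 6 \<beta> + 1), the classical central charge of a beta-gamma
  system of conformal weight \<beta>.\<close>

definition fock_charge :: complex where
  "fock_charge = 2 - 12 * \<beta> * (1 - \<beta>)"

lemma const_coeff_fock_op_quadratic:
  assumes "0 < m" "i < 0" "0 \<le> k"
  shows "const_coeff (fock_op m (bop i (cop k 1))) = (if m + i = k then - coef m i else 0)"
proof -
  have "pderiv_var l 1 = 0" for l
    using pderiv_var_basis[of l "{#}" 1] by simp
  then have "const_coeff (bop (m + i) (cop k 1)) = (if m + i = k then - 1 else 0)"
    using assms by (auto simp: bop_def cop_def const_coeff_mul_var pderiv_mul_var linear_opD(3)[OF linear_mul_var])
  moreover have "const_coeff (bop i v) = 0" for v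
    using assms(2) by (simp add: bop_def const_coeff_mul_var)
  ultimately show ?thesis
    by (simp add: fock_op_bop lookup_add)
qed

lemma fock_op_neg_vac:
  assumes "n < 0"
  shows "fock_op n 1 = (\<Sum>k\<in>{0..<-n}. scale (coef n k) (bop (n + k) (cop k 1)))"
  using assms by (simp add: fock_op_def lin_ext_one vir_support_def vir_term_def)

text \<open>For negative n the vector \<open>fock_op n 1\<close> is a sum of quadratic monomials,
  one for each k in \<open>{0..<-n}\<close>, and \<open>fock_op m\<close> contracts such a monomial
  to a constant only when m + n = 0.\<close>

lemma const_coeff_fock_op_op:
  assumes "0 < m"
  shows "const_coeff (fock_op m (fock_op n 1)) =
    (if m + n = 0 then - (\<Sum>k<nat m. (\<alpha> + of_nat k - of_int m * \<beta>) * (\<alpha> + of_nat k - of_int m + of_int m * \<beta>)) else 0)"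
proof (cases "n < 0")
  case True
  have "const_coeff (fock_op m (fock_op n 1)) =
      (\<Sum>k\<in>{0..<-n}. coef n k * const_coeff (fock_op m (bop (n + k) (cop k 1))))"
    by (simp add: fock_op_neg_vac[OF True] fock_op_simps(2,6) lookup_sum)
  also have "\<dots> = (\<Sum>k\<in>{0..<-n}. if m + n = 0 then - (coef n k * coef m (n + k)) else 0)"
    using assms by (intro sum.cong refl) (auto simp: const_coeff_fock_op_quadratic)
  finally have 1: "const_coeff (fock_op m (fock_op n 1)) = \<dots>" .
  show ?thesis
  proof (cases "m + n = 0")
    case True
    then have "n = - m" by simp
    have "{0..<m} = int ` {..<nat m}"
      using assms by (simp add: lessThan_atLeast0 image_int_atLeastLessThan)
    then show ?thesis
      using 1[unfolded \<open>n = - m\<close>] by (simp add: \<open>n = - m\<close> sum_negf sum.reindex coef_def add_diff_eq)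
  qed (use 1 in simp)
next
  case False
  then have "n = 0 \<or> n > 0" by auto
  then show ?thesis
    using assms by (auto simp: fock_op_vac fock_op_simps(2,3))
qed

text \<open>The sum is needed with q = p = m and x = m \<beta>. Keeping \<open>p\<close> and
  \<open>x\<close> apart from the upper limit lets the induction move \<open>q\<close>
  alone.\<close>

lemma sum_quadratic:
  fixes x p :: complex
  shows "(\<Sum>k<q. (\<alpha> + of_nat k - x) * (\<alpha> + of_nat k - p + x)) =
    of_nat q * (\<alpha>\<^sup>2 - p * \<alpha> + x * (p - x)) + \<alpha> * (of_nat q * (of_nat q - 1))
    + (of_nat q - 1) * of_nat q * (2 * of_nat q - 1) / 6 - p * (of_nat q * (of_nat q - 1)) / 2"
  by (induction q) (simp_all add: field_simps power2_eq_square)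

lemma fock_defect_vac_pos:
  assumes "0 < m"
  shows "const_coeff (fock_defect m n 1) = (if m + n = 0 then of_int (m ^ 3 - m) / 12 * fock_charge else 0)"
proof -
  have n: "const_coeff (fock_op n (fock_op m 1)) = 0"
    using assms by (simp add: fock_op_vac fock_op_simps(3))
  have s: "const_coeff (fock_op (m + n) 1) = (if m + n = 0 then fock_weight else 0)"
    using const_coeff_fock_op_nonpos[of "m + n" 1] fock_op_vac(1)[of "m + n"]
    by (cases "m + n \<le> 0") simp_all
  show ?thesis
  proof (cases "m + n = 0")
    case True
    then have nm: "n = - m" by simp
    have m: "of_nat (nat m) = (of_int m :: complex)" using assms by simp
    have "const_coeff (fock_defect m n 1) = - (\<Sum>k<nat m. (\<alpha> + of_nat k - of_int m * \<beta>) * (\<alpha> + of_nat k - of_int m + of_int m * \<beta>))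
        + 2 * of_int m * fock_weight"
      using True n s const_coeff_fock_op_op[OF assms, of n] by (simp add: fock_defect_def lookup_minus nm)
    also have "\<dots> = of_int (m ^ 3 - m) / 12 * fock_charge"
      unfolding sum_quadratic m by (simp add: fock_weight_def fock_charge_def field_simps power2_eq_square power3_eq_cube)
    finally show ?thesis using True by simp
  next
    case False
    then show ?thesis
      using n s const_coeff_fock_op_op[OF assms, of n] by (simp add: fock_defect_def lookup_minus)
  qed
qed

text \<open>Antisymmetry in m and n reduces to a positive m, except when neither index is positive;
  then the constant coefficients of the two products agree and the remaining term contributes
  nothing.\<close>

lemma fock_defect_vac:
  "const_coeff (fock_defect m n 1) = (if m + n = 0 then of_int (m ^ 3 - m) / 12 * fock_charge else 0)"
proof -
  have swap: "fock_defect m n 1 = - fock_defect n m 1"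
    by (rule poly_mapping_eqI) (simp add: fock_defect_def lookup_minus lookup_add add.commute[of n m] left_diff_distrib)
  consider "m > 0" | "n > 0" | "m \<le> 0" "n \<le> 0" by linarith
  then show ?thesis
  proof cases
    case 1
    then show ?thesis by (rule fock_defect_vac_pos)
  next
    case 2
    have "of_int (n ^ 3 - n) = (- of_int (m ^ 3 - m) :: complex)" if "m + n = 0"
      using that by (simp add: add_eq_0_iff2)
    with fock_defect_vac_pos[OF 2, of m] show ?thesis
      unfolding swap by (auto simp: add.commute simp del: of_int_diff)
  next
    case 3
    then show ?thesis
      by (auto simp: fock_defect_def lookup_minus const_coeff_fock_op_nonpos lookup_one)
  qed
qed

lemma fock_op_bracket:
  "fock_op m (fock_op n v) - fock_op n (fock_op m v) =
    scale (of_int (n - m)) (fock_op (m + n) v) + scale (if n = - m then of_int (m ^ 3 - m) / 12 * fock_charge else 0) v"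
proof -
  have "m + n = 0 \<longleftrightarrow> n = - m" by auto
  then have "fock_defect m n v = scale (if n = - m then of_int (m ^ 3 - m) / 12 * fock_charge else 0) v"
    using fock_commutant_scalar[OF linear_fock_defect fock_defect_bop fock_defect_cop]
    by (simp only: fock_defect_vac)
  then show ?thesis unfolding fock_defect_def
    by (simp only: diff_eq_eq add.commute)
qed

section \<open>The operators assembled into a representation, and the choice of its
  parameters\<close>

definition fock_act :: "vir \<Rightarrow> fock \<Rightarrow> fock" where
  "fock_act x v = lin_ext (\<lambda>b. case b of Vd m \<Rightarrow> fock_op m v | VC \<Rightarrow> scale fock_charge v) x"

lemma fock_act_basis: "fock_act (basis_vec (Vd m)) v = fock_op m v" "fock_act (basis_vec VC) v = scale fock_charge v"
  by (simp_all add: fock_act_def)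

lemma fock_act_simps:
  "fock_act (x + y) v = fock_act x v + fock_act y v" "fock_act (scale a x) v = scale a (fock_act x v)"
  "fock_act x (v + w) = fock_act x v + fock_act x w" "fock_act x (scale a v) = scale a (fock_act x v)"
  "fock_act 0 v = 0" "fock_act x 0 = 0"
proof -
  have *: "(case b of Vd m \<Rightarrow> fock_op m (v + w) | VC \<Rightarrow> scale fock_charge (v + w)) =
    (case b of Vd m \<Rightarrow> fock_op m v | VC \<Rightarrow> scale fock_charge v) + (case b of Vd m \<Rightarrow> fock_op m w | VC \<Rightarrow> scale fock_charge w)"
    "(case b of Vd m \<Rightarrow> fock_op m (scale a v) | VC \<Rightarrow> scale fock_charge (scale a v)) =
    scale a (case b of Vd m \<Rightarrow> fock_op m v | VC \<Rightarrow> scale fock_charge v)" for b v w a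
    by (auto simp: fock_op_simps(1,2) scale_add_right mult.commute split: vir_basis.split)
  show "fock_act (x + y) v = fock_act x v + fock_act y v" "fock_act (scale a x) v = scale a (fock_act x v)"
  "fock_act x (v + w) = fock_act x v + fock_act x w" and s: "fock_act x (scale a v) = scale a (fock_act x v)" for a v
    unfolding fock_act_def * lin_ext_add lin_ext_scale lin_ext_add_fun lin_ext_scale_fun by (rule refl)+
  show "fock_act 0 v = 0" by (simp add: fock_act_def)
  show "fock_act x 0 = 0" using s[of 0 0] by simp
qed

lemma fock_act_bracket:
  "fock_act (bracket Vir x y) v = fock_act x (fock_act y v) - fock_act y (fock_act x v)"
proof (induction x rule: free_space_induct)
  case (basis i)
  show ?case
  proof (induction y rule: free_space_induct)
    case (basis j)
    show ?case
    proof (cases "\<exists>m n. i = Vd m \<and> j = Vd n")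
      case True
      then obtain m n where ij: "i = Vd m" "j = Vd n" by blast
      show ?thesis
        unfolding ij Vir_bracket_basis fock_act_basis fock_op_bracket vir_basis_bracket.simps fock_act_simps
        by (simp add: fock_act_simps fock_act_basis del: scale_single of_int_diff)
    next
      case False
      then show ?thesis
        by (cases i; cases j) (auto simp: Vir_bracket_basis fock_act_simps fock_act_basis fock_op_simps(2))
    qed
  qed (simp_all add: fock_act_simps Vir_bracket_simps scale_diff_right)
qed (simp_all add: fock_act_simps Vir_bracket_simps scale_diff_right)

end

lemma fock_parameters_exist: "\<exists>\<alpha> \<beta>. fock_weight \<alpha> \<beta> = h \<and> fock_charge \<beta> = c"
proof -
  \<comment> \<open>Writing \<beta> = (1 + s)/2 turns the charge into 3 s^2 - 1, so s^2 must be (c +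
    1)/3. With \<beta> fixed, the weight equation becomes \<alpha>^2 - \<alpha> = - t, solved by
    completing the square as well.\<close>
  define \<beta> where "\<beta> = (1 + csqrt (1 - (2 - c) / 3)) / 2"
  define t where "t = \<beta> * (1 - \<beta>) - 2 * h"
  define \<alpha> where "\<alpha> = (1 + csqrt (1 - 4 * t)) / 2"
  have "fock_charge ((1 + s) / 2) = 3 * s\<^sup>2 - 1" for s
    by (simp add: fock_charge_def field_simps power2_eq_square)
  then have "fock_charge \<beta> = c" by (simp add: \<beta>_def diff_divide_distrib)
  moreover have "((1 + r) / 2)\<^sup>2 - (1 + r) / 2 = (r\<^sup>2 - 1) / 4" for r :: complex
    by (simp add: field_simps power2_eq_square)
  then have "\<alpha>\<^sup>2 - \<alpha> = - t" unfolding \<alpha>_def by (simp only: power2_csqrt) simp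
  ultimately show ?thesis
    by (intro exI[of _ \<alpha>] exI[of _ \<beta>]) (simp add: fock_weight_def t_def)
qed

section \<open>Left ideals of highest weight\<close>

lemma scale_diff_left: "scale (a - b) p = scale a p - scale b p"
  by (rule poly_mapping_eqI) (simp add: lookup_minus left_diff_distrib)

lemma free_space_expansion:
  "p = (\<Sum>k\<in>Poly_Mapping.keys p. scale (Poly_Mapping.lookup p k) (basis_vec k))"
  by (rule poly_mapping_eqI) (simp add: lookup_sum lookup_single when_def in_keys_iff)

definition nonneg_char :: "complex \<Rightarrow> complex \<Rightarrow> vir falg \<Rightarrow> complex" where
  "nonneg_char c h r = (\<Sum>w\<in>Poly_Mapping.keys r. Poly_Mapping.lookup r w *
    (\<Prod>x\<leftarrow>letters w. Poly_Mapping.lookup x (Vd 0) * h + Poly_Mapping.lookup x VC * c))"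

lemma free_algebra_act_highest_weight_line:
  "free_algebra_act (highest_weight_line c h) r n = nonneg_char c h r * n"
proof -
  interpret lie_module Vir_nonneg "highest_weight_line c h" by (rule lie_module_highest_weight_line)
  have ops: "carrier (highest_weight_line c h) = UNIV" "zero (highest_weight_line c h) = 0"
    "add (highest_weight_line c h) = (+)" "module.smult (highest_weight_line c h) = (*)"
    by (simp_all add: highest_weight_line_def)
  have fs: "finsum (highest_weight_line c h) f S = sum f S" if "finite S" for f and S :: "vir fword set"
    using that by (induction S) (simp_all add: ops M.M.finsum_insert)
  have "foldr (act (highest_weight_line c h)) xs n =
      (\<Prod>x\<leftarrow>xs. Poly_Mapping.lookup x (Vd 0) * h + Poly_Mapping.lookup x VC * c) * n" for xs
    by (induction xs) (simp_all add: highest_weight_line_def)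
  then show ?thesis
    unfolding free_algebra_act_def nonneg_char_def fs[OF finite_keys] ops
    by (simp add: sum_distrib_right mult.assoc)
qed

abbreviation dg :: "int \<Rightarrow> vir falg" where "dg n \<equiv> gen (basis_vec (Vd n))"
abbreviation cg :: "vir falg" where "cg \<equiv> gen (basis_vec VC)"

text \<open>Products of negative generators in arbitrary order. The number is the total degree, by
  which d_0 drops below the highest weight.\<close>

inductive neg_word :: "nat \<Rightarrow> vir falg \<Rightarrow> bool" where
  neg_word_one: "neg_word 0 1"
| neg_word_mult: "neg_word i p \<Longrightarrow> 0 < k \<Longrightarrow> neg_word (i + k) (dg (- int k) * p)"

text \<open>A left ideal of the free algebra that contains the enveloping relations is the same as a
  left ideal of the enveloping algebra. Representatives keep all computations in an ordinary ring;
  equations hold modulo \<open>L\<close>.\<close>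

locale vir_left_ideal =
  fixes L :: "vir falg set"
  assumes L_add: "p \<in> L \<Longrightarrow> q \<in> L \<Longrightarrow> p + q \<in> L"
    and L_left: "p \<in> L \<Longrightarrow> q * p \<in> L"
    and L_ideal: "p \<in> uea_ideal Vir \<Longrightarrow> p \<in> L"
begin

lemma L_zero: "0 \<in> L"
  using L_ideal uea_ideal_Vir_closed(4) by blast

lemma L_scale: "p \<in> L \<Longrightarrow> scale a p \<in> L"
  using L_left[of p "scale a 1"] by (simp add: scale_mult_left)

lemma L_diff: "p \<in> L \<Longrightarrow> q \<in> L \<Longrightarrow> p - q \<in> L"
  using L_add[of p "- q"] L_left[of q "- 1"] by simp

lemma L_cong: "p - q \<in> L \<Longrightarrow> p \<in> L \<longleftrightarrow> q \<in> L"
  using L_add[of "p - q" q] L_diff[of p "p - q"] by auto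

lemma gen_add: "gen (x + y) * p - (gen x * p + gen y * p) \<in> L"
  using L_ideal[OF uea_ideal_Vir_closed(3)[OF uea_ideal_Vir_relations(1)[of x y], of p]]
  by (simp add: algebra_simps)

lemma gen_scale: "gen (Poly_Mapping.single b a) * p - scale a (gen (basis_vec b) * p) \<in> L"
  using L_ideal[OF uea_ideal_Vir_closed(3)[OF uea_ideal_Vir_relations(2)[of a "basis_vec b"], of p]]
  by (simp add: algebra_simps scale_mult_left[symmetric])

lemma gen_zero: "gen 0 * p \<in> L"
  using L_ideal[OF uea_ideal_Vir_closed(3)[OF uea_ideal_Vir_relations(2)[of 0 0], of p]] by simp

lemma gen_bracket: "gen x * (gen y * p) - gen y * (gen x * p) - gen (bracket Vir x y) * p \<in> L"
  using L_ideal[OF uea_ideal_Vir_closed(3)[OF uea_ideal_Vir_relations(3)[of x y], of p]]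
  by (simp only: left_diff_distrib mult.assoc)

lemma dg_commute:
  "dg m * (dg n * p) - (dg n * (dg m * p) + scale (of_int (n - m)) (dg (m + n) * p)
    + scale (if n = - m then of_int (m ^ 3 - m) / 12 else 0) (cg * p)) \<in> L"
proof -
  define a where "a = (of_int (n - m) :: complex)"
  define b where "b = (if n = - m then of_int (m ^ 3 - m) / 12 else 0 :: complex)"
  have br: "bracket Vir (basis_vec (Vd m)) (basis_vec (Vd n)) =
      Poly_Mapping.single (Vd (m + n)) a + Poly_Mapping.single VC b"
    by (simp add: Vir_bracket_basis a_def b_def)
  let ?x = "gen (Poly_Mapping.single (Vd (m + n)) a) * p" and ?y = "gen (Poly_Mapping.single VC b) * p"
  have "(dg m * (dg n * p) - dg n * (dg m * p) - gen (Poly_Mapping.single (Vd (m + n)) a + Poly_Mapping.single VC b) * p)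
     + (gen (Poly_Mapping.single (Vd (m + n)) a + Poly_Mapping.single VC b) * p - (?x + ?y))
     + (?x - scale a (dg (m + n) * p)) + (?y - scale b (cg * p)) \<in> L"
    by (intro L_add gen_add gen_scale) (rule gen_bracket[of "basis_vec (Vd m)" "basis_vec (Vd n)", unfolded br])
  then show ?thesis unfolding a_def[symmetric] b_def[symmetric] by (simp add: algebra_simps)
qed

lemma cg_commute: "cg * (dg n * p) - dg n * (cg * p) \<in> L"
proof -
  have "bracket Vir (basis_vec VC) (basis_vec (Vd n)) = 0" by (simp add: Vir_bracket_basis)
  with L_add[OF gen_bracket[of "basis_vec VC" "basis_vec (Vd n)" p] gen_zero[of p]] show ?thesis
    by simp
qed

text \<open>Only elements \<open>d\<^sub>n\<close> of large index are needed, so the central term never interferes.\<close>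

lemma eventually_annihilates_mult:
  assumes p: "\<exists>N. \<forall>n>N. dg n * p \<in> L"
  shows "\<exists>N. \<forall>n>N. dg n * (gen x * p) \<in> L"
proof (induction x rule: free_space_induct)
  case zero
  show ?case using gen_zero L_left by blast
next
  case (basis b)
  from p obtain N where N: "\<And>n. n > N \<Longrightarrow> dg n * p \<in> L" by blast
  show ?case
  proof (cases b)
    case (Vd k)
    \<comment> \<open>The three bounds put \<open>dg n * p\<close> and \<open>dg (n + k) * p\<close>
      into \<open>L\<close> and exclude k = - n, the case with a central term.\<close>
    have "dg n * (dg k * p) \<in> L" if n: "n > max (max N (N - k)) (- k)" for n
    proof -
      have "k \<noteq> - n" "dg n * p \<in> L" "dg (n + k) * p \<in> L" using n N by auto
      then have "dg k * (dg n * p) + scale (of_int (k - n)) (dg (n + k) * p)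
        + scale (if k = - n then of_int (n ^ 3 - n) / 12 else 0) (cg * p) \<in> L"
        using L_add[OF L_left L_scale] by simp
      with L_cong[OF dg_commute] show ?thesis by blast
    qed
    then show ?thesis using Vd by blast
  next
    case VC
    have "dg n * (cg * p) \<in> L" if "n > N" for n
      using L_cong[OF cg_commute] L_left[OF N[OF that]] by blast
    then show ?thesis using VC by blast
  qed
next
  case (add x y)
  then obtain N N' where N: "\<And>n. n > N \<Longrightarrow> dg n * (gen x * p) \<in> L" "\<And>n. n > N' \<Longrightarrow> dg n * (gen y * p) \<in> L"
    by blast
  have "dg n * (gen (x + y) * p) \<in> L" if "n > max N N'" for n
  proof -
    have "dg n * (gen x * p + gen y * p) \<in> L" using L_add N that by (simp add: distrib_left)
    with L_cong[of "dg n * (gen (x + y) * p)"] L_left[OF gen_add[of x y p], of "dg n"] show ?thesis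
      by (simp add: right_diff_distrib)
  qed
  then show ?case by blast
next
  case (scale a x)
  then obtain N where N: "\<And>n. n > N \<Longrightarrow> dg n * (gen x * p) \<in> L" by blast
  have s: "gen (scale a x) * p - scale a (gen x * p) \<in> L"
    using L_ideal[OF uea_ideal_Vir_closed(3)[OF uea_ideal_Vir_relations(2)[of a x], of p]]
    by (simp only: left_diff_distrib scale_mult_left)
  have "dg n * (gen (scale a x) * p) \<in> L" if "n > N" for n
  proof -
    have "dg n * scale a (gen x * p) \<in> L"
      using L_scale[OF N[OF that], of a] by (simp add: scale_mult_right)
    with L_cong[of "dg n * (gen (scale a x) * p)"] L_left[OF s, of "dg n"] show ?thesis
      by (simp only: right_diff_distrib)
  qed
  then show ?case by blast
qed

end

locale vir_hw_left_ideal = vir_left_ideal +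
  fixes c h :: complex
  assumes pos: "0 < n \<Longrightarrow> dg n \<in> L"
    and dg_0: "dg 0 - scale h 1 \<in> L"
    and cg: "cg - scale c 1 \<in> L"
begin

text \<open>The empty word is killed by all positive generators, and each further letter only raises
  the bound.\<close>

lemma eventually_annihilates: "\<exists>N. \<forall>n>N. dg n * p \<in> L"
proof (induction p rule: free_space_induct)
  case zero
  then show ?case by (simp add: L_zero)
next
  case (basis w)
  show ?case
  proof (induction w)
    case (FWord xs)
    then show ?case
    proof (induction xs)
      case Nil
      show ?case using pos by (metis mult_1_right one_falg)
    next
      case (Cons x xs)
      then show ?case
        by (subst basis_fword_Cons) (intro eventually_annihilates_mult)
    qed
  qed
next
  case (add p q)
  then obtain N N' where "\<And>n. n > N \<Longrightarrow> dg n * p \<in> L" "\<And>n. n > N' \<Longrightarrow> dg n * q \<in> L"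
    by blast
  then show ?case by (intro exI[of _ "max N N'"]) (simp add: distrib_left L_add)
next
  case (scale a p)
  then show ?case by (metis L_scale scale_mult_right)
qed

text \<open>The span of the negative words together with \<open>L\<close>. In inductive form it
  yields, once \<open>neg_span_all\<close> is known, an induction principle for statements that are
  linear in p and hold on \<open>L\<close>.\<close>

inductive neg_span :: "vir falg \<Rightarrow> bool" where
  neg_span_word: "neg_word i p \<Longrightarrow> neg_span p"
| neg_span_add: "neg_span p \<Longrightarrow> neg_span q \<Longrightarrow> neg_span (p + q)"
| neg_span_scale: "neg_span p \<Longrightarrow> neg_span (scale a p)"
| neg_span_L: "p \<in> L \<Longrightarrow> neg_span p"

lemma neg_span_cong: "neg_span q \<Longrightarrow> p - q \<in> L \<Longrightarrow> neg_span p"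
  using neg_span_add[OF _ neg_span_L, of q "p - q"] by simp

lemma neg_word_cg: "neg_word i p \<Longrightarrow> cg * p - scale c p \<in> L"
proof (induction rule: neg_word.induct)
  case neg_word_one
  then show ?case using cg by simp
next
  case (neg_word_mult i p k)
  have "(cg * (dg (- int k) * p) - dg (- int k) * (cg * p)) + dg (- int k) * (cg * p - scale c p) \<in> L"
    by (intro L_add L_left cg_commute neg_word_mult)
  then show ?case by (simp add: right_diff_distrib scale_mult_right)
qed

lemma neg_word_dg_0: "neg_word i p \<Longrightarrow> dg 0 * p - scale (h - of_nat i) p \<in> L"
proof (induction rule: neg_word.induct)
  case neg_word_one
  then show ?case using dg_0 by simp
next
  case (neg_word_mult i p k)
  have "(dg 0 * (dg (- int k) * p) - (dg (- int k) * (dg 0 * p) + scale (- of_nat k) (dg (- int k) * p)))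
    + dg (- int k) * (dg 0 * p - scale (h - of_nat i) p) \<in> L"
    by (intro L_add L_left neg_word_mult) (use dg_commute[of 0 "- int k" p] neg_word_mult in simp)
  moreover have "scale (h - of_nat (i + k)) q = scale (h - of_nat i) q + scale (- of_nat k) q" for q :: "vir falg"
    by (simp add: algebra_simps flip: scale_add_left)
  ultimately show ?case by (simp add: right_diff_distrib scale_mult_right algebra_simps)
qed

lemma neg_span_dg_neg: "neg_span p \<Longrightarrow> n < 0 \<Longrightarrow> neg_span (dg n * p)"
proof (induction rule: neg_span.induct)
  case (neg_span_word i p)
  then show ?case using neg_word_mult[of i p "nat (- n)"] neg_span.neg_span_word by simp
qed (auto simp: distrib_left scale_mult_right intro: neg_span.intros L_left)

text \<open>Moving \<open>dg n\<close> past the first letter produces \<open>dg (n - int k)\<close>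
  and a central term on the shorter word, hence the induction for arbitrary n.\<close>

lemma neg_word_dg: "neg_word i p \<Longrightarrow> neg_span (dg n * p)"
proof (induction arbitrary: n rule: neg_word.induct)
  case neg_word_one
  have "neg_span (dg n)" if "n < 0"
    using neg_word_mult[OF neg_word.neg_word_one, of "nat (- n)"] neg_span_word that by fastforce
  moreover have "neg_span (dg 0)"
    using neg_span_cong[OF neg_span_scale[OF neg_span_word[OF neg_word.neg_word_one]] dg_0] .
  moreover have "neg_span (dg n)" if "n > 0" using pos[OF that] by (rule neg_span_L)
  ultimately show ?case by (cases n "0::int" rule: linorder_cases) auto
next
  case (neg_word_mult i p k)
  have 1: "neg_span (cg * p)"
    by (rule neg_span_cong[OF neg_span_scale[OF neg_span_word[OF neg_word_mult(1)]] neg_word_cg[OF neg_word_mult(1)]])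
  have 2: "neg_span (dg (- int k) * (dg n * p))"
    by (rule neg_span_dg_neg) (use neg_word_mult in auto)
  show ?case
    by (rule neg_span_cong[OF _ dg_commute], intro neg_span_add neg_span_scale neg_word_mult(3) 1 2)
qed

lemma neg_span_gen: "neg_span p \<Longrightarrow> neg_span (gen x * p)"
proof (induction rule: neg_span.induct)
  case (neg_span_word i p)
  show ?case
  proof (induction x rule: free_space_induct)
    case zero
    then show ?case by (intro neg_span_L gen_zero)
  next
    case (basis b)
    show ?case
    proof (cases b)
      case (Vd n)
      then show ?thesis using neg_word_dg[OF neg_span_word] by simp
    next
      case VC
      then show ?thesis
        using neg_span_cong[OF neg_span_scale[OF neg_span.neg_span_word[OF neg_span_word]] neg_word_cg[OF neg_span_word]]
        by simp
    qed
  next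
    case (add x y)
    then show ?case by (rule neg_span_cong[OF neg_span_add gen_add])
  next
    case (scale a x)
    have "gen (scale a x) * p - scale a (gen x * p) \<in> L"
      using L_ideal[OF uea_ideal_Vir_closed(3)[OF uea_ideal_Vir_relations(2)[of a x], of p]]
      by (simp only: left_diff_distrib scale_mult_left)
    then show ?case by (rule neg_span_cong[rotated]) (intro neg_span_scale scale)
  qed
qed (auto simp: distrib_left scale_mult_right intro: neg_span.intros L_left)

lemma neg_span_all: "neg_span p"
proof (induction p rule: free_space_induct)
  case zero
  then show ?case by (intro neg_span_L L_zero)
next
  case (basis w)
  show ?case
  proof (induction w)
    case (FWord xs)
    then show ?case
    proof (induction xs)
      case Nil
      show ?case using neg_span_word[OF neg_word_one] by (simp only: one_falg)
    next
      case (Cons x xs)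
      then show ?case by (subst basis_fword_Cons) (intro neg_span_gen)
    qed
  qed
qed (auto intro: neg_span_add neg_span_scale)

lemma cg_mult: "cg * p - scale c p \<in> L"
proof (induction rule: neg_span.induct[OF neg_span_all[of p]])
  case (1 i p)
  then show ?case by (rule neg_word_cg)
next
  case (2 p q)
  then show ?case using L_add[of "cg * p - scale c p" "cg * q - scale c q"]
    by (simp add: algebra_simps scale_add_right)
next
  case (3 p a)
  then show ?case using L_scale[of "cg * p - scale c p" a]
    by (simp add: scale_diff_right scale_mult_right mult.commute)
next
  case (4 p)
  then show ?case by (intro L_diff L_left L_scale)
qed

text \<open>The factor for i kills the weight h - i. On the weight h the difference acts as i, so
  the factor 1/i makes it the identity there.\<close>

definition weight_proj :: "nat list \<Rightarrow> vir falg" where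
  "weight_proj is = prod_list (map (\<lambda>i. scale (1 / of_nat i) (dg 0 - scale (h - of_nat i) 1)) is)"

lemma weight_proj_simps:
  "weight_proj [] = 1"
  "weight_proj (i # is) = scale (1 / of_nat i) (dg 0 - scale (h - of_nat i) 1) * weight_proj is"
  "weight_proj (is @ js) = weight_proj is * weight_proj js"
  by (simp_all add: weight_proj_def)

text \<open>Both are polynomials in \<open>dg 0\<close>.\<close>

lemma weight_proj_commute: "weight_proj is * weight_proj js = weight_proj js * weight_proj is"
proof -
  have comm_mult: "x * (y * z) = y * z * x" if "x * y = y * x" "x * z = z * x" for x y z :: "vir falg"
    using that by (metis mult.assoc)
  let ?r = "\<lambda>i. scale (1 / of_nat i) (dg 0 - scale (h - of_nat i) 1)"
  have "dg 0 * ?r i = ?r i * dg 0" for i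
    by (simp add: scale_mult_left scale_mult_right left_diff_distrib right_diff_distrib)
  then have "dg 0 * weight_proj is = weight_proj is * dg 0" for "is"
    by (induction "is") (simp only: weight_proj_simps mult_1_left mult_1_right,
      simp only: weight_proj_simps comm_mult)
  then have "?r i * weight_proj is = weight_proj is * ?r i" for i "is"
    by (simp add: scale_mult_left scale_mult_right left_diff_distrib right_diff_distrib)
  then show ?thesis
    by (induction js) (simp only: weight_proj_simps mult_1_left mult_1_right,
      simp only: weight_proj_simps comm_mult)
qed

lemma weight_proj_one: "0 \<notin> set is \<Longrightarrow> weight_proj is - 1 \<in> L"
proof (induction "is")
  case Nil
  then show ?case by (simp add: weight_proj_simps L_zero)
next
  case (Cons i "is")
  let ?r = "scale (1 / of_nat i) (dg 0 - scale (h - of_nat i) 1)"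
  have "?r - 1 = scale (1 / of_nat i) (dg 0 - scale h 1)"
    using Cons.prems by (intro poly_mapping_eqI) (simp add: lookup_minus field_simps)
  then have "?r - 1 \<in> L" using L_scale[OF dg_0] by simp
  moreover have "?r * (weight_proj is - 1) \<in> L" using Cons by (intro L_left) simp
  ultimately show ?case
    using L_add[of "?r - 1" "?r * (weight_proj is - 1)"]
    by (simp only: weight_proj_simps right_diff_distrib mult_1_right diff_add_cancel add.commute)
       (simp add: algebra_simps)
qed

end

text \<open>The vacuum expectation value of p in axiomatic form: \<open>eps_gen\<close> says that
  the vacuum to the right of p is a highest weight vector, \<open>eps_nonpos\<close> that the
  covector to its left is of lowest weight. The Fock model serves to show that such a functional
  exists.\<close>

locale vir_hw_functional =
  fixes c h :: complex and \<epsilon> :: "vir falg \<Rightarrow> complex"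
  assumes eps_add: "\<epsilon> (p + q) = \<epsilon> p + \<epsilon> q"
    and eps_scale: "\<epsilon> (scale a p) = a * \<epsilon> p"
    and eps_one: "\<epsilon> 1 = 1"
    and eps_ideal: "p \<in> uea_ideal Vir \<Longrightarrow> \<epsilon> p = 0"
    and eps_nonpos: "n \<le> 0 \<Longrightarrow> \<epsilon> (dg n * p) = (if n = 0 then h else 0) * \<epsilon> p"
    and eps_gen: "x \<in> carrier Vir_nonneg \<Longrightarrow>
      \<epsilon> (p * gen x) = (Poly_Mapping.lookup x (Vd 0) * h + Poly_Mapping.lookup x VC * c) * \<epsilon> p"
begin

lemma eps_dg: "n \<ge> 0 \<Longrightarrow> \<epsilon> (p * dg n) = (if n = 0 then h else 0) * \<epsilon> p"
  and eps_cg: "\<epsilon> (p * cg) = c * \<epsilon> p"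
  by (simp_all add: eps_gen Vir_nonneg_def lookup_single when_def)

lemma eps_zero: "\<epsilon> 0 = 0"
  using eps_scale[of 0 0] by simp

lemma eps_diff: "\<epsilon> (p - q) = \<epsilon> p - \<epsilon> q"
  using eps_add[of "p - q" q] by simp

lemma eps_neg_word: "neg_word i p \<Longrightarrow> \<epsilon> (p * q) = (if i = 0 then \<epsilon> q else 0)"
  by (cases rule: neg_word.cases) (auto simp: mult.assoc eps_nonpos)

lemma eps_sum: "\<epsilon> (\<Sum>i\<in>I. f i) = (\<Sum>i\<in>I. \<epsilon> (f i))"
  by (induction I rule: infinite_finite_induct) (simp_all add: eps_add eps_zero)

lemma eps_nonneg:
  assumes "r \<in> carrier (free_algebra (carrier Vir_nonneg))"
  shows "\<epsilon> (p * r) = nonneg_char c h r * \<epsilon> p"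
proof -
  have word: "\<epsilon> (p * basis_vec (FWord xs)) =
      (\<Prod>x\<leftarrow>xs. Poly_Mapping.lookup x (Vd 0) * h + Poly_Mapping.lookup x VC * c) * \<epsilon> p"
    if "set xs \<subseteq> carrier Vir_nonneg" for p xs
    using that
  proof (induction xs arbitrary: p)
    case Nil
    then show ?case by (simp flip: one_falg)
  next
    case (Cons x xs)
    then show ?case
      by (subst basis_fword_Cons) (simp add: eps_gen flip: mult.assoc)
  qed
  have "\<epsilon> (p * r) = (\<Sum>w\<in>Poly_Mapping.keys r. Poly_Mapping.lookup r w * \<epsilon> (p * basis_vec w))"
    by (subst free_space_expansion[of r]) (simp add: sum_distrib_left eps_sum scale_mult_right eps_scale del: scale_single)
  also have "\<dots> = (\<Sum>w\<in>Poly_Mapping.keys r. Poly_Mapping.lookup r w *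
      ((\<Prod>x\<leftarrow>letters w. Poly_Mapping.lookup x (Vd 0) * h + Poly_Mapping.lookup x VC * c) * \<epsilon> p))"
    using assms word[of "letters w" for w]
    by (intro sum.cong refl) (simp add: free_algebra_simps)
  finally show ?thesis by (simp add: nonneg_char_def sum_distrib_right mult.assoc)
qed

definition Ann :: "vir falg set" where
  "Ann = {p. \<forall>s. \<epsilon> (s * p) = 0}"

lemma Ann_eps: "p \<in> Ann \<Longrightarrow> \<epsilon> p = 0"
  unfolding Ann_def by (metis (mono_tags) mem_Collect_eq mult_1_left)

sublocale Ann: vir_hw_left_ideal Ann c h
proof
  fix n :: int
  show "0 < n \<Longrightarrow> dg n \<in> Ann" by (simp add: Ann_def eps_dg)
qed (auto simp: Ann_def distrib_left eps_add right_diff_distrib eps_diff eps_dg eps_cg eps_scale scale_mult_right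
    simp flip: mult.assoc intro: eps_ideal uea_ideal_Vir_closed)

text \<open>The lower weight components of \<open>q\<close> are killed by a product of factors \<open>d\<^sub>0 - (h - i)\<close>.\<close>

lemma one_in_left_ideal:
  assumes "vir_hw_left_ideal L c h" "\<And>p. p \<in> L \<Longrightarrow> \<epsilon> p = 0"
    and "vir_left_ideal K" "L \<subseteq> K" "q \<in> K" "\<epsilon> q \<noteq> 0"
  shows "1 \<in> K"
proof -
  interpret L: vir_hw_left_ideal L c h by fact
  interpret K: vir_left_ideal K by fact
  \<comment> \<open>The list collects the positive degrees occurring in \<open>q\<close>. What
    survives the product is the component of degree 0, and this is \<open>\<epsilon> q\<close> times
    the highest weight vector.\<close>
  have "\<exists>is. 0 \<notin> set is \<and> L.weight_proj is * q - scale (\<epsilon> q) 1 \<in> L"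
  proof (induction rule: L.neg_span.induct[OF L.neg_span_all[of q]])
    case (1 i p)
    show ?case
    proof (cases "i = 0")
      case True
      with 1 have "p = 1" by (cases rule: neg_word.cases) auto
      then show ?thesis by (intro exI[of _ "[]"]) (simp add: L.weight_proj_simps eps_one L.L_zero)
    next
      case False
      with eps_neg_word[OF 1, of 1] L.L_scale[OF L.neg_word_dg_0[OF 1], of "1 / of_nat i"] show ?thesis
        by (intro exI[of _ "[i]"]) (simp add: L.weight_proj_simps scale_mult_left left_diff_distrib)
    qed
  next
    case (2 p q)
    then obtain s t where st: "0 \<notin> set s" "L.weight_proj s * p - scale (\<epsilon> p) 1 \<in> L"
      "0 \<notin> set t" "L.weight_proj t * q - scale (\<epsilon> q) 1 \<in> L" by blast
    let ?s = "L.weight_proj s" and ?t = "L.weight_proj t"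
    \<comment> \<open>Each product is applied to the relation of the other summand; the products
      commute and fix \<open>1\<close> modulo \<open>L\<close>, so concatenating the lists serves
      both summands.\<close>
    have "?t * (?s * p - scale (\<epsilon> p) 1) + scale (\<epsilon> p) (?t - 1)
        + (?s * (?t * q - scale (\<epsilon> q) 1) + scale (\<epsilon> q) (?s - 1)) \<in> L"
      by (intro L.L_add L.L_left L.L_scale st L.weight_proj_one)
    also have "?t * (?s * p - scale (\<epsilon> p) 1) + scale (\<epsilon> p) (?t - 1)
        + (?s * (?t * q - scale (\<epsilon> q) 1) + scale (\<epsilon> q) (?s - 1)) =
        L.weight_proj (s @ t) * (p + q) - scale (\<epsilon> (p + q)) 1"
      using L.weight_proj_commute[of s t]
      by (simp add: L.weight_proj_simps eps_add algebra_simps scale_add_left scale_diff_right scale_mult_right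
          flip: mult.assoc)
    finally show ?case using st by (intro exI[of _ "s @ t"]) simp
  next
    case (3 p a)
    then obtain s where s: "0 \<notin> set s" "L.weight_proj s * p - scale (\<epsilon> p) 1 \<in> L" by blast
    then show ?case using L.L_scale[OF s(2), of a]
      by (intro exI[of _ s]) (simp add: eps_scale scale_mult_right scale_diff_right)
  next
    case (4 p)
    then show ?case by (intro exI[of _ "[]"]) (simp add: L.weight_proj_simps assms(2))
  qed
  then obtain s where s: "L.weight_proj s * q - scale (\<epsilon> q) 1 \<in> L" by blast
  have "L.weight_proj s * q - (L.weight_proj s * q - scale (\<epsilon> q) 1) \<in> K"
    by (intro K.L_diff K.L_left assms(5) subsetD[OF assms(4) s])
  then have "scale (1 / \<epsilon> q) (scale (\<epsilon> q) 1) \<in> K" by (intro K.L_scale[of "scale (\<epsilon> q) 1"]) simp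
  then show ?thesis using assms(6) by simp
qed

text \<open>If \<open>\<epsilon> p\<close> were 0, all vectors generated from \<open>p\<close> by
  negative words would have vacuum component 0, and \<open>p\<close> would lie in
  \<open>Ann\<close>. So \<open>\<epsilon> p\<close> is nonzero, and evaluating
  \<open>\<epsilon>\<close> on \<open>dg 0 * p\<close> from either side compares the
  weights.\<close>

lemma singular_weight:
  assumes "\<And>n. 0 < n \<Longrightarrow> dg n * p \<in> Ann" "dg 0 * p - scale \<mu> p \<in> Ann" "p \<notin> Ann"
  shows "\<mu> = h"
proof -
  \<comment> \<open>The annihilator of the class of \<open>p\<close> is again of highest weight
    type, now with weight \<mu>; hence negative words applied to \<open>p\<close> exhaust the
    submodule it generates.\<close>
  interpret S: vir_hw_left_ideal "{s. s * p \<in> Ann}" c \<mu>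
    by standard
      (use assms Ann.cg_mult in \<open>auto simp: distrib_right left_diff_distrib scale_mult_left mult.assoc
        intro: Ann.L_add Ann.L_left Ann.L_ideal uea_ideal_Vir_closed\<close>)
  have "\<epsilon> (s * p) = 0" if "\<epsilon> p = 0" for s
  proof (induction rule: S.neg_span.induct[OF S.neg_span_all[of s]])
    case (1 i q)
    then show ?case using that by (simp add: eps_neg_word)
  next
    case (4 q)
    then show ?case by (simp add: Ann_eps)
  qed (simp_all add: distrib_right eps_add eps_scale scale_mult_left)
  then have "\<epsilon> p \<noteq> 0" using assms(3) by (auto simp: Ann_def)
  moreover have "h * \<epsilon> p - \<mu> * \<epsilon> p = 0"
    using Ann_eps[OF assms(2)] by (simp add: eps_diff eps_nonpos eps_scale)
  ultimately show ?thesis by simp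
qed

lemma central_charge:
  assumes "cg * p - scale c' p \<in> Ann" "p \<notin> Ann"
  shows "c' = c"
proof (rule ccontr)
  assume neq: "c' \<noteq> c"
  have "scale (c' - c) p \<in> Ann"
    using Ann.L_diff[OF Ann.cg_mult[of p] assms(1)] by (simp add: scale_diff_left)
  from Ann.L_scale[OF this, of "1 / (c' - c)"] neq assms(2) show False by simp
qed

end

section \<open>The vacuum functional of the Fock model\<close>

context fixes \<alpha> \<beta> :: complex
begin

definition fock_word_act :: "vir falg \<Rightarrow> fock \<Rightarrow> fock" where
  "fock_word_act p v = lin_ext (\<lambda>w. foldr (fock_act \<alpha> \<beta>) (letters w) v) p"

lemma fock_foldr_linear:
  "foldr (fock_act \<alpha> \<beta>) xs (v + w) = foldr (fock_act \<alpha> \<beta>) xs v + foldr (fock_act \<alpha> \<beta>) xs w"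
  "foldr (fock_act \<alpha> \<beta>) xs (scale a v) = scale a (foldr (fock_act \<alpha> \<beta>) xs v)"
  by (induction xs) (simp_all add: fock_act_simps)

lemma fock_word_act_simps:
  "fock_word_act (p + q) v = fock_word_act p v + fock_word_act q v"
  "fock_word_act (p - q) v = fock_word_act p v - fock_word_act q v"
  "fock_word_act (scale a p) v = scale a (fock_word_act p v)"
  "fock_word_act p (v + w) = fock_word_act p v + fock_word_act p w"
  "fock_word_act p (scale a v) = scale a (fock_word_act p v)"
  "fock_word_act (gen x) v = fock_act \<alpha> \<beta> x v"
  "fock_word_act 0 v = 0" "fock_word_act 1 v = v"
  by (simp_all add: fock_word_act_def lin_ext_add lin_ext_diff lin_ext_scale fock_foldr_linear
      lin_ext_add_fun lin_ext_scale_fun lin_ext_one zero_fword_def)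

lemma fock_word_act_zero: "fock_word_act p 0 = 0"
  using fock_word_act_simps(5)[of p 0 0] by simp

lemma fock_word_act_mult: "fock_word_act (p * q) v = fock_word_act p (fock_word_act q v)"
proof (induction p rule: free_space_induct)
  case (basis k)
  show ?case
  proof (induction q rule: free_space_induct)
    case (basis l)
    show ?case by (simp add: mult_single fock_word_act_def plus_fword_def)
  qed (simp_all add: distrib_left scale_mult_right fock_word_act_simps fock_word_act_zero)
qed (simp_all add: distrib_right scale_mult_left fock_word_act_simps)

lemma fock_word_act_ideal:
  assumes "p \<in> uea_ideal Vir"
  shows "fock_word_act p v = 0"
proof -
  let ?H = "{p. \<forall>v. fock_word_act p v = 0}"
  have "ideal ?H (free_algebra (carrier Vir))"
    by (rule idealI_free_algebra)
      (simp_all add: fock_word_act_simps fock_word_act_mult fock_word_act_zero carrier_free_algebra_Vir)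
  moreover have "uea_relations Vir \<subseteq> ?H"
    unfolding uea_relations_def Vir_ops
    by (auto simp: fock_word_act_simps fock_word_act_mult fock_act_simps fock_act_bracket simp del: scale_single)
  ultimately show ?thesis using uea_ideal_least assms by blast
qed

lemma fock_act_nonneg_vac:
  assumes "x \<in> carrier Vir_nonneg"
  shows "fock_act \<alpha> \<beta> x 1 =
    scale (Poly_Mapping.lookup x (Vd 0) * fock_weight \<alpha> \<beta> + Poly_Mapping.lookup x VC * fock_charge \<beta>) 1"
proof -
  let ?f = "\<lambda>b. scale (Poly_Mapping.lookup x b) (case b of Vd m \<Rightarrow> fock_op \<alpha> \<beta> m 1 | VC \<Rightarrow> scale (fock_charge \<beta>) 1)"
  have "fock_act \<alpha> \<beta> x 1 = (\<Sum>b\<in>Poly_Mapping.keys x \<union> {Vd 0, VC}. ?f b)"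
    unfolding fock_act_def by (rule lin_ext_superset) auto
  also have "\<dots> = (\<Sum>b\<in>{Vd 0, VC}. ?f b)"
  proof (rule sum.mono_neutral_right)
    show "\<forall>b\<in>Poly_Mapping.keys x \<union> {Vd 0, VC} - {Vd 0, VC}. ?f b = 0"
    proof
      fix b assume b: "b \<in> Poly_Mapping.keys x \<union> {Vd 0, VC} - {Vd 0, VC}"
      then obtain m where m: "b = Vd m" "m \<noteq> 0" by (cases b) auto
      then have "\<not> m < 0" using assms b by (auto simp: Vir_nonneg_def in_keys_iff)
      with m have "m > 0" by simp
      then show "?f b = 0" by (simp add: m fock_op_vac)
    qed
  qed auto
  finally show ?thesis by (simp add: fock_op_vac scale_add_left)
qed

lemma vir_hw_functional_fock:
  "vir_hw_functional (fock_charge \<beta>) (fock_weight \<alpha> \<beta>) (\<lambda>p. Poly_Mapping.lookup (fock_word_act p 1) {#})"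
proof
  fix n :: int and p assume "n \<le> 0"
  then show "Poly_Mapping.lookup (fock_word_act (dg n * p) 1) {#} =
      (if n = 0 then fock_weight \<alpha> \<beta> else 0) * Poly_Mapping.lookup (fock_word_act p 1) {#}"
    by (simp add: fock_word_act_simps fock_word_act_mult fock_act_basis const_coeff_fock_op_nonpos)
qed (simp_all add: fock_word_act_simps fock_word_act_mult fock_word_act_ideal fock_act_nonneg_vac lookup_add lookup_one)

end

lemma vir_hw_functional_exists: "\<exists>\<epsilon>. vir_hw_functional c h \<epsilon>"
  using fock_parameters_exist[of h c] vir_hw_functional_fock by metis

section \<open>Verma modules and their simple quotients\<close>

definition lin_form :: "('k \<Rightarrow> complex) \<Rightarrow> ('k \<Rightarrow>\<^sub>0 complex) \<Rightarrow> complex" where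
  "lin_form f p = (\<Sum>k\<in>Poly_Mapping.keys p. Poly_Mapping.lookup p k * f k)"

lemma lin_form_simps:
  "lin_form f (p + q) = lin_form f p + lin_form f q"
  "lin_form f (p - q) = lin_form f p - lin_form f q"
  "lin_form f (scale a p) = a * lin_form f p"
  "lin_form f (Poly_Mapping.single k a) = a * f k"
  "lin_form f 0 = 0"
proof -
  have *: "lin_form f p = Poly_Mapping.lookup (lin_ext (\<lambda>k. Poly_Mapping.single () (f k)) p) ()" for p
    by (simp add: lin_form_def lookup_lin_ext)
  show "lin_form f (p + q) = lin_form f p + lin_form f q"
    "lin_form f (p - q) = lin_form f p - lin_form f q"
    "lin_form f (scale a p) = a * lin_form f p"
    "lin_form f (Poly_Mapping.single k a) = a * f k"
    "lin_form f 0 = 0"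
    by (simp_all add: * lin_ext_add lin_ext_diff lin_ext_scale lookup_add lookup_minus)
qed

lemma free_space_induct_keys [consumes 1, case_names zero basis add scale]:
  assumes "Poly_Mapping.keys p \<subseteq> K" "P 0" "\<And>k. k \<in> K \<Longrightarrow> P (basis_vec k)" "\<And>p q. P p \<Longrightarrow> P q \<Longrightarrow> P (p + q)"
    "\<And>a p. P p \<Longrightarrow> P (scale a p)"
  shows "P p"
proof -
  have "P (\<Sum>k\<in>S. scale (Poly_Mapping.lookup p k) (basis_vec k))" if "finite S" "S \<subseteq> K" for S
    using that by induction (auto simp del: scale_single intro!: assms)
  from this[OF finite_keys assms(1)] show ?thesis by (simp only: free_space_expansion[symmetric])
qed

section \<open>Computing with classes in the enveloping algebras of \<open>Vir\<close> and
  \<open>Vir_nonneg\<close>\<close>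

lemma uea_class_eq_iff: "uea_class Vir p = uea_class Vir q \<longleftrightarrow> p - q \<in> uea_ideal Vir"
  unfolding uea_class_def
  using ring.quotient_eq_iff_same_a_r_cos[OF ring_free_algebra ideal_uea_ideal[OF lie_algebra_Vir], of p q]
  by (simp add: carrier_free_algebra_Vir free_algebra_minus)

lemma uea_class_mem: "q \<in> uea_class Vir p \<longleftrightarrow> q - p \<in> uea_ideal Vir"
  by (auto simp: uea_class_def a_r_coset_def' free_algebra_simps(5)) (metis diff_add_cancel)

lemma carrier_uea_Vir: "carrier (uea Vir) = range (uea_class Vir)"
  by (auto simp: uea_simps A_RCOSETS_def' carrier_free_algebra_Vir uea_class_def)

lemma uea_class_mult: "uea_class Vir p \<otimes>\<^bsub>uea Vir\<^esub> uea_class Vir q = uea_class Vir (p * q)"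
  using ideal.rcoset_mult_add[OF ideal_uea_ideal[OF lie_algebra_Vir], of p q]
  by (simp add: uea_simps uea_class_def carrier_free_algebra_Vir free_algebra_simps(2))

lemma uea_class_add: "uea_class Vir p \<oplus>\<^bsub>uea Vir\<^esub> uea_class Vir q = uea_class Vir (p + q)"
proof -
  interpret ideal "uea_ideal Vir" "free_algebra (carrier Vir)" by (rule ideal_uea_ideal[OF lie_algebra_Vir])
  show ?thesis
    using a_rcos_sum[of p q]
    by (simp add: uea_simps uea_class_def carrier_free_algebra_Vir free_algebra_simps(5))
qed

lemma uea_class_smult: "a \<odot>\<^bsub>uea Vir\<^esub> uea_class Vir p = uea_class Vir (scale a p)"
proof -
  have "uea_class Vir (scale a q) = uea_class Vir (scale a p)" if "q \<in> uea_class Vir p" for q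
    using that uea_ideal_Vir_closed(5)[of "q - p" a] by (simp add: uea_class_eq_iff uea_class_mem scale_diff_right)
  moreover have "p \<in> uea_class Vir p" by (simp add: uea_class_mem uea_ideal_Vir_closed)
  ultimately have "(\<Union>q\<in>uea_class Vir p. uea_class Vir (scale a q)) = uea_class Vir (scale a p)" by blast
  then show ?thesis by (simp only: uea_simps)
qed

text \<open>Makes the map \<open>uea_incl\<close> from the smaller enveloping algebra to the larger
  one well defined on classes.\<close>

lemma uea_ideal_Vir_nonneg_subset: "uea_ideal Vir_nonneg \<subseteq> uea_ideal Vir \<inter> carrier (free_algebra (carrier Vir_nonneg))"
proof (rule uea_ideal_least)
  show "ideal (uea_ideal Vir \<inter> carrier (free_algebra (carrier Vir_nonneg))) (free_algebra (carrier Vir_nonneg))"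
    by (rule idealI_free_algebra) (auto intro: uea_ideal_Vir_closed free_algebra_carrier_intros)
  have "uea_relations Vir_nonneg \<subseteq> uea_relations Vir"
    by (auto simp: uea_relations_def Vir_nonneg_def carrier_Vir simp del: scale_single)
  then show "uea_relations Vir_nonneg \<subseteq> uea_ideal Vir \<inter> carrier (free_algebra (carrier Vir_nonneg))"
    using uea_relations_subset_ideal[OF lie_algebra_Vir] uea_relations_carrier[OF lie_algebra_Vir_nonneg] by blast
qed

lemma uea_class_Vir_nonneg_mem:
  assumes "q \<in> carrier (free_algebra (carrier Vir_nonneg))" "p \<in> uea_class Vir_nonneg q"
  shows "p \<in> carrier (free_algebra (carrier Vir_nonneg))" "p - q \<in> uea_ideal Vir"
proof -
  obtain i where "i \<in> uea_ideal Vir_nonneg" "p = i + q"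
    using assms(2) by (auto simp: uea_class_def a_r_coset_def' free_algebra_simps(5))
  then show "p \<in> carrier (free_algebra (carrier Vir_nonneg))" "p - q \<in> uea_ideal Vir"
    using uea_ideal_Vir_nonneg_subset assms(1) by (auto intro: free_algebra_carrier_intros)
qed

lemma uea_class_Vir_nonneg_self:
  assumes "q \<in> carrier (free_algebra (carrier Vir_nonneg))"
  shows "q \<in> uea_class Vir_nonneg q"
proof -
  interpret ideal "uea_ideal Vir_nonneg" "free_algebra (carrier Vir_nonneg)"
    by (rule ideal_uea_ideal[OF lie_algebra_Vir_nonneg])
  show ?thesis using a_rcos_self[OF assms] by (simp add: uea_class_def)
qed

lemma carrier_uea_Vir_nonneg:
  "carrier (uea Vir_nonneg) = uea_class Vir_nonneg ` carrier (free_algebra (carrier Vir_nonneg))"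
  by (auto simp: uea_simps A_RCOSETS_def' uea_class_def)

lemma uea_incl_class:
  assumes "q \<in> carrier (free_algebra (carrier Vir_nonneg))"
  shows "uea_incl Vir (uea_class Vir_nonneg q) = uea_class Vir q"
proof -
  have "uea_class Vir p = uea_class Vir q" if "p \<in> uea_class Vir_nonneg q" for p
    using uea_class_Vir_nonneg_mem[OF assms that] by (simp add: uea_class_eq_iff)
  then show ?thesis
    using uea_class_Vir_nonneg_self[OF assms] unfolding uea_incl_def by blast
qed

context vir_hw_functional begin

lemma nonneg_char_eq:
  "r \<in> carrier (free_algebra (carrier Vir_nonneg)) \<Longrightarrow> nonneg_char c h r = \<epsilon> r"
  using eps_nonneg[of r 1] by (simp add: eps_one)

lemma uea_act_line:
  assumes q: "q \<in> carrier (free_algebra (carrier Vir_nonneg))"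
  shows "uea_act (highest_weight_line c h) (uea_class Vir_nonneg q) n = \<epsilon> q * n"
proof -
  have "free_algebra_act (highest_weight_line c h) p n = \<epsilon> q * n" if "p \<in> uea_class Vir_nonneg q" for p
    using uea_class_Vir_nonneg_mem[OF q that] eps_ideal[of "p - q"]
    by (simp add: free_algebra_act_highest_weight_line nonneg_char_eq eps_diff)
  then have "(\<lambda>p. free_algebra_act (highest_weight_line c h) p n) ` uea_class Vir_nonneg q = {\<epsilon> q * n}"
    using uea_class_Vir_nonneg_self[OF q] by auto
  then show ?thesis by (simp add: uea_act_def)
qed

text \<open>The relations of the induced module in terms of representatives, with the action of
  \<open>q\<close> on the line already evaluated to \<open>\<epsilon> q\<close>. Later checks become
  case distinctions over these five shapes.\<close>

inductive_set verma_relations :: "((vir fword \<Rightarrow>\<^sub>0 complex) set \<times> complex \<Rightarrow>\<^sub>0 complex) set" where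
  "basis_vec (uea_class Vir (p + p'), n) - basis_vec (uea_class Vir p, n) - basis_vec (uea_class Vir p', n)
    \<in> verma_relations"
| "basis_vec (uea_class Vir p, n + n') - basis_vec (uea_class Vir p, n) - basis_vec (uea_class Vir p, n')
    \<in> verma_relations"
| "basis_vec (uea_class Vir (scale a p), n) - scale a (basis_vec (uea_class Vir p, n)) \<in> verma_relations"
| "basis_vec (uea_class Vir p, a * n) - scale a (basis_vec (uea_class Vir p, n)) \<in> verma_relations"
| "q \<in> carrier (free_algebra (carrier Vir_nonneg)) \<Longrightarrow>
    basis_vec (uea_class Vir (p * q), n) - basis_vec (uea_class Vir p, \<epsilon> q * n) \<in> verma_relations"

lemma line_simps:
  "carrier (highest_weight_line c h) = UNIV" "add (highest_weight_line c h) = (+)"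
  "module.smult (highest_weight_line c h) = (*)"
  by (simp_all add: highest_weight_line_def)

lemma verma_relations_eq:
  "bilinear_relations (uea Vir) (highest_weight_line c h) \<union> balanced_relations Vir Vir_nonneg (highest_weight_line c h)
    = verma_relations" (is "?A = _")
proof
  show "?A \<subseteq> verma_relations"
    unfolding bilinear_relations_def balanced_relations_def carrier_uea_Vir carrier_uea_Vir_nonneg
    by (auto simp: uea_class_mult uea_class_add uea_class_smult uea_incl_class uea_act_line line_simps
        simp del: scale_single intro: verma_relations.intros)
  show "verma_relations \<subseteq> ?A"
  proof
    fix r assume "r \<in> verma_relations"
    then show "r \<in> ?A"
    proof cases
      case (1 p p' n)
      have "r \<in> bilinear_relations (uea Vir) (highest_weight_line c h)"
        unfolding 1 bilinear_relations_def carrier_uea_Vir line_simps uea_class_add[symmetric] by blast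
      then show ?thesis by blast
    next
      case (2 p n n')
      have "r \<in> bilinear_relations (uea Vir) (highest_weight_line c h)"
        unfolding 2 bilinear_relations_def carrier_uea_Vir line_simps by blast
      then show ?thesis by blast
    next
      case (3 a p n)
      have "r \<in> bilinear_relations (uea Vir) (highest_weight_line c h)"
        unfolding 3 bilinear_relations_def carrier_uea_Vir line_simps uea_class_smult[symmetric] by blast
      then show ?thesis by blast
    next
      case (4 p a n)
      have "r \<in> bilinear_relations (uea Vir) (highest_weight_line c h)"
        unfolding 4 bilinear_relations_def carrier_uea_Vir line_simps by blast
      then show ?thesis by blast
    next
      case (5 q p n)
      have "r \<in> balanced_relations Vir Vir_nonneg (highest_weight_line c h)"
        unfolding 5 balanced_relations_def carrier_uea_Vir carrier_uea_Vir_nonneg line_simps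
          uea_class_mult[symmetric] uea_incl_class[OF 5(2), symmetric] uea_act_line[OF 5(2), symmetric]
        using 5(2) by blast
      then show ?thesis by blast
    qed
  qed
qed

definition verma_free where
  "verma_free = free_rep (carrier (uea Vir) \<times> carrier (highest_weight_line c h))
    (\<lambda>x (u, n). basis_vec (uea_class Vir (gen x) \<otimes>\<^bsub>uea Vir\<^esub> u, n))"

definition verma_null where "verma_null = lin_span verma_free verma_relations"

lemma Verma_eq: "Verma c h = lie_quotient verma_free verma_null"
  by (simp add: Verma_def induced_module_def verma_free_def verma_null_def Let_def verma_relations_eq)

lemma carrier_verma_free: "carrier verma_free = {p. Poly_Mapping.keys p \<subseteq> range (uea_class Vir) \<times> UNIV}"
  by (simp add: verma_free_def free_rep_simps line_simps carrier_uea_Vir)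

lemma verma_free_simps:
  "zero verma_free = 0" "add verma_free = (+)" "module.smult verma_free = scale"
  "act verma_free x (Poly_Mapping.single (uea_class Vir p, n) a) = Poly_Mapping.single (uea_class Vir (gen x * p), n) a"
  by (simp_all add: verma_free_def free_rep_simps uea_class_mult)

lemma basis_verma_free: "basis_vec (uea_class Vir p, n) \<in> carrier verma_free"
  by (simp add: carrier_verma_free)

lemma verma_relations_carrier: "verma_relations \<subseteq> carrier verma_free"
proof
  have D: "submodule (carrier verma_free) complex_field verma_free"
    unfolding verma_free_def by (rule Module.module.carrier_is_submodule[OF module_free_rep])
  fix r assume "r \<in> verma_relations"
  then show "r \<in> carrier verma_free"
    by cases (auto intro!: submodule_free_repD(4,5)[OF D[unfolded verma_free_def], folded verma_free_def] basis_verma_free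
        simp del: scale_single)
qed

lemma verma_null_submodule: "submodule verma_null complex_field verma_free"
  unfolding verma_null_def verma_free_def
  by (rule submodule_lin_span_free_rep) (use verma_relations_carrier in \<open>simp add: verma_free_def\<close>)

lemmas verma_nullD = submodule_free_repD[OF verma_null_submodule[unfolded verma_free_def], folded verma_free_def]

lemma verma_null_relation: "r \<in> verma_relations \<Longrightarrow> r \<in> verma_null"
  unfolding verma_null_def by (rule subsetD[OF lin_span_superset])

lemma verma_quotient: "rep_quotient verma_free verma_null"
  unfolding verma_free_def
proof (rule rep_quotient_free_rep)
  show "submodule verma_null complex_field (free_rep (carrier (uea Vir) \<times> carrier (highest_weight_line c h))
     (\<lambda>x (u, n). basis_vec (uea_class Vir (gen x) \<otimes>\<^bsub>uea Vir\<^esub> u, n)))"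
    using verma_null_submodule by (simp add: verma_free_def)
  show "Poly_Mapping.keys (case k of (u, n) \<Rightarrow> basis_vec (uea_class Vir (gen x) \<otimes>\<^bsub>uea Vir\<^esub> u, n))
      \<subseteq> carrier (uea Vir) \<times> carrier (highest_weight_line c h)"
    if "k \<in> carrier (uea Vir) \<times> carrier (highest_weight_line c h)" for x k
    using that by (auto simp: carrier_uea_Vir uea_class_mult line_simps)
  fix x p
  let ?f = "\<lambda>(u, n). basis_vec (uea_class Vir (gen x) \<otimes>\<^bsub>uea Vir\<^esub> u, n)"
  have "lin_ext ?f r \<in> lin_span verma_free verma_relations" if "r \<in> verma_relations" for r
  proof -
    have f: "lin_ext ?f (basis_vec (uea_class Vir p, n)) = basis_vec (uea_class Vir (gen x * p), n)" for p n
      by (simp add: uea_class_mult)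
    from that have "lin_ext ?f r \<in> verma_relations"
    proof cases
      case 1
      show ?thesis unfolding 1 lin_ext_diff f distrib_left by (rule verma_relations.intros)
    next
      case 2
      show ?thesis unfolding 2 lin_ext_diff f by (rule verma_relations.intros)
    next
      case 3
      show ?thesis unfolding 3 lin_ext_diff lin_ext_scale f scale_mult_right by (rule verma_relations.intros)
    next
      case 4
      show ?thesis unfolding 4 lin_ext_diff lin_ext_scale f by (rule verma_relations.intros)
    next
      case 5
      show ?thesis unfolding 5 lin_ext_diff f mult.assoc[symmetric] by (rule verma_relations.intros) fact
    qed
    then show ?thesis using verma_null_relation by (simp add: verma_null_def)
  qed
  then show "lin_ext ?f p \<in> verma_null" if "p \<in> verma_null"
    using lin_span_closed_lin_ext[OF verma_relations_carrier[unfolded verma_free_def], folded verma_free_def] that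
    by (simp add: verma_null_def)
qed

end

text \<open>A linear surjection from a free space under which \<open>D\<close> induces the action.
  It hides the nested cosets: the Verma module, its simple quotient and the series are all handled
  through representatives.\<close>

definition rep_presentation ::
  "(('k \<Rightarrow>\<^sub>0 complex) \<Rightarrow> 'v) \<Rightarrow> ('l, 'v, 'n) lie_rep_scheme \<Rightarrow> ('l \<Rightarrow> ('k \<Rightarrow>\<^sub>0 complex) \<Rightarrow> ('k \<Rightarrow>\<^sub>0 complex)) \<Rightarrow> bool"
  where "rep_presentation \<pi> M D \<longleftrightarrow> carrier M = range \<pi> \<and> (\<forall>p q. \<pi> (p + q) = \<pi> p \<oplus>\<^bsub>M\<^esub> \<pi> q) \<and>
    (\<forall>a p. \<pi> (scale a p) = a \<odot>\<^bsub>M\<^esub> \<pi> p) \<and> (\<forall>x p. act M x (\<pi> p) = \<pi> (D x p))"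

lemma rep_presentationD:
  assumes "rep_presentation \<pi> M D"
  shows "carrier M = range \<pi>" "\<pi> p \<oplus>\<^bsub>M\<^esub> \<pi> q = \<pi> (p + q)" "a \<odot>\<^bsub>M\<^esub> \<pi> p = \<pi> (scale a p)" "act M x (\<pi> p) = \<pi> (D x p)"
  using assms by (simp_all add: rep_presentation_def)

lemma rep_presentation_group:
  assumes "rep_presentation \<pi> M D" "Module.module complex_field M"
  shows "\<pi> 0 = \<zero>\<^bsub>M\<^esub>" "\<ominus>\<^bsub>M\<^esub> \<pi> p = \<pi> (- p)" "\<pi> p \<ominus>\<^bsub>M\<^esub> \<pi> q = \<pi> (p - q)"
proof -
  interpret Module.module complex_field M by fact
  note P = rep_presentationD[OF assms(1)]
  have carr: "\<pi> p \<in> carrier M" for p using P(1) by simp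
  have "\<pi> 0 \<oplus>\<^bsub>M\<^esub> \<pi> 0 = \<pi> 0" by (simp add: P(2))
  then show 0: "\<pi> 0 = \<zero>\<^bsub>M\<^esub>" using M.add.r_cancel_one[OF carr carr] by blast
  show m: "\<ominus>\<^bsub>M\<^esub> \<pi> p = \<pi> (- p)" for p
    by (rule M.minus_equality) (simp_all add: P(2) 0 carr)
  show "\<pi> p \<ominus>\<^bsub>M\<^esub> \<pi> q = \<pi> (p - q)" by (simp add: a_minus_def m P(2))
qed

lemma rep_presentation_submoduleI:
  assumes "rep_presentation \<pi> M D" "Module.module complex_field M"
    and "0 \<in> S" "\<And>p q. p \<in> S \<Longrightarrow> q \<in> S \<Longrightarrow> p + q \<in> S" "\<And>a p. p \<in> S \<Longrightarrow> scale a p \<in> S"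
  shows "submodule (\<pi> ` S) complex_field M"
proof (rule Module.module.submoduleI[OF assms(2)])
  note P = rep_presentationD[OF assms(1)] and G = rep_presentation_group[OF assms(1,2)]
  show "\<zero>\<^bsub>M\<^esub> \<in> \<pi> ` S" using assms(3) G(1) by (metis imageI)
  have "- p \<in> S" if "p \<in> S" for p
  proof -
    have "- p = scale (- 1) p" by (rule poly_mapping_eqI) simp
    then show ?thesis using assms(5)[OF that] by simp
  qed
  then show "\<ominus>\<^bsub>M\<^esub> v \<in> \<pi> ` S" if "v \<in> \<pi> ` S" for v using that by (auto simp: G)
qed (use assms(4,5) in \<open>auto simp: rep_presentationD[OF assms(1)]\<close>)

lemma rep_presentation_quotient:
  assumes P: "rep_presentation \<pi> M D" and M: "Module.module complex_field M"
    and D: "\<And>x p q. D x (p + q) = D x p + D x q"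
    and N: "submodule N complex_field M" "\<And>x v. v \<in> N \<Longrightarrow> act M x v \<in> N"
  shows "rep_presentation (\<lambda>p. N +>\<^bsub>M\<^esub> \<pi> p) (lie_quotient M N) D"
    "Module.module complex_field (lie_quotient M N)"
    "N +>\<^bsub>M\<^esub> \<pi> p = N +>\<^bsub>M\<^esub> \<pi> q \<longleftrightarrow> \<pi> (p - q) \<in> N"
proof -
  note PD = rep_presentationD[OF P]
  interpret rep_quotient M N
    by (intro rep_quotient.intro rep_quotient_axioms.intro M N) (auto simp: PD D)
  have carr: "\<pi> p \<in> carrier M" for p using PD(1) by simp
  show "rep_presentation (\<lambda>p. N +>\<^bsub>M\<^esub> \<pi> p) (lie_quotient M N) D"
    by (auto simp: rep_presentation_def quotient_carrier quotient_add quotient_smult quotient_act PD carr)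
  show "Module.module complex_field (lie_quotient M N)" by (rule quotient_module)
  show "N +>\<^bsub>M\<^esub> \<pi> p = N +>\<^bsub>M\<^esub> \<pi> q \<longleftrightarrow> \<pi> (p - q) \<in> N"
    by (simp add: coset_eq_iff carr rep_presentation_group[OF P M])
qed

context vir_hw_functional begin

definition verma_vec where
  "verma_vec p = verma_null +>\<^bsub>verma_free\<^esub> basis_vec (uea_class Vir p, 1)"

lemma verma_free_coset_eq:
  assumes "v \<in> carrier verma_free" "w \<in> carrier verma_free"
  shows "verma_null +>\<^bsub>verma_free\<^esub> v = verma_null +>\<^bsub>verma_free\<^esub> w \<longleftrightarrow> v - w \<in> verma_null"
proof -
  interpret rep_quotient verma_free verma_null by (rule verma_quotient)
  have "v \<ominus>\<^bsub>verma_free\<^esub> w = v - w"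
    unfolding verma_free_def using assms(2)
    by (intro free_rep_minus) (simp add: verma_free_def free_rep_simps)
  then show ?thesis using coset_eq_iff[OF assms] by simp
qed

text \<open>The right factor is a line, so u \<otimes> n can be rewritten as (n u) \<otimes>
  1.\<close>

lemma verma_null_reduce:
  assumes "v \<in> carrier verma_free"
  shows "\<exists>p. v - basis_vec (uea_class Vir p, 1) \<in> verma_null"
proof -
  have "Poly_Mapping.keys v \<subseteq> range (uea_class Vir) \<times> UNIV" using assms by (simp add: carrier_verma_free)
  then show ?thesis
  proof (induction v rule: free_space_induct_keys)
    case zero
    have "0 - (basis_vec (uea_class Vir (scale 0 0), 1) - scale 0 (basis_vec (uea_class Vir 0, 1))) \<in> verma_null"
      by (intro verma_nullD(2,5) verma_null_relation verma_relations.intros)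
    then show ?case by (intro exI[of _ 0]) simp
  next
    case (basis k)
    then obtain p n where k: "k = (uea_class Vir p, n)" by auto
    have "(basis_vec (uea_class Vir p, n * 1) - scale n (basis_vec (uea_class Vir p, 1)))
      - (basis_vec (uea_class Vir (scale n p), 1) - scale n (basis_vec (uea_class Vir p, 1))) \<in> verma_null"
      by (intro verma_nullD(5) verma_null_relation verma_relations.intros)
    then show ?case by (intro exI[of _ "scale n p"]) (simp add: k)
  next
    case (add v w)
    then obtain p q where pq: "v - basis_vec (uea_class Vir p, 1) \<in> verma_null"
      "w - basis_vec (uea_class Vir q, 1) \<in> verma_null" by blast
    have "(v - basis_vec (uea_class Vir p, 1)) + (w - basis_vec (uea_class Vir q, 1))
      - (basis_vec (uea_class Vir (p + q), 1) - basis_vec (uea_class Vir p, 1) - basis_vec (uea_class Vir q, 1)) \<in> verma_null"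
      by (intro verma_nullD(3,5) verma_null_relation verma_relations.intros pq)
    then show ?case by (intro exI[of _ "p + q"]) (simp add: algebra_simps)
  next
    case (scale a v)
    then obtain p where p: "v - basis_vec (uea_class Vir p, 1) \<in> verma_null" by blast
    have "scale a (v - basis_vec (uea_class Vir p, 1))
      - (basis_vec (uea_class Vir (scale a p), 1) - scale a (basis_vec (uea_class Vir p, 1))) \<in> verma_null"
      by (intro verma_nullD(4,5) verma_null_relation verma_relations.intros p)
    then show ?case by (intro exI[of _ "scale a p"]) (simp add: scale_diff_right del: scale_single)
  qed
qed

lemma verma_module: "Module.module complex_field (Verma c h)"
  unfolding Verma_eq by (rule rep_quotient.quotient_module[OF verma_quotient])

lemma verma_presentation: "rep_presentation verma_vec (Verma c h) (\<lambda>x p. gen x * p)"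
proof -
  interpret rep_quotient verma_free verma_null by (rule verma_quotient)
  have range: "carrier (Verma c h) = range verma_vec"
  proof -
    have "verma_null +>\<^bsub>verma_free\<^esub> v \<in> range verma_vec" if v: "v \<in> carrier verma_free" for v
      using verma_null_reduce[OF v] verma_free_coset_eq[OF v basis_verma_free] by (auto simp: verma_vec_def)
    then show ?thesis
      unfolding Verma_eq quotient_carrier by (auto simp: verma_vec_def basis_verma_free)
  qed
  have sum: "basis_vec (uea_class Vir p, 1) + basis_vec (uea_class Vir q, 1) \<in> carrier verma_free" for p q
    using M.a_closed[OF basis_verma_free basis_verma_free] by (simp add: verma_free_simps)
  have sc: "scale a (basis_vec (uea_class Vir p, 1)) \<in> carrier verma_free" for a p
    using smult_carrier[OF basis_verma_free] by (simp add: verma_free_simps)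
  have add: "verma_vec (p + q) = verma_vec p \<oplus>\<^bsub>Verma c h\<^esub> verma_vec q" for p q
    using verma_null_relation[OF verma_relations.intros(1)[of p q 1]]
    by (simp add: Verma_eq verma_vec_def quotient_add basis_verma_free verma_free_simps(2)
        verma_free_coset_eq[OF basis_verma_free sum] diff_diff_eq)
  have smult: "verma_vec (scale a p) = a \<odot>\<^bsub>Verma c h\<^esub> verma_vec p" for a p
    using verma_null_relation[OF verma_relations.intros(3)[of a p 1]]
    by (simp add: Verma_eq verma_vec_def quotient_smult basis_verma_free verma_free_simps(3)
        verma_free_coset_eq[OF basis_verma_free sc] del: scale_single)
  show ?thesis
    unfolding rep_presentation_def using range add smult
    by (simp add: Verma_eq verma_vec_def quotient_act basis_verma_free verma_free_simps)
qed

lemmas vermaD = rep_presentationD[OF verma_presentation] rep_presentation_group[OF verma_presentation verma_module]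

lemma verma_vec_eq_iff: "verma_vec p = verma_vec q \<longleftrightarrow>
    basis_vec (uea_class Vir p, 1) - basis_vec (uea_class Vir q, 1) \<in> verma_null"
  by (simp add: verma_vec_def verma_free_coset_eq basis_verma_free)

lemma verma_vec_nonneg:
  assumes "q \<in> carrier (free_algebra (carrier Vir_nonneg))"
  shows "verma_vec (p * q) = verma_vec (scale (\<epsilon> q) p)"
proof -
  have "(basis_vec (uea_class Vir (p * q), 1) - basis_vec (uea_class Vir p, \<epsilon> q * 1))
    + ((basis_vec (uea_class Vir p, \<epsilon> q * 1) - scale (\<epsilon> q) (basis_vec (uea_class Vir p, 1)))
    - (basis_vec (uea_class Vir (scale (\<epsilon> q) p), 1) - scale (\<epsilon> q) (basis_vec (uea_class Vir p, 1)))) \<in> verma_null"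
    by (intro verma_nullD(3,5) verma_null_relation verma_relations.intros assms)
  then show ?thesis by (simp add: verma_vec_eq_iff)
qed

lemma verma_vec_ideal: "p - q \<in> uea_ideal Vir \<Longrightarrow> verma_vec p = verma_vec q"
  using uea_class_eq_iff[of p q] by (simp add: verma_vec_def)

lemma verma_free_submodule: "submodule (carrier verma_free) complex_field verma_free"
  unfolding verma_free_def by (rule Module.module.carrier_is_submodule[OF module_free_rep])

lemmas verma_freeD = submodule_free_repD[OF verma_free_submodule[unfolded verma_free_def], folded verma_free_def]

text \<open>The bound that keeps the Verma module from collapsing: for each s the functional sending
  u \<otimes> n to n times \<open>\<epsilon>\<close> of s u respects every relation.\<close>

lemma verma_null_Ann:
  assumes "verma_vec p = \<zero>\<^bsub>Verma c h\<^esub>"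
  shows "p \<in> Ann"
proof -
  have "\<epsilon> (s * p) = 0" for s
  proof -
    \<comment> \<open>Any representative serves: two of them differ by an element of the ideal, and
      \<open>\<epsilon>\<close> vanishes on its left multiples.\<close>
    let ?rep = "\<lambda>u. SOME p. u = uea_class Vir p"
    let ?f = "lin_form (\<lambda>(u, n). n * \<epsilon> (s * ?rep u))"
    have "\<epsilon> (s * ?rep (uea_class Vir q)) = \<epsilon> (s * q)" for q
    proof -
      have "uea_class Vir q = uea_class Vir (?rep (uea_class Vir q))" by (rule someI) simp
      then have "s * (q - ?rep (uea_class Vir q)) \<in> uea_ideal Vir"
        by (intro uea_ideal_Vir_closed) (simp add: uea_class_eq_iff)
      from eps_ideal[OF this] show ?thesis by (simp add: right_diff_distrib eps_diff)
    qed
    then have f: "?f (Poly_Mapping.single (uea_class Vir q, n) a) = a * n * \<epsilon> (s * q)" for q n a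
      by (simp add: lin_form_simps)
    have "submodule {v \<in> carrier verma_free. ?f v = 0} complex_field verma_free"
      unfolding verma_free_def
      by (rule submodule_free_repI, fold verma_free_def)
        (use verma_freeD(1) in \<open>auto simp: lin_form_simps intro: verma_freeD(2-4)\<close>)
    moreover have "verma_relations \<subseteq> {v \<in> carrier verma_free. ?f v = 0}"
    proof
      fix r assume r: "r \<in> verma_relations"
      then have "?f r = 0"
      proof cases
        case (5 q p n)
        then show ?thesis
          using nonneg_char_eq[OF 5(2)] eps_nonneg[OF 5(2), of "s * p"]
          by (simp only: lin_form_simps(2) f) (simp add: mult.assoc)
      qed (simp_all only: lin_form_simps(1-3) f, simp_all add: distrib_left eps_add scale_mult_right eps_scale algebra_simps)
      then show "r \<in> {v \<in> carrier verma_free. ?f v = 0}" using r verma_relations_carrier by blast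
    qed
    ultimately have "verma_null \<subseteq> {v \<in> carrier verma_free. ?f v = 0}"
      unfolding verma_null_def by (rule lin_span_least)
    moreover have "basis_vec (uea_class Vir p, 1) - basis_vec (uea_class Vir 0, 1) \<in> verma_null"
      using assms by (simp add: verma_vec_eq_iff flip: vermaD(5))
    ultimately have "?f (basis_vec (uea_class Vir p, 1) - basis_vec (uea_class Vir 0, 1)) = 0" by blast
    then show ?thesis by (simp only: lin_form_simps(2) f) (simp add: eps_zero)
  qed
  then show ?thesis by (simp add: Ann_def)
qed

lemma vir_left_ideal_vimage:
  assumes "lie_submodule Vir (Verma c h) K"
  shows "vir_left_ideal {p. verma_vec p \<in> K}"
proof
  have sub: "submodule K complex_field (Verma c h)" and act: "\<And>x v. v \<in> K \<Longrightarrow> act (Verma c h) x v \<in> K"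
    using assms by (auto simp: lie_submodule_def carrier_Vir)
  note E = Module.module.submoduleE[OF verma_module sub]
  have "\<zero>\<^bsub>Verma c h\<^esub> \<in> K"
    using subgroup.one_closed[OF submodule.axioms(1)[OF sub]] by simp
  then have zero: "verma_vec 0 \<in> K" by (simp add: vermaD)
  have add: "verma_vec p \<in> K \<Longrightarrow> verma_vec q \<in> K \<Longrightarrow> verma_vec (p + q) \<in> K" for p q
    using E(5) vermaD(2) by metis
  have scale: "verma_vec p \<in> K \<Longrightarrow> verma_vec (scale a p) \<in> K" for a p
    using E(4)[of a "verma_vec p"] by (simp add: vermaD carrier_complex_field)
  have word: "verma_vec p \<in> K \<Longrightarrow> verma_vec (basis_vec (FWord xs) * p) \<in> K" for xs p
  proof (induction xs)
    case Nil
    then show ?case by (simp flip: one_falg)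
  next
    case (Cons x xs)
    then show ?case using act[of "verma_vec (basis_vec (FWord xs) * p)" x]
      by (subst basis_fword_Cons) (simp only: mult.assoc vermaD(4))
  qed
  show "p \<in> {p. verma_vec p \<in> K} \<Longrightarrow> q \<in> {p. verma_vec p \<in> K} \<Longrightarrow> p + q \<in> {p. verma_vec p \<in> K}" for p q
    using add by simp
  show "q * p \<in> {p. verma_vec p \<in> K}" if "p \<in> {p. verma_vec p \<in> K}" for p q
    using that
  proof (induction q rule: free_space_induct)
    case (basis w)
    then show ?case using word[of p "letters w"] by simp
  qed (simp_all add: zero add scale distrib_right scale_mult_left)
  show "p \<in> {p. verma_vec p \<in> K}" if "p \<in> uea_ideal Vir" for p
    using verma_vec_ideal[of p 0] that zero by simp
qed

lemma zero_lie_submodule: "lie_submodule Vir (Verma c h) {\<zero>\<^bsub>Verma c h\<^esub>}"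
proof -
  have "submodule (verma_vec ` {0}) complex_field (Verma c h)"
    by (rule rep_presentation_submoduleI[OF verma_presentation verma_module]) auto
  moreover have "act (Verma c h) x (verma_vec 0) = verma_vec 0" for x
    by (simp add: vermaD(4))
  ultimately show ?thesis by (simp add: lie_submodule_def vermaD(5))
qed

lemma verma_kernel: "vir_hw_left_ideal {p. verma_vec p = \<zero>\<^bsub>Verma c h\<^esub>} c h"
proof -
  interpret vir_left_ideal "{p. verma_vec p = \<zero>\<^bsub>Verma c h\<^esub>}"
    using vir_left_ideal_vimage[OF zero_lie_submodule] by simp
  have diff: "verma_vec (p - q) = \<zero>\<^bsub>Verma c h\<^esub>" if "verma_vec p = verma_vec q" for p q
  proof -
    have "verma_vec (p - q) = verma_vec (q - q)"
      using that by (simp only: flip: vermaD(7))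
    then show ?thesis by (simp add: vermaD(5))
  qed
  have gen: "gen x - scale (Poly_Mapping.lookup x (Vd 0) * h + Poly_Mapping.lookup x VC * c) 1
      \<in> {p. verma_vec p = \<zero>\<^bsub>Verma c h\<^esub>}" if "x \<in> carrier Vir_nonneg" for x
    using verma_vec_nonneg[OF free_algebra_carrier_intros(8)[OF that], of 1] eps_gen[OF that, of 1]
    by (intro CollectI diff) (simp add: eps_one)
  show ?thesis
  proof
    show "dg n \<in> {p. verma_vec p = \<zero>\<^bsub>Verma c h\<^esub>}" if "0 < n" for n
      using gen[of "basis_vec (Vd n)"] that by (simp add: Vir_nonneg_def lookup_single when_def)
    show "dg 0 - scale h 1 \<in> {p. verma_vec p = \<zero>\<^bsub>Verma c h\<^esub>}"
      using gen[of "basis_vec (Vd 0)"] by (simp add: Vir_nonneg_def lookup_single when_def)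
    show "cg - scale c 1 \<in> {p. verma_vec p = \<zero>\<^bsub>Verma c h\<^esub>}"
      using gen[of "basis_vec VC"] by (simp add: Vir_nonneg_def lookup_single when_def)
  qed
qed

text \<open>\<open>Ann\<close> contains the kernel of \<open>verma_vec\<close>, so any
  representative decides.\<close>

lemma verma_vec_mem_Ann: "verma_vec p \<in> verma_vec ` Ann \<longleftrightarrow> p \<in> Ann"
proof
  assume "verma_vec p \<in> verma_vec ` Ann"
  then obtain q where q: "verma_vec p = verma_vec q" "q \<in> Ann" by blast
  then have "verma_vec (p - q) = \<zero>\<^bsub>Verma c h\<^esub>"
    using vermaD(5) vermaD(7)[of q q] by (simp flip: vermaD(7))
  then show "p \<in> Ann" using Ann.L_cong[OF verma_null_Ann] q(2) by blast
qed simp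

text \<open>A submodule not inside the radical contains a vector with nonzero vacuum component, and
  the weight argument of \<open>one_in_left_ideal\<close> brings the generator into it. So the
  radical contains every proper submodule, which also settles the uniqueness behind the definite
  description.\<close>

lemma Verma_max_submodule_eq: "Verma_max_submodule c h = verma_vec ` Ann"
  and lie_submodule_Ann: "lie_submodule Vir (Verma c h) (verma_vec ` Ann)"
proof -
  have sub: "submodule (verma_vec ` Ann) complex_field (Verma c h)"
    by (rule rep_presentation_submoduleI[OF verma_presentation verma_module])
      (auto intro: Ann.L_zero Ann.L_add Ann.L_scale)
  then show lie: "lie_submodule Vir (Verma c h) (verma_vec ` Ann)"
    by (auto simp: lie_submodule_def vermaD(4) intro: Ann.L_left)
  have proper: "verma_vec ` Ann \<noteq> carrier (Verma c h)"
  proof -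
    have "1 \<notin> Ann" using Ann_eps eps_one by fastforce
    moreover have "verma_vec 1 \<in> carrier (Verma c h)" by (simp add: vermaD(1))
    ultimately show ?thesis using verma_vec_mem_Ann[of 1] by auto
  qed
  have max: "K \<subseteq> verma_vec ` Ann" if K: "lie_submodule Vir (Verma c h) K" "K \<noteq> carrier (Verma c h)" for K
  proof (rule ccontr)
    assume "\<not> K \<subseteq> verma_vec ` Ann"
    have subK: "submodule K complex_field (Verma c h)" using K(1) by (simp add: lie_submodule_def)
    then have Kc: "K \<subseteq> carrier (Verma c h)" and Kz: "\<zero>\<^bsub>Verma c h\<^esub> \<in> K"
      using Module.module.submoduleE(1)[OF verma_module] subgroup.one_closed[OF submodule.axioms(1)[OF subK]]
      by simp_all
    interpret K: vir_left_ideal "{p. verma_vec p \<in> K}" by (rule vir_left_ideal_vimage[OF K(1)])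
    from \<open>\<not> K \<subseteq> verma_vec ` Ann\<close> obtain v where "v \<in> K" "v \<notin> verma_vec ` Ann" by blast
    then obtain p where p: "verma_vec p \<in> K" "p \<notin> Ann"
      using Kc unfolding vermaD(1) by blast
    then obtain s where s: "\<epsilon> (s * p) \<noteq> 0" by (auto simp: Ann_def)
    have "1 \<in> {p. verma_vec p \<in> K}"
    proof (rule one_in_left_ideal[OF verma_kernel _ K.vir_left_ideal_axioms])
      show "s * p \<in> {p. verma_vec p \<in> K}" using K.L_left[of p s] p by simp
      show "\<epsilon> (s * p) \<noteq> 0" by (rule s)
    qed (use verma_null_Ann Ann_eps Kz in auto)
    then have "verma_vec q \<in> K" for q using K.L_left[of 1 q] by simp
    then have "carrier (Verma c h) \<subseteq> K" unfolding vermaD(1) by auto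
    then show False using K(2) Kc by simp
  qed
  have "maximal_lie_submodule Vir (Verma c h) J \<longleftrightarrow> J = verma_vec ` Ann" for J
  proof
    assume J: "maximal_lie_submodule Vir (Verma c h) J"
    then have "J \<subseteq> verma_vec ` Ann" using max by (auto simp: maximal_lie_submodule_def)
    with J lie proper show "J = verma_vec ` Ann" unfolding maximal_lie_submodule_def by metis
  next
    assume "J = verma_vec ` Ann"
    with lie proper max show "maximal_lie_submodule Vir (Verma c h) J"
      unfolding maximal_lie_submodule_def by blast
  qed
  then show "Verma_max_submodule c h = verma_vec ` Ann"
    by (simp add: Verma_max_submodule_def)
qed

definition simple_vec where
  "simple_vec p = Verma_max_submodule c h +>\<^bsub>Verma c h\<^esub> verma_vec p"

lemma simple_presentation: "rep_presentation simple_vec (simple_highest_weight c h) (\<lambda>x p. gen x * p)"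
  and simple_vec_eq_iff: "simple_vec p = simple_vec q \<longleftrightarrow> p - q \<in> Ann"
proof -
  have "submodule (verma_vec ` Ann) complex_field (Verma c h)"
    "\<And>x v. v \<in> verma_vec ` Ann \<Longrightarrow> act (Verma c h) x v \<in> verma_vec ` Ann"
    using lie_submodule_Ann by (auto simp: lie_submodule_def carrier_Vir)
  note Q = rep_presentation_quotient[OF verma_presentation verma_module distrib_left this]
  show "rep_presentation simple_vec (simple_highest_weight c h) (\<lambda>x p. gen x * p)"
    using Q(1) unfolding simple_vec_def simple_highest_weight_def Verma_max_submodule_eq .
  show "simple_vec p = simple_vec q \<longleftrightarrow> p - q \<in> Ann"
    using Q(3)[of p q] unfolding simple_vec_def Verma_max_submodule_eq verma_vec_mem_Ann .
qed

end

section \<open>Coordinates on the tensor product\<close>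

context fixes \<alpha> \<beta> :: complex
begin

definition series_index :: "int set" where
  "series_index = (if \<alpha> = 0 \<and> \<beta> = 0 then - {0} else UNIV)"

text \<open>Describing the kernel by vanishing coordinates treats both branches of
  \<open>intermediate_series'\<close> at once.\<close>

definition series_null :: "(int \<Rightarrow>\<^sub>0 complex) set" where
  "series_null = {y. \<forall>j\<in>series_index. Poly_Mapping.lookup y j = 0}"

lemma lookup_act_intermediate:
  "Poly_Mapping.lookup (act (intermediate_series \<alpha> \<beta>) x y) j =
    lin_form (\<lambda>b. case b of Vd n \<Rightarrow> (\<alpha> + of_int (j - n) + of_int n * \<beta>) * Poly_Mapping.lookup y (j - n) | VC \<Rightarrow> 0) x"
proof (induction x rule: free_space_induct)
  case (basis b)
  show ?case
  proof (induction y rule: free_space_induct)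
    case (basis k)
    show ?case by (cases b) (auto simp: act_intermediate_basis lin_form_simps lookup_single when_def)
  next
    case (add p q)
    then show ?case
      by (cases b) (simp_all add: act_intermediate_simps lin_form_simps lookup_add distrib_left)
  qed (cases b; simp add: act_intermediate_simps lin_form_simps)+
qed (simp_all add: act_intermediate_simps lin_form_simps lookup_add)

lemma intermediate_ops: "carrier (intermediate_series \<alpha> \<beta>) = UNIV" "zero (intermediate_series \<alpha> \<beta>) = 0"
    "add (intermediate_series \<alpha> \<beta>) = (+)" "module.smult (intermediate_series \<alpha> \<beta>) = scale"
  by (simp_all add: intermediate_series_def free_rep_def)

lemma series_null_submodule: "submodule series_null complex_field (intermediate_series \<alpha> \<beta>)"
  unfolding intermediate_series_def by (rule submodule_free_repI) (auto simp: series_null_def lookup_add)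

lemma series_null_eq:
  "(if \<alpha> = 0 \<and> \<beta> = 0 then lin_span (intermediate_series \<alpha> \<beta>) {basis_vec 0} else {0}) = series_null"
proof (cases "\<alpha> = 0 \<and> \<beta> = 0")
  case True
  have "lin_span (intermediate_series \<alpha> \<beta>) {basis_vec 0} = series_null"
  proof
    show "lin_span (intermediate_series \<alpha> \<beta>) {basis_vec 0} \<subseteq> series_null"
      by (rule lin_span_least[OF series_null_submodule])
        (unfold series_null_def series_index_def, auto simp: True lookup_one)
    show "series_null \<subseteq> lin_span (intermediate_series \<alpha> \<beta>) {basis_vec 0}"
    proof
      fix y assume "y \<in> series_null"
      then have "y = scale (Poly_Mapping.lookup y 0) (basis_vec 0)"
        by (intro poly_mapping_eqI, unfold series_null_def series_index_def) (auto simp: True lookup_one when_def)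
      moreover have "scale a (basis_vec 0) \<in> lin_span (intermediate_series \<alpha> \<beta>) {basis_vec 0}" for a
        unfolding intermediate_series_def
        by (intro submodule_free_repD(4)[OF submodule_lin_span_free_rep] subsetD[OF lin_span_superset])
          (simp_all add: free_rep_simps)
      ultimately show "y \<in> lin_span (intermediate_series \<alpha> \<beta>) {basis_vec 0}" by metis
    qed
  qed
  then show ?thesis using True by simp
next
  case False
  then show ?thesis by (auto simp: series_null_def series_index_def intro: poly_mapping_eqI)
qed

lemma series_null_act: "y \<in> series_null \<Longrightarrow> act (intermediate_series \<alpha> \<beta>) x y \<in> series_null"
proof -
  assume y: "y \<in> series_null"
  \<comment> \<open>Either the coordinate of \<open>y\<close> vanishes, or \<alpha> = \<beta> = 0
    and j = n, where the coefficient is 0.\<close>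
  have "(\<alpha> + of_int (j - n) + of_int n * \<beta>) * Poly_Mapping.lookup y (j - n) = 0" for j n
    using y by (cases "j - n \<in> series_index") (auto simp: series_null_def series_index_def split: if_splits)
  then show ?thesis
    by (simp add: series_null_def lookup_act_intermediate lin_form_def sum.neutral split: vir_basis.split)
qed

definition series_vec where
  "series_vec y = series_null +>\<^bsub>intermediate_series \<alpha> \<beta>\<^esub> y"

lemma series_presentation:
  "rep_presentation series_vec (intermediate_series' \<alpha> \<beta>) (act (intermediate_series \<alpha> \<beta>))"
  and series_vec_eq_iff:
  "series_vec y = series_vec y' \<longleftrightarrow> (\<forall>j\<in>series_index. Poly_Mapping.lookup y j = Poly_Mapping.lookup y' j)"
proof -
  have P: "rep_presentation (\<lambda>y. y) (intermediate_series \<alpha> \<beta>) (act (intermediate_series \<alpha> \<beta>))"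
    by (simp add: rep_presentation_def intermediate_ops)
  have M: "Module.module complex_field (intermediate_series \<alpha> \<beta>)"
    using lie_module_intermediate_series by (simp add: lie_module_def)
  note Q = rep_presentation_quotient[OF P M act_intermediate_simps(2) series_null_submodule series_null_act]
  show "rep_presentation series_vec (intermediate_series' \<alpha> \<beta>) (act (intermediate_series \<alpha> \<beta>))"
    using Q(1) unfolding intermediate_series'_def series_null_eq series_vec_def .
  show "series_vec y = series_vec y' \<longleftrightarrow> (\<forall>j\<in>series_index. Poly_Mapping.lookup y j = Poly_Mapping.lookup y' j)"
    using Q(3)[of y y'] by (auto simp: series_vec_def series_null_def lookup_minus)
qed

end

locale tensor_series = vir_hw_functional + fixes \<alpha> \<beta> :: complex
begin

abbreviation "I \<equiv> series_index \<alpha> \<beta>"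
abbreviation "w_vec \<equiv> series_vec \<alpha> \<beta>"
abbreviation "V \<equiv> simple_highest_weight c h"
abbreviation "W \<equiv> intermediate_series' \<alpha> \<beta>"

lemmas VD = rep_presentationD[OF simple_presentation]
lemmas WD = rep_presentationD[OF series_presentation[of \<alpha> \<beta>]]

definition tensor_free where
  "tensor_free = free_rep (carrier V \<times> carrier W) (\<lambda>x (v, w). basis_vec (act V x v, w) + basis_vec (v, act W x w))"

lemma carrier_tensor_free: "carrier tensor_free = {P. Poly_Mapping.keys P \<subseteq> range simple_vec \<times> range w_vec}"
  by (simp add: tensor_free_def free_rep_simps VD(1) WD(1))

lemma act_tensor_free_basis:
  "act tensor_free x (Poly_Mapping.single (simple_vec p, w_vec y) a) =
    scale a (basis_vec (simple_vec (gen x * p), w_vec y) + basis_vec (simple_vec p, w_vec (act (intermediate_series \<alpha> \<beta>) x y)))"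
  by (simp add: tensor_free_def free_rep_simps VD(4) WD(4))

definition coord_V where
  "coord_V s v = \<epsilon> (s * (SOME p. v = simple_vec p))"

definition coord_W where
  "coord_W j w = (if j \<in> I then Poly_Mapping.lookup (SOME y. w = w_vec y) j else 0)"

lemma coord_V_simple_vec: "coord_V s (simple_vec p) = \<epsilon> (s * p)"
proof -
  have "simple_vec p = simple_vec (SOME q. simple_vec p = simple_vec q)" by (rule someI) simp
  then have "p - (SOME q. simple_vec p = simple_vec q) \<in> Ann" by (simp add: simple_vec_eq_iff)
  then have "\<epsilon> (s * (p - (SOME q. simple_vec p = simple_vec q))) = 0" by (simp add: Ann_def)
  then show ?thesis by (simp add: coord_V_def right_diff_distrib eps_diff)
qed

lemma coord_W_vec: "coord_W j (w_vec y) = (if j \<in> I then Poly_Mapping.lookup y j else 0)"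
proof -
  have "w_vec y = w_vec (SOME z. w_vec y = w_vec z)" by (rule someI) simp
  then show ?thesis by (simp add: coord_W_def series_vec_eq_iff)
qed

text \<open>The functional sending v \<otimes> w to \<open>\<epsilon>\<close> of s v times the j-th
  coordinate of w, extended linearly to the free space. Letting s range over the whole algebra makes
  up for a basis of V.\<close>

definition coord where
  "coord j s = lin_form (\<lambda>(v, w). coord_V s v * coord_W j w)"

lemma coord_simps:
  "coord j s (P + Q) = coord j s P + coord j s Q"
  "coord j s (P - Q) = coord j s P - coord j s Q"
  "coord j s (scale a P) = a * coord j s P"
  "coord j s (Poly_Mapping.single (simple_vec p, w_vec y) a) = a * (\<epsilon> (s * p) * (if j \<in> I then Poly_Mapping.lookup y j else 0))"
  "coord j s 0 = 0"
  by (simp_all add: coord_def lin_form_simps coord_V_simple_vec coord_W_vec)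

lemma coord_sum: "coord j s (\<Sum>i\<in>S. f i) = (\<Sum>i\<in>S. coord j s (f i))"
  by (induction S rule: infinite_finite_induct) (simp_all add: coord_simps)

text \<open>The transposed action on labels: the first factor turns s into \<open>s * gen x\<close>,
  the second shifts j to j - n.\<close>

lemma coord_act:
  assumes "P \<in> carrier tensor_free"
  shows "coord j s (act tensor_free x P) = coord j (s * gen x) P +
    (if j \<in> I then lin_form (\<lambda>b. case b of Vd n \<Rightarrow> (\<alpha> + of_int (j - n) + of_int n * \<beta>) * coord (j - n) s P | VC \<Rightarrow> 0) x else 0)"
proof -
  have add: "act tensor_free x (P + Q) = act tensor_free x P + act tensor_free x Q"
    and sc: "act tensor_free x (scale a P) = scale a (act tensor_free x P)"
    and z: "act tensor_free x 0 = 0" for P Q a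
    by (simp_all add: tensor_free_def free_rep_simps lin_ext_add lin_ext_scale)
  define g where "g P = (\<lambda>b. case b of Vd n \<Rightarrow> (\<alpha> + of_int (j - n) + of_int n * \<beta>) * coord (j - n) s P | VC \<Rightarrow> 0)" for P
  have g_add: "lin_form (g (P + Q)) x = lin_form (g P) x + lin_form (g Q) x" for P Q
  proof -
    have "g (P + Q) b = g P b + g Q b" for b by (cases b) (simp_all add: g_def coord_simps distrib_left)
    then show ?thesis by (simp add: lin_form_def distrib_left sum.distrib)
  qed
  have g_scale: "lin_form (g (scale a P)) x = a * lin_form (g P) x" for a P
  proof -
    have "g (scale a P) b = a * g P b" for b by (cases b) (simp_all add: g_def coord_simps)
    then show ?thesis by (simp add: lin_form_def sum_distrib_left mult.left_commute)
  qed
  have "Poly_Mapping.keys P \<subseteq> range simple_vec \<times> range w_vec" using assms by (simp add: carrier_tensor_free)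
  then have "coord j s (act tensor_free x P) = coord j (s * gen x) P + (if j \<in> I then lin_form (g P) x else 0)"
  proof (induction P rule: free_space_induct_keys)
    case zero
    have "g 0 = (\<lambda>b. 0)" by (rule ext) (simp add: g_def coord_simps split: vir_basis.split)
    then show ?case by (simp add: z coord_simps lin_form_def)
  next
    case (basis k)
    then obtain p y where k: "k = (simple_vec p, w_vec y)" by auto
    have "lin_form (g (basis_vec k)) x = \<epsilon> (s * p) * Poly_Mapping.lookup (act (intermediate_series \<alpha> \<beta>) x y) j"
    proof -
      \<comment> \<open>An index j - n outside \<open>I\<close> forces \<alpha> = \<beta> = 0 and j
        = n, so the coefficient vanishes and both sides agree there too.\<close>
      have "g (basis_vec k) b = \<epsilon> (s * p) *
        (case b of Vd n \<Rightarrow> (\<alpha> + of_int (j - n) + of_int n * \<beta>) * Poly_Mapping.lookup y (j - n) | VC \<Rightarrow> 0)" for b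
        by (cases b) (auto simp: g_def k coord_simps series_index_def)
      then show ?thesis
        unfolding lookup_act_intermediate
        by (simp add: lin_form_def sum_distrib_left mult.left_commute del: of_int_diff)
    qed
    then show ?case
      by (simp add: k act_tensor_free_basis coord_simps mult.assoc)
  qed (simp_all add: add sc coord_simps g_add g_scale distrib_left)
  then show ?thesis by (simp only: g_def)
qed

definition tensor_null where
  "tensor_null = lin_span tensor_free (bilinear_relations V W)"

lemma tensor_eq: "lie_tensor V W = lie_quotient tensor_free tensor_null"
  by (simp add: lie_tensor_def tensor_free_def tensor_null_def Let_def)

lemma bilinear_relations_cases [consumes 1]:
  assumes "r \<in> bilinear_relations V W"
  obtains p p' y where "r = basis_vec (simple_vec (p + p'), w_vec y) - basis_vec (simple_vec p, w_vec y) - basis_vec (simple_vec p', w_vec y)"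
  | p y y' where "r = basis_vec (simple_vec p, w_vec (y + y')) - basis_vec (simple_vec p, w_vec y) - basis_vec (simple_vec p, w_vec y')"
  | a p y where "r = basis_vec (simple_vec (scale a p), w_vec y) - scale a (basis_vec (simple_vec p, w_vec y))"
  | a p y where "r = basis_vec (simple_vec p, w_vec (scale a y)) - scale a (basis_vec (simple_vec p, w_vec y))"
  using assms unfolding bilinear_relations_def VD(1) WD(1)
  by (auto simp: VD(2,3) WD(2,3) simp del: scale_single)

lemma bilinear_relations_intros:
  "basis_vec (simple_vec (p + p'), w_vec y) - basis_vec (simple_vec p, w_vec y) - basis_vec (simple_vec p', w_vec y) \<in> bilinear_relations V W"
  "basis_vec (simple_vec p, w_vec (y + y')) - basis_vec (simple_vec p, w_vec y) - basis_vec (simple_vec p, w_vec y') \<in> bilinear_relations V W"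
  "basis_vec (simple_vec (scale a p), w_vec y) - scale a (basis_vec (simple_vec p, w_vec y)) \<in> bilinear_relations V W"
  "basis_vec (simple_vec p, w_vec (scale a y)) - scale a (basis_vec (simple_vec p, w_vec y)) \<in> bilinear_relations V W"
  unfolding bilinear_relations_def VD(1) WD(1) VD(2,3)[symmetric] WD(2,3)[symmetric] by blast+

lemma tensor_free_submodule: "submodule (carrier tensor_free) complex_field tensor_free"
  unfolding tensor_free_def by (rule Module.module.carrier_is_submodule[OF module_free_rep])

lemmas tensor_freeD = submodule_free_repD[OF tensor_free_submodule[unfolded tensor_free_def], folded tensor_free_def]

lemma basis_tensor_free: "basis_vec (simple_vec p, w_vec y) \<in> carrier tensor_free"
  by (simp add: carrier_tensor_free)

lemma bilinear_relations_carrier: "bilinear_relations V W \<subseteq> carrier tensor_free"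
proof
  fix r assume "r \<in> bilinear_relations V W"
  then show "r \<in> carrier tensor_free"
    by (cases rule: bilinear_relations_cases)
      (simp_all only:, (intro tensor_freeD(4,5) basis_tensor_free)+)
qed

lemma tensor_null_submodule: "submodule tensor_null complex_field tensor_free"
  unfolding tensor_null_def tensor_free_def
  by (rule submodule_lin_span_free_rep) (use bilinear_relations_carrier in \<open>simp add: tensor_free_def\<close>)

lemmas tensor_nullD = submodule_free_repD[OF tensor_null_submodule[unfolded tensor_free_def], folded tensor_free_def]

lemma tensor_null_relation: "r \<in> bilinear_relations V W \<Longrightarrow> r \<in> tensor_null"
  unfolding tensor_null_def by (rule subsetD[OF lin_span_superset])

lemma tensor_null_coord:
  assumes "P \<in> tensor_null"
  shows "P \<in> carrier tensor_free" "coord j s P = 0"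
proof -
  let ?H = "{P \<in> carrier tensor_free. coord j s P = 0}"
  have "submodule ?H complex_field tensor_free"
    unfolding tensor_free_def
    by (rule submodule_free_repI, fold tensor_free_def)
      (use tensor_freeD(1) in \<open>auto simp: coord_simps intro: tensor_freeD(2-4)\<close>)
  moreover have "bilinear_relations V W \<subseteq> ?H"
  proof
    fix r assume r: "r \<in> bilinear_relations V W"
    then have "coord j s r = 0"
      by (cases rule: bilinear_relations_cases)
        (simp_all only: coord_simps(1-3) coord_simps(4)[of _ _ _ _ 1],
          simp_all add: distrib_left eps_add scale_mult_right eps_scale lookup_add algebra_simps)
    then show "r \<in> ?H" using r bilinear_relations_carrier by blast
  qed
  ultimately have "tensor_null \<subseteq> ?H" unfolding tensor_null_def by (rule lin_span_least)
  then show "P \<in> carrier tensor_free" "coord j s P = 0" using assms by auto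
qed

section \<open>Normal forms of tensors\<close>

definition pure_sum :: "int set \<Rightarrow> (int \<Rightarrow> vir falg) \<Rightarrow> _" where
  "pure_sum S q = (\<Sum>j\<in>S. basis_vec (simple_vec (q j), w_vec (basis_vec j)))"

lemma tensor_null_zero_left: "basis_vec (simple_vec 0, w_vec y) \<in> tensor_null"
  using tensor_null_relation[OF bilinear_relations_intros(3)[of 0 0 y]] by simp

lemma pure_sum_mono:
  assumes "finite T" "S \<subseteq> T" "\<And>j. j \<notin> S \<Longrightarrow> q j = 0"
  shows "pure_sum S q - pure_sum T q \<in> tensor_null"
proof -
  have "pure_sum S q - pure_sum T q = 0 - (\<Sum>j\<in>T - S. basis_vec (simple_vec (q j), w_vec (basis_vec j)))"
    by (simp add: pure_sum_def sum.subset_diff[OF assms(2,1)])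
  also have "\<dots> \<in> tensor_null"
    by (intro tensor_nullD(2,5,6)) (use assms(3) tensor_null_zero_left in simp)
  finally show ?thesis .
qed

lemma pure_sum_add: "pure_sum S q + pure_sum S q' - pure_sum S (\<lambda>j. q j + q' j) \<in> tensor_null"
proof -
  have "pure_sum S q + pure_sum S q' - pure_sum S (\<lambda>j. q j + q' j) = 0 - (\<Sum>j\<in>S.
      basis_vec (simple_vec (q j + q' j), w_vec (basis_vec j)) - basis_vec (simple_vec (q j), w_vec (basis_vec j))
      - basis_vec (simple_vec (q' j), w_vec (basis_vec j)))"
    by (simp add: pure_sum_def sum_subtractf sum.distrib)
  also have "\<dots> \<in> tensor_null"
    by (intro tensor_nullD(2,5,6) tensor_null_relation bilinear_relations_intros)
  finally show ?thesis .
qed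

lemma pure_sum_scale: "scale a (pure_sum S q) - pure_sum S (\<lambda>j. scale a (q j)) \<in> tensor_null"
proof -
  have "scale a (pure_sum S q) - pure_sum S (\<lambda>j. scale a (q j)) = 0 - (\<Sum>j\<in>S.
      basis_vec (simple_vec (scale a (q j)), w_vec (basis_vec j)) - scale a (basis_vec (simple_vec (q j), w_vec (basis_vec j))))"
    by (simp add: pure_sum_def sum_subtractf scale_sum_right)
  also have "\<dots> \<in> tensor_null"
    by (intro tensor_nullD(2,5,6) tensor_null_relation bilinear_relations_intros)
  finally show ?thesis .
qed

lemma basis_pure_sum:
  assumes "finite S"
  shows "basis_vec (simple_vec p, w_vec (\<Sum>j\<in>S. scale (a j) (basis_vec j)))
    - pure_sum S (\<lambda>j. scale (a j) p) \<in> tensor_null"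
  using assms
proof (induction S)
  case empty
  show ?case
    using tensor_null_relation[OF bilinear_relations_intros(4)[of p 0 0]] by (simp add: pure_sum_def)
next
  case (insert k S)
  let ?b = "\<lambda>p y. basis_vec (simple_vec p, w_vec y)"
  let ?y = "\<Sum>j\<in>S. scale (a j) (basis_vec j)"
  have "(?b p (scale (a k) (basis_vec k) + ?y) - ?b p (scale (a k) (basis_vec k)) - ?b p ?y)
    + (?b p (scale (a k) (basis_vec k)) - scale (a k) (?b p (basis_vec k)))
    - (?b (scale (a k) p) (basis_vec k) - scale (a k) (?b p (basis_vec k)))
    + (?b p ?y - pure_sum S (\<lambda>j. scale (a j) p)) \<in> tensor_null"
    by (intro tensor_nullD(3,5) tensor_null_relation bilinear_relations_intros insert.IH)
  then show ?case
    using insert.hyps by (simp add: pure_sum_def algebra_simps del: scale_single)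
qed

text \<open>Every tensor is a finite sum of q_j \<otimes> v_j. Requiring \<open>q\<close> to vanish
  off \<open>S\<close> allows \<open>S\<close> to be enlarged, so that two normal forms can be added
  over a common index set.\<close>

lemma tensor_null_reduce:
  assumes "P \<in> carrier tensor_free"
  shows "\<exists>S q. finite S \<and> S \<subseteq> I \<and> (\<forall>j. j \<notin> S \<longrightarrow> q j = 0) \<and> P - pure_sum S q \<in> tensor_null"
proof -
  have "Poly_Mapping.keys P \<subseteq> range simple_vec \<times> range w_vec" using assms by (simp add: carrier_tensor_free)
  then show ?thesis
  proof (induction P rule: free_space_induct_keys)
    case zero
    show ?case
      by (intro exI[of _ "{}"] exI[of _ "\<lambda>_. 0"]) (simp add: pure_sum_def tensor_nullD(2))
  next
    case (basis k)
    then obtain p y where k: "k = (simple_vec p, w_vec y)" by auto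
    define S where "S = Poly_Mapping.keys y \<inter> I"
    have fin: "finite S" by (simp add: S_def)
    have "w_vec y = w_vec (\<Sum>j\<in>S. scale (Poly_Mapping.lookup y j) (basis_vec j))"
      by (auto simp: series_vec_eq_iff lookup_sum lookup_single when_def S_def in_keys_iff)
    then have "basis_vec k - pure_sum S (\<lambda>j. scale (Poly_Mapping.lookup y j) p) \<in> tensor_null"
      using basis_pure_sum[OF fin, of p "Poly_Mapping.lookup y"] k by simp
    moreover have "pure_sum S (\<lambda>j. scale (Poly_Mapping.lookup y j) p) =
        pure_sum S (\<lambda>j. if j \<in> S then scale (Poly_Mapping.lookup y j) p else 0)"
      by (simp add: pure_sum_def)
    ultimately show ?case
      by (intro exI[of _ S] exI[of _ "\<lambda>j. if j \<in> S then scale (Poly_Mapping.lookup y j) p else 0"])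
        (simp add: fin, simp add: S_def)
  next
    case (add P Q)
    then obtain S q T r where
      S: "finite S" "S \<subseteq> I" "\<And>j. j \<notin> S \<Longrightarrow> q j = 0" "P - pure_sum S q \<in> tensor_null" and
      T: "finite T" "T \<subseteq> I" "\<And>j. j \<notin> T \<Longrightarrow> r j = 0" "Q - pure_sum T r \<in> tensor_null"
      by metis
    have "(P - pure_sum S q) + (pure_sum S q - pure_sum (S \<union> T) q)
      + ((Q - pure_sum T r) + (pure_sum T r - pure_sum (S \<union> T) r))
      + (pure_sum (S \<union> T) q + pure_sum (S \<union> T) r - pure_sum (S \<union> T) (\<lambda>j. q j + r j)) \<in> tensor_null"
      by (intro tensor_nullD(3) S T pure_sum_mono pure_sum_add) (use S T in auto)
    then show ?case
      by (intro exI[of _ "S \<union> T"] exI[of _ "\<lambda>j. q j + r j"]) (use S T in \<open>simp add: algebra_simps\<close>)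
  next
    case (scale a P)
    then obtain S q where
      S: "finite S" "S \<subseteq> I" "\<And>j. j \<notin> S \<Longrightarrow> q j = 0" "P - pure_sum S q \<in> tensor_null" by metis
    have "scale a (P - pure_sum S q) + (scale a (pure_sum S q) - pure_sum S (\<lambda>j. scale a (q j))) \<in> tensor_null"
      by (intro tensor_nullD(3,4) S pure_sum_scale)
    then show ?case
      by (intro exI[of _ S] exI[of _ "\<lambda>j. scale a (q j)"]) (use S in \<open>simp add: scale_diff_right\<close>)
  qed
qed

lemma coord_pure_sum:
  assumes "finite S" "S \<subseteq> I"
  shows "coord j s (pure_sum S q) = (if j \<in> S then \<epsilon> (s * q j) else 0)"
proof -
  have "coord j s (pure_sum S q) = (\<Sum>i\<in>S. if i = j then \<epsilon> (s * q i) else 0)"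
    unfolding pure_sum_def coord_sum using assms(2)
    by (intro sum.cong refl) (auto simp: coord_simps(4)[of _ _ _ _ 1] lookup_single when_def simp del: single_one)
  then show ?thesis using assms(1) by simp
qed

text \<open>The coordinates separate tensors: on a normal form they return
  \<open>\<epsilon> (s * q j)\<close>, and vanishing for all s puts \<open>q j\<close> into
  \<open>Ann\<close>, so each summand is 0 \<otimes> v_j.\<close>

lemma tensor_null_iff: "P \<in> tensor_null \<longleftrightarrow> P \<in> carrier tensor_free \<and> (\<forall>j s. coord j s P = 0)"
proof
  assume P: "P \<in> carrier tensor_free \<and> (\<forall>j s. coord j s P = 0)"
  then obtain S q where S: "finite S" "S \<subseteq> I" "P - pure_sum S q \<in> tensor_null"
    using tensor_null_reduce by metis
  have "simple_vec (q j) = simple_vec 0" if "j \<in> S" for j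
  proof -
    have "\<epsilon> (s * q j) = 0" for s
      using tensor_null_coord(2)[OF S(3), of j s] P that by (simp add: coord_simps coord_pure_sum[OF S(1,2)])
    then show ?thesis by (simp add: simple_vec_eq_iff Ann_def)
  qed
  then have "pure_sum S q \<in> tensor_null"
    unfolding pure_sum_def by (intro tensor_nullD(6)) (simp add: tensor_null_zero_left)
  with tensor_nullD(3)[OF S(3)] show "P \<in> tensor_null" by fastforce
qed (use tensor_null_coord in blast)

lemma act_tensor_free_carrier:
  assumes "P \<in> carrier tensor_free"
  shows "act tensor_free x P \<in> carrier tensor_free"
proof -
  have "Poly_Mapping.keys P \<subseteq> range simple_vec \<times> range w_vec" using assms by (simp add: carrier_tensor_free)
  then show ?thesis
  proof (induction P rule: free_space_induct_keys)
    case (basis k)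
    then obtain p y where k: "k = (simple_vec p, w_vec y)" by auto
    show ?case unfolding k act_tensor_free_basis scale_one
      by (intro tensor_freeD(3) basis_tensor_free)
  qed (simp_all add: tensor_free_def free_rep_simps(5) lin_ext_add lin_ext_scale tensor_freeD(2-4)[unfolded tensor_free_def])
qed

text \<open>Stability of the null space under the action is read off the coordinates: by
  \<open>coord_act\<close> those of the image are combinations of those of the argument.\<close>

lemma tensor_quotient: "rep_quotient tensor_free tensor_null"
proof (intro rep_quotient.intro rep_quotient_axioms.intro)
  show "Module.module complex_field tensor_free" unfolding tensor_free_def by (rule module_free_rep)
  show "act tensor_free x v \<in> tensor_null" if "v \<in> tensor_null" for x v
  proof -
    have v: "v \<in> carrier tensor_free" "\<And>j s. coord j s v = 0" using that tensor_null_iff by auto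
    have lf: "lin_form (\<lambda>b. case b of Vd n \<Rightarrow> (\<alpha> + of_int (j - n) + of_int n * \<beta>) * coord (j - n) s v | VC \<Rightarrow> 0) x = 0" for j s
      unfolding lin_form_def by (rule sum.neutral) (auto simp: v(2) split: vir_basis.split)
    have "coord j s (act tensor_free x v) = 0" for j s
      unfolding coord_act[OF v(1)] lf by (simp add: v(2))
    then show ?thesis by (simp add: tensor_null_iff act_tensor_free_carrier v(1))
  qed
qed (simp_all add: act_tensor_free_carrier tensor_null_submodule, simp add: tensor_free_def free_rep_simps lin_ext_add)

section \<open>Coordinates of elements of the tensor product\<close>

definition tensor_coord where
  "tensor_coord z j s = coord j s (SOME P. P \<in> carrier tensor_free \<and> z = tensor_null +>\<^bsub>tensor_free\<^esub> P)"

lemma tensor_coset_eq: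
  assumes "P \<in> carrier tensor_free" "Q \<in> carrier tensor_free"
  shows "tensor_null +>\<^bsub>tensor_free\<^esub> P = tensor_null +>\<^bsub>tensor_free\<^esub> Q \<longleftrightarrow> (\<forall>j s. coord j s P = coord j s Q)"
proof -
  interpret rep_quotient tensor_free tensor_null by (rule tensor_quotient)
  have "P \<ominus>\<^bsub>tensor_free\<^esub> Q = P - Q"
    unfolding tensor_free_def using assms(2)
    by (intro free_rep_minus) (simp add: tensor_free_def free_rep_simps)
  then show ?thesis
    using coset_eq_iff[OF assms] tensor_freeD(5)[OF assms] by (simp add: tensor_null_iff coord_simps)
qed

lemma tensor_coord_coset:
  assumes "P \<in> carrier tensor_free"
  shows "tensor_coord (tensor_null +>\<^bsub>tensor_free\<^esub> P) j s = coord j s P"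
proof -
  let ?Q = "SOME Q. Q \<in> carrier tensor_free \<and> tensor_null +>\<^bsub>tensor_free\<^esub> P = tensor_null +>\<^bsub>tensor_free\<^esub> Q"
  have "?Q \<in> carrier tensor_free \<and> tensor_null +>\<^bsub>tensor_free\<^esub> P = tensor_null +>\<^bsub>tensor_free\<^esub> ?Q"
    by (rule someI[of _ P]) (simp add: assms)
  then show ?thesis using tensor_coset_eq[OF assms, of ?Q] by (simp add: tensor_coord_def)
qed

abbreviation "T \<equiv> lie_tensor V W"

lemma carrier_tensor: "carrier T = (\<lambda>P. tensor_null +>\<^bsub>tensor_free\<^esub> P) ` carrier tensor_free"
  unfolding tensor_eq by (rule rep_quotient.quotient_carrier[OF tensor_quotient])

lemma tensor_coord_inj: "inj_on tensor_coord (carrier T)"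
proof (rule inj_onI)
  fix y z assume "y \<in> carrier T" "z \<in> carrier T" and eq: "tensor_coord y = tensor_coord z"
  then obtain P Q where "P \<in> carrier tensor_free" "Q \<in> carrier tensor_free"
    "y = tensor_null +>\<^bsub>tensor_free\<^esub> P" "z = tensor_null +>\<^bsub>tensor_free\<^esub> Q"
    by (auto simp: carrier_tensor)
  with eq show "y = z"
    using tensor_coord_coset[of P] tensor_coord_coset[of Q] by (simp add: tensor_coset_eq)
qed

lemma tensor_smult:
  assumes "z \<in> carrier T"
  shows "a \<odot>\<^bsub>T\<^esub> z \<in> carrier T" "tensor_coord (a \<odot>\<^bsub>T\<^esub> z) = (\<lambda>j s. a * tensor_coord z j s)"
proof -
  interpret rep_quotient tensor_free tensor_null by (rule tensor_quotient)
  obtain P where P: "P \<in> carrier tensor_free" "z = tensor_null +>\<^bsub>tensor_free\<^esub> P"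
    using assms by (auto simp: carrier_tensor)
  have sc: "a \<odot>\<^bsub>tensor_free\<^esub> P = scale a P" by (simp add: tensor_free_def free_rep_simps)
  have eq: "a \<odot>\<^bsub>T\<^esub> z = tensor_null +>\<^bsub>tensor_free\<^esub> scale a P"
    unfolding tensor_eq P(2) quotient_smult[OF P(1)] sc ..
  show "a \<odot>\<^bsub>T\<^esub> z \<in> carrier T" "tensor_coord (a \<odot>\<^bsub>T\<^esub> z) = (\<lambda>j s. a * tensor_coord z j s)"
    unfolding eq unfolding P(2) using P(1) tensor_freeD(4)[OF P(1)]
    by (auto simp: carrier_tensor tensor_coord_coset coord_simps fun_eq_iff)
qed

lemma tensor_act:
  assumes "z \<in> carrier T"
  shows "act T x z \<in> carrier T"
    "tensor_coord (act T (basis_vec (Vd n)) z) j s = tensor_coord z j (s * dg n) +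
      (if j \<in> I then (\<alpha> + of_int (j - n) + of_int n * \<beta>) * tensor_coord z (j - n) s else 0)"
    "tensor_coord (act T (basis_vec VC) z) j s = tensor_coord z j (s * cg)"
proof -
  interpret rep_quotient tensor_free tensor_null by (rule tensor_quotient)
  obtain P where P: "P \<in> carrier tensor_free" "z = tensor_null +>\<^bsub>tensor_free\<^esub> P"
    using assms by (auto simp: carrier_tensor)
  have eq: "act T x z = tensor_null +>\<^bsub>tensor_free\<^esub> act tensor_free x P" for x
    unfolding tensor_eq P(2) quotient_act[OF P(1)] ..
  show "act T x z \<in> carrier T"
    unfolding eq using act_tensor_free_carrier[OF P(1)] by (auto simp: carrier_tensor)
  show "tensor_coord (act T (basis_vec (Vd n)) z) j s = tensor_coord z j (s * dg n) +
      (if j \<in> I then (\<alpha> + of_int (j - n) + of_int n * \<beta>) * tensor_coord z (j - n) s else 0)"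
    "tensor_coord (act T (basis_vec VC) z) j s = tensor_coord z j (s * cg)"
    unfolding eq unfolding P(2)
    by (simp_all add: tensor_coord_coset act_tensor_free_carrier P(1) coord_act lin_form_simps)
qed

lemma tensor_coord_finite:
  assumes "z \<in> carrier T"
  shows "\<exists>S q. finite S \<and> S \<subseteq> I \<and> (\<forall>j s. tensor_coord z j s = (if j \<in> S then \<epsilon> (s * q j) else 0))"
proof -
  obtain P where P: "P \<in> carrier tensor_free" "z = tensor_null +>\<^bsub>tensor_free\<^esub> P"
    using assms by (auto simp: carrier_tensor)
  obtain S q where S: "finite S" "S \<subseteq> I" "P - pure_sum S q \<in> tensor_null"
    using tensor_null_reduce[OF P(1)] by metis
  have "tensor_coord z j s = (if j \<in> S then \<epsilon> (s * q j) else 0)" for j s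
    using tensor_null_coord(2)[OF S(3), of j s]
    by (simp add: P(2) tensor_coord_coset[OF P(1)] coord_simps coord_pure_sum[OF S(1,2)])
  with S show ?thesis by blast
qed

definition pure_tensor where
  "pure_tensor k = tensor_null +>\<^bsub>tensor_free\<^esub> basis_vec (simple_vec 1, w_vec (basis_vec k))"

lemma pure_tensor:
  assumes "k \<in> I"
  shows "pure_tensor k \<in> carrier T" "tensor_coord (pure_tensor k) j s = (if j = k then \<epsilon> s else 0)"
  using assms basis_tensor_free[of 1 "basis_vec k"]
  by (auto simp: pure_tensor_def carrier_tensor tensor_coord_coset coord_simps(4)[of _ _ _ _ 1] lookup_single when_def
      simp del: single_one)

end

section \<open>Isomorphisms of tensor products\<close>

lemma cubic_coeffs_zero:
  fixes c0 c1 c2 c3 :: complex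
  assumes "\<And>n. n > N \<Longrightarrow> c0 + c1 * of_int n + c2 * of_int n ^ 2 + c3 * of_int n ^ 3 = 0"
  shows "c0 = 0" "c1 = 0" "c2 = 0" "c3 = 0"
proof -
  let ?p = "[:c0, c1, c2, c3:]"
  have "of_int n \<in> {z. poly ?p z = 0}" if "n > N" for n
    using assms[OF that] by (simp add: power2_eq_square power3_eq_cube algebra_simps)
  then have "of_int ` {N<..} \<subseteq> {z. poly ?p z = 0}" by auto
  moreover have "infinite (of_int ` {N<..} :: complex set)"
    by (subst finite_image_iff) (auto simp: inj_on_def infinite_Ioi)
  ultimately have "?p = 0" using poly_roots_finite[of ?p] finite_subset by blast
  then show "c0 = 0" "c1 = 0" "c2 = 0" "c3 = 0" by auto
qed

text \<open>
  Comparison of linear factors; only the coefficients of \<open>1\<close>, \<open>m\<^sup>2\<close>, \<open>m n\<close> and \<open>m\<^sup>2 n\<close> are needed.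
\<close>

lemma shift_identity:
  fixes A a \<beta> \<beta>' :: complex
  assumes id: "\<And>n m. n > N \<Longrightarrow> m > N \<Longrightarrow>
      (A + of_int (n + m) * \<beta>) * ((a + of_int n + of_int m * \<beta>') * (a + of_int n * \<beta>')) =
      (A + of_int n * \<beta>) * (A + of_int n + of_int m * \<beta>) * (a + of_int (n + m) * \<beta>')"
    and "A \<noteq> 0" "a \<noteq> 0 \<or> \<beta>' \<noteq> 0" "\<beta> \<noteq> 1" "\<beta>' \<noteq> 1"
  shows "A = a \<and> \<beta> = \<beta>'"
proof -
  \<comment> \<open>For fixed m the difference of the two sides is a polynomial in n that vanishes
    at infinitely many integers; these are its coefficients of 1 and n.\<close>
  have coeffs: "(A + of_int m * \<beta>) * (a + of_int m * \<beta>') * (a - A) = 0"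
    "\<beta> * a * (a + of_int m * \<beta>') + (A + of_int m * \<beta>) * \<beta>' * (a + of_int m * \<beta>') + (A + of_int m * \<beta>) * a
      - (\<beta> * (A + of_int m * \<beta>) * (a + of_int m * \<beta>') + A * (a + of_int m * \<beta>') + A * (A + of_int m * \<beta>) * \<beta>') = 0"
    if m: "m > N" for m
  proof -
    let ?c0 = "(A + of_int m * \<beta>) * (a + of_int m * \<beta>') * (a - A)"
    let ?c1 = "\<beta> * a * (a + of_int m * \<beta>') + (A + of_int m * \<beta>) * \<beta>' * (a + of_int m * \<beta>') + (A + of_int m * \<beta>) * a
      - (\<beta> * (A + of_int m * \<beta>) * (a + of_int m * \<beta>') + A * (a + of_int m * \<beta>') + A * (A + of_int m * \<beta>) * \<beta>')"
    let ?c2 = "\<beta> * \<beta>' * (a + of_int m * \<beta>') + \<beta> * a + (A + of_int m * \<beta>) * \<beta>'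
      - (\<beta> * (a + of_int m * \<beta>') + \<beta> * (A + of_int m * \<beta>) * \<beta>' + A * \<beta>')"
    have "?c0 + ?c1 * of_int n + ?c2 * of_int n ^ 2 + 0 * of_int n ^ 3 = 0" if "n > N" for n
    proof -
      have "?c0 + ?c1 * of_int n + ?c2 * of_int n ^ 2 + 0 * of_int n ^ 3 =
        (A + of_int (n + m) * \<beta>) * ((a + of_int n + of_int m * \<beta>') * (a + of_int n * \<beta>')) -
        (A + of_int n * \<beta>) * (A + of_int n + of_int m * \<beta>) * (a + of_int (n + m) * \<beta>')"
        by (simp add: algebra_simps power2_eq_square)
      then show ?thesis using id[OF that m] by simp
    qed
    from cubic_coeffs_zero(1,2)[where N = N, OF this] show "?c0 = 0" "?c1 = 0" by blast+
  qed
  have "A * a * (a - A) + ((A * \<beta>' + a * \<beta>) * (a - A)) * of_int m + (\<beta> * \<beta>' * (a - A)) * of_int m ^ 2 + 0 * of_int m ^ 3 = 0"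
    if "m > N" for m
    using coeffs(1)[OF that] by (simp add: algebra_simps power2_eq_square)
  from cubic_coeffs_zero(1,3)[where N = N, OF this] have 1: "A * a * (a - A) = 0" "\<beta> * \<beta>' * (a - A) = 0" by blast+
  have "(\<beta> * a * a + A * \<beta>' * a + A * a - \<beta> * A * a - A * a - A * A * \<beta>')
    + (A * \<beta>' * \<beta>' + 2 * a * \<beta> * \<beta>' + a * \<beta> - (A * \<beta>' + 2 * A * \<beta> * \<beta>' + \<beta> * \<beta> * a)) * of_int m
    + (\<beta> * \<beta>' * (\<beta>' - \<beta>)) * of_int m ^ 2 + 0 * of_int m ^ 3 = 0" if "m > N" for m
    using coeffs(2)[OF that] by (simp add: algebra_simps power2_eq_square)
  from cubic_coeffs_zero(2,3)[where N = N, OF this]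
  have 2: "A * \<beta>' * \<beta>' + 2 * a * \<beta> * \<beta>' + a * \<beta> - (A * \<beta>' + 2 * A * \<beta> * \<beta>' + \<beta> * \<beta> * a) = 0"
    "\<beta> * \<beta>' * (\<beta>' - \<beta>) = 0" by blast+
  \<comment> \<open>If exactly one of \<beta>, \<beta>' is 0, the coefficient of m n would force the
    other to be 1. The exclusion of 1 is essential: V_{\<alpha>,0} and V_{\<alpha>,1} are isomorphic
    when \<alpha> is not an integer.\<close>
  show ?thesis
  proof (cases "\<beta> = 0"; cases "\<beta>' = 0")
    assume "\<beta> = 0" "\<beta>' \<noteq> 0"
    then have "A * \<beta>' * (\<beta>' - 1) = 0" using 2(1) by (simp add: algebra_simps)
    then show ?thesis using assms(2,5) \<open>\<beta>' \<noteq> 0\<close> by simp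
  next
    assume "\<beta> \<noteq> 0" "\<beta>' = 0"
    then have "a * \<beta> * (1 - \<beta>) = 0" using 2(1) by (simp add: algebra_simps)
    then show ?thesis using assms(3,4) \<open>\<beta> \<noteq> 0\<close> \<open>\<beta>' = 0\<close> by simp
  qed (use 1 2(2) assms(2,3) in auto)
qed

lemma complex_strip_unique:
  assumes "0 \<le> Re \<alpha>" "Re \<alpha> < 1" "0 \<le> Re \<alpha>'" "Re \<alpha>' < 1" "\<alpha> + of_int k = \<alpha>' + of_int j"
  shows "j = k \<and> \<alpha> = \<alpha>'"
proof -
  have "Re \<alpha> + of_int k = Re \<alpha>' + of_int j" using arg_cong[OF assms(5), of Re] by simp
  then have "real_of_int \<bar>j - k\<bar> < 1" using assms(1-4) by simp
  then have "j = k" by linarith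
  then show ?thesis using assms(5) by simp
qed

text \<open>Positive generators kill the highest weight vector, so only the series factor moves.
  Positive indices lie in \<open>I\<close> for all parameters.\<close>

lemma (in tensor_series) pure_tensor_act:
  assumes "0 < k"
  shows "0 < n \<Longrightarrow> act T (basis_vec (Vd n)) (pure_tensor k) = (\<alpha> + of_int k + of_int n * \<beta>) \<odot>\<^bsub>T\<^esub> pure_tensor (k + n)"
    "act T (basis_vec (Vd 0)) (pure_tensor k) = (h + \<alpha> + of_int k) \<odot>\<^bsub>T\<^esub> pure_tensor k"
    "act T (basis_vec VC) (pure_tensor k) = c \<odot>\<^bsub>T\<^esub> pure_tensor k"
proof -
  have I: "j \<in> I" if "0 < j" for j using that by (simp add: series_index_def)
  have eqI: "y = z" if "y \<in> carrier T" "z \<in> carrier T" "\<And>j s. tensor_coord y j s = tensor_coord z j s" for y z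
    using inj_onD[OF tensor_coord_inj _ that(1,2)] that(3) by blast
  note k = pure_tensor[OF I[OF assms]]
  show "act T (basis_vec (Vd n)) (pure_tensor k) = (\<alpha> + of_int k + of_int n * \<beta>) \<odot>\<^bsub>T\<^esub> pure_tensor (k + n)"
    if "0 < n"
  proof (rule eqI)
    have kn: "k + n \<in> I" using I assms that by simp
    show "act T (basis_vec (Vd n)) (pure_tensor k) \<in> carrier T"
      "(\<alpha> + of_int k + of_int n * \<beta>) \<odot>\<^bsub>T\<^esub> pure_tensor (k + n) \<in> carrier T"
      by (intro tensor_act tensor_smult pure_tensor kn k)+
    show "tensor_coord (act T (basis_vec (Vd n)) (pure_tensor k)) j s =
        tensor_coord ((\<alpha> + of_int k + of_int n * \<beta>) \<odot>\<^bsub>T\<^esub> pure_tensor (k + n)) j s" for j s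
      using that kn by (auto simp: tensor_act(2)[OF k(1)] tensor_smult(2)[OF pure_tensor(1)[OF kn]] k(2) pure_tensor(2)[OF kn] eps_dg)
  qed
  show "act T (basis_vec (Vd 0)) (pure_tensor k) = (h + \<alpha> + of_int k) \<odot>\<^bsub>T\<^esub> pure_tensor k"
    by (rule eqI) (use I[OF assms] in \<open>auto simp: tensor_act[OF k(1)] tensor_smult[OF k(1)] k(2) eps_dg algebra_simps\<close>)
  show "act T (basis_vec VC) (pure_tensor k) = c \<odot>\<^bsub>T\<^esub> pure_tensor k"
    by (rule eqI) (auto simp: tensor_act[OF k(1)] tensor_smult[OF k(1)] k(2) eps_cg)
qed

lemma tensor_isomorphic_imp_eq:
  fixes c h \<alpha> \<beta> c\<^sub>1 h\<^sub>1 \<alpha>\<^sub>1 \<beta>\<^sub>1 :: complex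
  assumes strip: "0 \<le> Re \<alpha>" "Re \<alpha> < 1" "0 \<le> Re \<alpha>\<^sub>1" "Re \<alpha>\<^sub>1 < 1"
    and not_one: "\<beta> \<noteq> 1" "\<beta>\<^sub>1 \<noteq> 1"
    and iso: "lie_module_isomorphic Vir
      (lie_tensor (simple_highest_weight c h) (intermediate_series' \<alpha> \<beta>))
      (lie_tensor (simple_highest_weight c\<^sub>1 h\<^sub>1) (intermediate_series' \<alpha>\<^sub>1 \<beta>\<^sub>1))"
  shows "c\<^sub>1 = c \<and> h\<^sub>1 = h \<and> \<alpha>\<^sub>1 = \<alpha> \<and> \<beta>\<^sub>1 = \<beta>"
proof -
  obtain \<epsilon> \<epsilon>\<^sub>1 where eps: "vir_hw_functional c h \<epsilon>" "vir_hw_functional c\<^sub>1 h\<^sub>1 \<epsilon>\<^sub>1"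
    using vir_hw_functional_exists by metis
  interpret A: tensor_series c h \<epsilon> \<alpha> \<beta> using eps(1) by (rule tensor_series.intro)
  interpret B: tensor_series c\<^sub>1 h\<^sub>1 \<epsilon>\<^sub>1 \<alpha>\<^sub>1 \<beta>\<^sub>1 using eps(2) by (rule tensor_series.intro)
  obtain f where f_iso: "f \<in> iso (add_monoid A.T) (add_monoid B.T)"
    and f_smult: "\<And>a v. v \<in> carrier A.T \<Longrightarrow> f (a \<odot>\<^bsub>A.T\<^esub> v) = a \<odot>\<^bsub>B.T\<^esub> f v"
    and f_act: "\<And>x v. v \<in> carrier A.T \<Longrightarrow> f (act A.T x v) = act B.T x (f v)"
    using iso by (auto simp: lie_module_isomorphic_def carrier_Vir)
  have f_carrier: "f v \<in> carrier B.T" if "v \<in> carrier A.T" for v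
    using f_iso that by (auto simp: iso_def hom_def)
  have f_inj: "inj_on f (carrier A.T)"
    using f_iso by (auto simp: iso_def bij_betw_def)
  define G where "G k = B.tensor_coord (f (A.pure_tensor k))" for k
  have pure: "A.pure_tensor k \<in> carrier A.T" if "0 < k" for k
    using A.pure_tensor(1) that by (simp add: series_index_def)
  have G_pos: "(\<alpha> + of_int k + of_int n * \<beta>) * G (k + n) j s = G k j (s * dg n) +
      (if j \<in> B.I then (\<alpha>\<^sub>1 + of_int (j - n) + of_int n * \<beta>\<^sub>1) * G k (j - n) s else 0)" if "0 < k" "0 < n" for k n j s
  proof -
    have "B.tensor_coord (f (act A.T (basis_vec (Vd n)) (A.pure_tensor k))) j s =
        B.tensor_coord (f ((\<alpha> + of_int k + of_int n * \<beta>) \<odot>\<^bsub>A.T\<^esub> A.pure_tensor (k + n))) j s"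
      using A.pure_tensor_act(1)[OF that] by simp
    then show ?thesis
      using that by (cases "j \<in> B.I")
        (simp_all add: f_act f_smult pure B.tensor_act B.tensor_smult f_carrier G_def del: of_int_diff)
  qed
  have G_zero: "(h + \<alpha> + of_int k) * G k j s = G k j (s * dg 0) +
      (if j \<in> B.I then (\<alpha>\<^sub>1 + of_int j) * G k j s else 0)" if "0 < k" for k j s
  proof -
    have "B.tensor_coord (f (act A.T (basis_vec (Vd 0)) (A.pure_tensor k))) j s =
        B.tensor_coord (f ((h + \<alpha> + of_int k) \<odot>\<^bsub>A.T\<^esub> A.pure_tensor k)) j s"
      using A.pure_tensor_act(2)[OF that] by simp
    then show ?thesis
      using that by (cases "j \<in> B.I")
        (simp_all add: f_act f_smult pure B.tensor_act B.tensor_smult f_carrier G_def)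
  qed
  have G_C: "c * G k j s = G k j (s * cg)" if "0 < k" for k j s
  proof -
    have "B.tensor_coord (f (act A.T (basis_vec VC) (A.pure_tensor k))) j s =
        B.tensor_coord (f (c \<odot>\<^bsub>A.T\<^esub> A.pure_tensor k)) j s"
      using A.pure_tensor_act(3)[OF that] by simp
    then show ?thesis
      using that by (simp add: f_act f_smult pure B.tensor_act B.tensor_smult f_carrier G_def)
  qed
  \<comment> \<open>The multiple by 0 plays the zero vector, since coordinates of scalar multiples
    are known on both sides of \<open>f\<close>.\<close>
  have G_nonzero: "\<exists>j s. G k j s \<noteq> 0" if k: "0 < k" for k
  proof (rule ccontr)
    assume "\<nexists>j s. G k j s \<noteq> 0"
    then have "B.tensor_coord (f (0 \<odot>\<^bsub>A.T\<^esub> A.pure_tensor k)) = B.tensor_coord (f (A.pure_tensor k))"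
      by (simp add: f_smult pure[OF k] B.tensor_smult f_carrier G_def fun_eq_iff)
    then have "f (0 \<odot>\<^bsub>A.T\<^esub> A.pure_tensor k) = f (A.pure_tensor k)"
      by (rule inj_onD[OF B.tensor_coord_inj]) (auto intro: f_carrier A.tensor_smult pure k)
    then have "0 \<odot>\<^bsub>A.T\<^esub> A.pure_tensor k = A.pure_tensor k"
      by (rule inj_onD[OF f_inj]) (auto intro: A.tensor_smult pure k)
    then have "A.tensor_coord (0 \<odot>\<^bsub>A.T\<^esub> A.pure_tensor k) k 1 = A.tensor_coord (A.pure_tensor k) k 1" by simp
    moreover have "k \<in> A.I" using k by (simp add: series_index_def)
    ultimately show False
      by (simp add: A.tensor_smult pure k A.pure_tensor A.eps_one)
  qed
  have G_finite: "\<exists>S q. finite S \<and> S \<subseteq> B.I \<and> (\<forall>j s. G k j s = (if j \<in> S then \<epsilon>\<^sub>1 (s * q j) else 0))" if "0 < k" for k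
    unfolding G_def by (rule B.tensor_coord_finite[OF f_carrier[OF pure[OF that]]])
  have combine: "P * (Q * z) = r * t" if "P * x = 0" "P * y = t" "Q * z = x + r * y" for P Q r t x y z :: complex
    unfolding that(3) distrib_left that(1) mult.left_commute[of P r] that(2) by simp
  have G_support: "\<alpha>\<^sub>1 = \<alpha> \<and> \<beta>\<^sub>1 = \<beta> \<and> j = k" if k: "0 < k" and nz: "G k j s \<noteq> 0" for k j s
  proof -
    obtain S q where S: "finite S" "S \<subseteq> B.I" "\<And>j s. G k j s = (if j \<in> S then \<epsilon>\<^sub>1 (s * q j) else 0)"
      using G_finite[OF k] by blast
    have j: "j \<in> B.I" using nz S(2,3) by (auto split: if_splits)
    have "\<exists>N. \<forall>j\<in>S. \<forall>n>N. dg n * q j \<in> B.Ann"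
      using S(1)
    proof (induction S)
      case (insert i S)
      then obtain N N' where "\<forall>j\<in>S. \<forall>n>N. dg n * q j \<in> B.Ann" "\<forall>n>N'. dg n * q i \<in> B.Ann"
        using B.Ann.eventually_annihilates[of "q i"] by blast
      then show ?case by (intro exI[of _ "max N N'"]) auto
    qed simp
    then obtain N0 where N0: "\<And>j n. j \<in> S \<Longrightarrow> n > N0 \<Longrightarrow> dg n * q j \<in> B.Ann" by blast
    \<comment> \<open>Beyond \<bar>j\<bar> the shifted indices j + n and j + n + m are positive,
      hence in the index set of the target.\<close>
    define N where "N = max N0 \<bar>j\<bar>"
    have kill: "G k i (s * dg n) = 0" if "n > N" for i s n
    proof (cases "i \<in> S")
      case True
      then have "dg n * q i \<in> B.Ann" using N0 that by (simp add: N_def)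
      then show ?thesis using True by (simp add: S(3) B.Ann_def mult.assoc)
    qed (simp add: S(3))
    have id: "(\<alpha> + of_int k + of_int (n + m) * \<beta>) * ((\<alpha>\<^sub>1 + of_int j + of_int n + of_int m * \<beta>\<^sub>1) * (\<alpha>\<^sub>1 + of_int j + of_int n * \<beta>\<^sub>1)) =
      (\<alpha> + of_int k + of_int n * \<beta>) * (\<alpha> + of_int k + of_int n + of_int m * \<beta>) * (\<alpha>\<^sub>1 + of_int j + of_int (n + m) * \<beta>\<^sub>1)"
      if n: "n > N" and m: "m > N" for n m
    proof -
      have pos: "0 < n" "0 < m" "0 < k + n" "0 < n + m" "n + m > N" and ind: "j + n \<in> B.I" "j + n + m \<in> B.I"
        using n m k by (auto simp: N_def series_index_def)
      \<comment> \<open>The bound \<open>N\<close> belongs to the image with index k. The image with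
        index k + n is accessible only through this multiple, whose factor might be 0 and is
        therefore carried along.\<close>
      have "(\<alpha> + of_int k + of_int n * \<beta>) * G (k + n) (j + n + m) (s * dg m) = 0"
        unfolding G_pos[OF k pos(1)] using kill[OF m] kill[OF n, of _ "s * dg m"] by simp
      moreover have 1: "(\<alpha> + of_int k + of_int n * \<beta>) * G (k + n) (j + n) s = (\<alpha>\<^sub>1 + of_int j + of_int n * \<beta>\<^sub>1) * G k j s"
        unfolding G_pos[OF k pos(1)] using ind(1) kill[OF n] by simp
      moreover have "(\<alpha> + of_int (k + n) + of_int m * \<beta>) * G (k + n + m) (j + n + m) s =
          G (k + n) (j + n + m) (s * dg m) + (\<alpha>\<^sub>1 + of_int (j + n) + of_int m * \<beta>\<^sub>1) * G (k + n) (j + n) s"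
        unfolding G_pos[OF pos(3,2)] using ind(2) by simp
      ultimately have 2: "(\<alpha> + of_int k + of_int n * \<beta>) * ((\<alpha> + of_int (k + n) + of_int m * \<beta>) * G (k + n + m) (j + n + m) s) =
          (\<alpha>\<^sub>1 + of_int (j + n) + of_int m * \<beta>\<^sub>1) * ((\<alpha>\<^sub>1 + of_int j + of_int n * \<beta>\<^sub>1) * G k j s)"
        by (rule combine)
      have 3: "(\<alpha> + of_int k + of_int (n + m) * \<beta>) * G (k + n + m) (j + n + m) s = (\<alpha>\<^sub>1 + of_int j + of_int (n + m) * \<beta>\<^sub>1) * G k j s"
        using G_pos[OF k pos(4), of "j + n + m" s] ind(2) kill[OF pos(5)] by (simp add: add.assoc)
      \<comment> \<open>Facts \<open>2\<close> and \<open>3\<close> give multiples of the same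
        coordinate at k + n + m. Cross multiplication eliminates it and leaves the nonzero number
        \<open>G k j s\<close> to cancel.\<close>
      have "(\<alpha> + of_int k + of_int (n + m) * \<beta>) * ((\<alpha>\<^sub>1 + of_int (j + n) + of_int m * \<beta>\<^sub>1) * ((\<alpha>\<^sub>1 + of_int j + of_int n * \<beta>\<^sub>1) * G k j s)) =
        (\<alpha> + of_int k + of_int n * \<beta>) * ((\<alpha> + of_int (k + n) + of_int m * \<beta>) * ((\<alpha> + of_int k + of_int (n + m) * \<beta>) * G (k + n + m) (j + n + m) s))"
        unfolding 2[symmetric] by (simp only: mult.left_commute)
      then have "((\<alpha> + of_int k + of_int (n + m) * \<beta>) * ((\<alpha>\<^sub>1 + of_int j + of_int n + of_int m * \<beta>\<^sub>1) * (\<alpha>\<^sub>1 + of_int j + of_int n * \<beta>\<^sub>1))) * G k j s =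
      ((\<alpha> + of_int k + of_int n * \<beta>) * (\<alpha> + of_int k + of_int n + of_int m * \<beta>) * (\<alpha>\<^sub>1 + of_int j + of_int (n + m) * \<beta>\<^sub>1)) * G k j s"
        unfolding 3 by (simp only: of_int_add mult.assoc add.assoc)
      then show ?thesis by (simp only: mult_right_cancel[OF nz])
    qed
    have "\<alpha> + of_int k \<noteq> 0"
    proof
      assume "\<alpha> + of_int k = 0"
      then have "Re (\<alpha> + of_int k) = 0" by (simp only: zero_complex.sel)
      then show False using strip(1) k by simp
    qed
    \<comment> \<open>Otherwise the strip condition gives parameters (0,0) and j = 0, the index
      removed from the series.\<close>
    moreover have "\<alpha>\<^sub>1 + of_int j \<noteq> 0 \<or> \<beta>\<^sub>1 \<noteq> 0"
    proof (rule ccontr)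
      assume neg: "\<not> (\<alpha>\<^sub>1 + of_int j \<noteq> 0 \<or> \<beta>\<^sub>1 \<noteq> 0)"
      then have "\<alpha>\<^sub>1 + of_int j = 0 + of_int 0" by simp
      from complex_strip_unique[OF strip(3,4) _ _ this] have "0 = j" "\<alpha>\<^sub>1 = 0" by auto
      then show False using j neg by (simp add: series_index_def)
    qed
    ultimately have "\<alpha> + of_int k = \<alpha>\<^sub>1 + of_int j \<and> \<beta> = \<beta>\<^sub>1"
      using shift_identity[OF id] not_one by blast
    then show ?thesis using complex_strip_unique[OF strip] by auto
  qed
  obtain j0 s0 where nz: "G 1 j0 s0 \<noteq> 0" using G_nonzero[of 1] by auto
  from G_support[OF _ nz] have par: "\<alpha>\<^sub>1 = \<alpha>" "\<beta>\<^sub>1 = \<beta>" and j0: "j0 = 1" by auto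
  obtain S q where S: "\<And>j s. G 1 j s = (if j \<in> S then \<epsilon>\<^sub>1 (s * q j) else 0)"
    using G_finite[of 1] by auto
  define p where "p = q 1"
  have G1: "G 1 1 s = \<epsilon>\<^sub>1 (s * p)" for s
    using nz S[of 1] by (auto simp: j0 p_def split: if_splits)
  have p: "p \<notin> B.Ann" using nz by (auto simp: j0 G1 B.Ann_def)
  have "dg n * p \<in> B.Ann" if "0 < n" for n
  proof -
    have "\<epsilon>\<^sub>1 (s * (dg n * p)) = 0" for s
    proof -
      \<comment> \<open>Each image is supported at its own index only, so in the relation for d_n at
        k = j = 1 just the term with \<open>dg n * p\<close> remains.\<close>
      have "G (1 + n) 1 s = 0" "G 1 (1 - n) s = 0"
        using G_support[of "1 + n" 1 s] G_support[of 1 "1 - n" s] that by auto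
      then show ?thesis using G_pos[of 1 n 1 s] that by (simp add: G1 mult.assoc split: if_split_asm)
    qed
    then show ?thesis by (simp add: B.Ann_def)
  qed
  moreover have "dg 0 * p - scale h p \<in> B.Ann"
  proof -
    have "1 \<in> B.I" by (simp add: series_index_def)
    then have "\<epsilon>\<^sub>1 (s * (dg 0 * p - scale h p)) = 0" for s
      using G_zero[of 1 1 s]
      by (simp add: G1 par right_diff_distrib scale_mult_right B.eps_diff B.eps_scale mult.assoc algebra_simps)
    then show ?thesis by (simp add: B.Ann_def)
  qed
  ultimately have "h = h\<^sub>1" using p by (rule B.singular_weight)
  have "\<epsilon>\<^sub>1 (s * (cg * p - scale c p)) = 0" for s
    using G_C[of 1 1 s] by (simp add: G1 right_diff_distrib scale_mult_right B.eps_diff B.eps_scale mult.assoc)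
  then have "cg * p - scale c p \<in> B.Ann" by (simp add: B.Ann_def)
  then have "c = c\<^sub>1" using p by (rule B.central_charge)
  then show ?thesis using par \<open>h = h\<^sub>1\<close> by simp
qed

lemma lie_module_isomorphic_refl: "lie_module_isomorphic L M M"
  unfolding lie_module_isomorphic_def by (intro bexI[of _ id]) (auto simp: iso_def hom_def)

theorem theorem3:
  fixes c h \<alpha> \<beta> c\<^sub>1 h\<^sub>1 \<alpha>\<^sub>1 \<beta>\<^sub>1 :: complex
  assumes "0 \<le> Re \<alpha>" and "Re \<alpha> < 1"
    and "0 \<le> Re \<alpha>\<^sub>1" and "Re \<alpha>\<^sub>1 < 1"
    and "\<beta> \<noteq> 1" and "\<beta>\<^sub>1 \<noteq> 1"
  shows "lie_module_isomorphic Vir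
      (lie_tensor (simple_highest_weight c h) (intermediate_series' \<alpha> \<beta>))
      (lie_tensor (simple_highest_weight c\<^sub>1 h\<^sub>1) (intermediate_series' \<alpha>\<^sub>1 \<beta>\<^sub>1))
    \<longleftrightarrow> c\<^sub>1 = c \<and> h\<^sub>1 = h \<and> \<alpha>\<^sub>1 = \<alpha> \<and> \<beta>\<^sub>1 = \<beta>"
  using tensor_isomorphic_imp_eq[OF assms] lie_module_isomorphic_refl by blast

end
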